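(* Let $1/2<\alpha<H<1$, let $V_0,\dots,V_d$ be $C_{\mathrm b}^\infty$ vector fields on $\mathbb{R}^e$ and $a\in\mathbb{R}^e$. Assume that $y_T=y(T,a)$ is non-degenerate in the sense of Malliavin. Then the family $$\{\mathbb{Q}^H_{a,b}(A)\mid A\in\mathcal{B}(\tilde C_a^{\alpha\text{-Hld}}(\mathbb{R}^e)),\ b\in\mathbb{R}^e\}$$ is (a version of) the regular conditional probability of $\mathbb{Q}^H_a$ on $\tilde C_a^{\alpha\text{-Hld}}(\mathbb{R}^e)$ given the evaluation map $\Pi_T\colon z\mapsto z_T$ at time $T$. That is, for every $A\in\mathcal{B}(\tilde C_a^{\alpha\text{-Hld}}(\mathbb{R}^e))$ the map $b\mapsto\mathbb{Q}^H_{a,b}(A)$ is Borel measurable, and $$\mathbb{Q}^H_a(A\cap\Pi_T^{-1}(E))=\int_E\mathbb{Q}^H_{a,b}(A)\,[(\Pi_T)_*\mathbb{Q}^H_a](db)\qquad\text{for all }E\in\mathcal{B}(\mathbb{R}^e).$$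
   Context: Notation. Fix $T>0$, $d,e\in\mathbb{N}$. $\mathcal{B}(\cdot)$ is the Borel $\sigma$-field; $C_{\mathrm b}^\infty$ means smooth, bounded, with all derivatives bounded. $\tilde C^{\alpha\text{-Hld}}(V)$ (little Hölder space) is the closure of the $C^1$ paths in the space of $\alpha$-Hölder paths $[0,T]\to V$ with norm $|\varphi_0|+\sup_{s<t}|\varphi_t-\varphi_s|/(t-s)^\alpha$; $\tilde C_a^{\alpha\text{-Hld}}(V)$ is its subset of paths with $\varphi_0=a$. FBM. $\mu^H$ is the law on $\mathcal{W}=\tilde C_0^{\alpha\text{-Hld}}(\mathbb{R}^d)$ of $d$-dimensional fractional Brownian motion with Hurst parameter $H$ (independent components, covariance $\frac12(s^{2H}+t^{2H}-|t-s|^{2H})$); $\mathcal{H}^H$ is its Cameron–Martin space; $w$ is the coordinate process; $(\mathcal{W},\mathcal{H}^H,\mu^H)$ is an abstract Wiener space. Fractional diffusion. For $w\in\mathcal{W}$, $y=\Phi_a(w)\in\tilde C_a^{\alpha\text{-Hld}}(\mathbb{R}^e)$ is the unique solution of the Young differential equation $dy_t=\sum_{j=1}^dV_j(y_t)dw^j_t+V_0(y_t)dt$, $y_0=a$; write $y_t=y(t,a)$. $\mathbb{Q}^H_a=(\Phi_a)_*\mu^H$ is its law. It is known that $y_t\in\mathbf{D}_\infty(\mathbb{R}^e)$. Malliavin calculus on $(\mathcal{W},\mathcal{H}^H,\mu^H)$. $\mathbf{D}_{p,k}$ are the Gaussian Sobolev spaces, $\mathbf{D}_\infty=\bigcap_{p,k}\mathbf{D}_{p,k}$,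 $\mathbf{D}_{-\infty}=\bigcup_{p,k}\mathbf{D}_{p,-k}$. $F\in\mathbf{D}_\infty(\mathbb{R}^e)$ is non-degenerate if its Malliavin covariance matrix $\sigma_F$ satisfies $(\det\sigma_F)^{-1}\in\bigcap_{1<p<\infty}L^p$. Then for $b\in\mathbb{R}^e$ Watanabe's pullback $\delta_b(F)\in\mathbf{D}_{-\infty}$ is characterized by: for each $G\in\mathbf{D}_\infty$, $b\mapsto\mathbb{E}[\delta_b(F)G]:=\langle\delta_b(F),G\rangle$ is continuous and $\mathbb{E}[\chi(F)G]=\int\chi(b)\mathbb{E}[\delta_b(F)G]\,db$ for all Schwartz functions $\chi$. $\delta_b(F)$ is a positive Watanabe distribution, so by Sugita's theorem there is a unique finite Borel measure $\mu_{\delta_b(F)}$ on $\mathcal{W}$ with $\langle\delta_b(F),G\rangle=\int\tilde G\,d\mu_{\delta_b(F)}$ for all $G\in\mathbf{D}_\infty$, where $\tilde G$ is an $\infty$-quasi-continuous modification of $G$ (i.e. for all $q\in(1,\infty),k\in\mathbb{N},\varepsilon>0$, continuous off an open set of $(q,k)$-capacity $<\varepsilon$). Bridge measures. $p(T,a,b)=\mathbb{E}[\delta_b(y_T)]$ is the continuous density of the law of $y_T$. If $p(T,a,b)>0$, $\mu^H_{a,b}$ is the Borel probability measure on $\mathcal{W}$ corresponding to $p(T,a,b)^{-1}\delta_b(y_T)$ and $\mathbb{Q}^H_{a,b}=(\Phi_a)_*\mu^H_{a,b}$. If $p(T,a,b)=0$, $\mathbb{Q}^H_{a,b}$ is the Dirac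 mass at the path $\ell(a,b)_t=a+(b-a)t/T$. *)

theory Defs
  imports "HOL-Probability.Probability"
begin

section \<open>Little Hoelder path spaces\<close>

text \<open>A path on \<open>[0,T]\<close> is encoded as a function on the whole real line that vanishes outside
  \<open>[0,T]\<close>, so that equality of functions is equality of paths.\<close>

type_synonym 'n path = "real \<Rightarrow> real ^ 'n"

definition hoelder_quotients :: "real \<Rightarrow> real \<Rightarrow> 'n::finite path \<Rightarrow> real set" where
  "hoelder_quotients T \<alpha> x =
     {norm (x t - x s) / (t - s) powr \<alpha> | s t. 0 \<le> s \<and> s < t \<and> t \<le> T}"

definition hoelder_norm :: "real \<Rightarrow> real \<Rightarrow> 'n::finite path \<Rightarrow> real" where
  "hoelder_norm T \<alpha> x = norm (x 0) + Sup (hoelder_quotients T \<alpha> x)"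

definition hoelder_paths :: "real \<Rightarrow> real \<Rightarrow> 'n::finite path set" where
  "hoelder_paths T \<alpha> =
     {x. (\<forall>t. t \<notin> {0..T} \<longrightarrow> x t = 0) \<and> bdd_above (hoelder_quotients T \<alpha> x)}"

definition C1_paths :: "real \<Rightarrow> 'n::finite path set" where
  "C1_paths T = {x. (\<forall>t. t \<notin> {0..T} \<longrightarrow> x t = 0) \<and>
     (\<exists>x'. continuous_on {0..T} x' \<and>
           (\<forall>t\<in>{0..T}. (x has_vector_derivative x' t) (at t within {0..T})))}"

definition little_hoelder :: "real \<Rightarrow> real \<Rightarrow> 'n::finite path set" where
  "little_hoelder T \<alpha> = {x \<in> hoelder_paths T \<alpha>.
     \<forall>\<epsilon>>0. \<exists>z\<in>C1_paths T. hoelder_norm T \<alpha> (\<lambda>t. x t - z t) < \<epsilon>}"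

definition little_hoelder_at :: "real \<Rightarrow> real \<Rightarrow> real ^ 'n \<Rightarrow> 'n::finite path set" where
  "little_hoelder_at T \<alpha> a = {x \<in> little_hoelder T \<alpha>. x 0 = a}"

text \<open>The absolute value has no effect on Hoelder paths; it only makes the distance nonnegative
  for arbitrary functions, as \<open>Metric_space\<close> demands.\<close>

definition hoelder_dist :: "real \<Rightarrow> real \<Rightarrow> 'n::finite path \<Rightarrow> 'n path \<Rightarrow> real" where
  "hoelder_dist T \<alpha> x y = \<bar>hoelder_norm T \<alpha> (\<lambda>t. x t - y t)\<bar>"

definition path_topology :: "real \<Rightarrow> real \<Rightarrow> real ^ 'n \<Rightarrow> 'n::finite path topology" where
  "path_topology T \<alpha> a =
     Metric_space.mtopology (little_hoelder_at T \<alpha> a) (hoelder_dist T \<alpha>)"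

definition path_borel :: "real \<Rightarrow> real \<Rightarrow> real ^ 'n \<Rightarrow> 'n::finite path measure" where
  "path_borel T \<alpha> a = sigma (little_hoelder_at T \<alpha> a) {U. openin (path_topology T \<alpha> a) U}"

lemma hoelder_quotient_le:
  assumes "x \<in> hoelder_paths T \<alpha>" "0 \<le> s" "s < t" "t \<le> T"
  shows "norm (x t - x s) / (t - s) powr \<alpha> \<le> Sup (hoelder_quotients T \<alpha> x)"
  using assms by (intro cSup_upper) (auto simp: hoelder_paths_def hoelder_quotients_def)

lemma hoelder_quotients_nonempty:
  assumes "0 < T" shows "hoelder_quotients T \<alpha> x \<noteq> {}"
  using assms by (force simp: hoelder_quotients_def)

lemma hoelder_quotients_bounded_diff:
  assumes "x \<in> hoelder_paths T \<alpha>" "y \<in> hoelder_paths T \<alpha>" "0 \<le> s" "s < t" "t \<le> T"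
  shows "norm ((x t - y t) - (x s - y s)) / (t - s) powr \<alpha>
    \<le> Sup (hoelder_quotients T \<alpha> x) + Sup (hoelder_quotients T \<alpha> y)"
proof -
  have "norm ((x t - y t) - (x s - y s)) \<le> norm (x t - x s) + norm (y t - y s)"
    using norm_triangle_ineq4[of "x t - x s" "y t - y s"] by (simp add: algebra_simps)
  then have "norm ((x t - y t) - (x s - y s)) / (t - s) powr \<alpha>
      \<le> norm (x t - x s) / (t - s) powr \<alpha> + norm (y t - y s) / (t - s) powr \<alpha>"
    by (simp add: divide_right_mono flip: add_divide_distrib)
  then show ?thesis
    using hoelder_quotient_le[OF assms(1,3-5)] hoelder_quotient_le[OF assms(2-5)] by linarith
qed

lemma hoelder_paths_diff:
  assumes "x \<in> hoelder_paths T \<alpha>" "y \<in> hoelder_paths T \<alpha>"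
  shows "(\<lambda>t. x t - y t) \<in> hoelder_paths T \<alpha>"
proof -
  have "bdd_above (hoelder_quotients T \<alpha> (\<lambda>t. x t - y t))"
    unfolding bdd_above_def hoelder_quotients_def
    using hoelder_quotients_bounded_diff[OF assms] by blast
  then show ?thesis using assms by (auto simp: hoelder_paths_def)
qed

lemma hoelder_seminorm_nonneg:
  assumes "0 < T" "x \<in> hoelder_paths T \<alpha>"
  shows "0 \<le> Sup (hoelder_quotients T \<alpha> x)"
  using hoelder_quotient_le[OF assms(2), of 0 T] assms(1)
  by (meson divide_nonneg_nonneg norm_ge_zero order_refl order_trans powr_ge_zero)

lemma Metric_space_little_hoelder:
  fixes a :: "real ^ 'n::finite"
  assumes T: "0 < T"
  shows "Metric_space (little_hoelder_at T \<alpha> a) (hoelder_dist T \<alpha>)"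
proof
  fix x y :: "'n path"
  show "0 \<le> hoelder_dist T \<alpha> x y" by (simp add: hoelder_dist_def)
  show "hoelder_dist T \<alpha> x y = hoelder_dist T \<alpha> y x"
  proof -
    have "norm (x t - y t - (x s - y s)) = norm (y t - x t - (y s - x s))" for s t
      using norm_minus_commute[of "x t - y t" "x s - y s"] by (simp add: algebra_simps)
    then show ?thesis
      by (simp add: hoelder_dist_def hoelder_norm_def hoelder_quotients_def norm_minus_commute)
  qed
next
  fix x y :: "'n path"
  assume "x \<in> little_hoelder_at T \<alpha> a" "y \<in> little_hoelder_at T \<alpha> a"
  then have xy: "x \<in> hoelder_paths T \<alpha>" "y \<in> hoelder_paths T \<alpha>" "x 0 = y 0"
    by (auto simp: little_hoelder_at_def little_hoelder_def)
  let ?z = "\<lambda>t. x t - y t"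
  have z: "?z \<in> hoelder_paths T \<alpha>" using xy by (simp add: hoelder_paths_diff)
  show "hoelder_dist T \<alpha> x y = 0 \<longleftrightarrow> x = y"
  proof
    assume "hoelder_dist T \<alpha> x y = 0"
    then have 0: "Sup (hoelder_quotients T \<alpha> ?z) = 0"
      using xy by (simp add: hoelder_dist_def hoelder_norm_def)
    have "x t = y t" for t
    proof (cases "0 < t \<and> t \<le> T")
      case True
      then have "norm (?z t - ?z 0) / (t - 0) powr \<alpha> \<le> 0"
        using hoelder_quotient_le[OF z, of 0 t] 0 by simp
      then show ?thesis using True xy by (simp add: divide_le_0_iff)
    next
      case False
      then show ?thesis using xy by (cases "t = 0") (auto simp: hoelder_paths_def)
    qed
    then show "x = y" by blast
  next
    assume "x = y"
    then have "hoelder_quotients T \<alpha> ?z = {0}"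
      using T by (force simp: hoelder_quotients_def)
    then show "hoelder_dist T \<alpha> x y = 0"
      using xy by (simp add: hoelder_dist_def hoelder_norm_def)
  qed
next
  fix x y z :: "'n path"
  assume "x \<in> little_hoelder_at T \<alpha> a" "y \<in> little_hoelder_at T \<alpha> a"
    "z \<in> little_hoelder_at T \<alpha> a"
  then have H: "x \<in> hoelder_paths T \<alpha>" "y \<in> hoelder_paths T \<alpha>" "z \<in> hoelder_paths T \<alpha>"
    and 0: "x 0 = a" "y 0 = a" "z 0 = a"
    by (auto simp: little_hoelder_at_def little_hoelder_def)
  let ?S = "\<lambda>u. Sup (hoelder_quotients T \<alpha> u)"
  have xy: "(\<lambda>t. x t - y t) \<in> hoelder_paths T \<alpha>" and zy: "(\<lambda>t. z t - y t) \<in> hoelder_paths T \<alpha>"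
    and yz: "(\<lambda>t. y t - z t) \<in> hoelder_paths T \<alpha>" and xz: "(\<lambda>t. x t - z t) \<in> hoelder_paths T \<alpha>"
    using H by (auto intro: hoelder_paths_diff)
  have "norm (z t - y t - (z s - y s)) = norm (y t - z t - (y s - z s))" for s t
    using norm_minus_commute[of "z t - y t" "z s - y s"] by (simp add: algebra_simps)
  then have sym: "?S (\<lambda>t. z t - y t) = ?S (\<lambda>t. y t - z t)"
    by (simp add: hoelder_quotients_def)
  have "?S (\<lambda>t. x t - z t) \<le> ?S (\<lambda>t. x t - y t) + ?S (\<lambda>t. z t - y t)"
  proof (rule cSup_least[OF hoelder_quotients_nonempty[OF T]])
    fix q assume "q \<in> hoelder_quotients T \<alpha> (\<lambda>t. x t - z t)"
    then obtain s t where "q = norm (x t - z t - (x s - z s)) / (t - s) powr \<alpha>"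
      "0 \<le> s" "s < t" "t \<le> T" by (auto simp: hoelder_quotients_def)
    then show "q \<le> ?S (\<lambda>t. x t - y t) + ?S (\<lambda>t. z t - y t)"
      using hoelder_quotients_bounded_diff[OF xy zy, of s t] by simp
  qed
  then show "hoelder_dist T \<alpha> x z \<le> hoelder_dist T \<alpha> x y + hoelder_dist T \<alpha> y z"
    using hoelder_seminorm_nonneg[OF T xy] hoelder_seminorm_nonneg[OF T yz]
      hoelder_seminorm_nonneg[OF T xz] sym 0
    by (simp add: hoelder_dist_def hoelder_norm_def)
qed


section \<open>Smooth functions\<close>

fun iterated_derivative ::
  "('a::real_normed_vector \<Rightarrow> 'b::real_normed_vector) \<Rightarrow> 'a list \<Rightarrow> 'a \<Rightarrow> 'b" where
  "iterated_derivative f [] x = f x"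
| "iterated_derivative f (v # vs) x = frechet_derivative (iterated_derivative f vs) (at x) v"

definition smooth :: "('a::real_normed_vector \<Rightarrow> 'b::real_normed_vector) \<Rightarrow> bool" where
  "smooth f \<longleftrightarrow> (\<forall>vs x. iterated_derivative f vs differentiable (at x))"

definition C_b_infinity :: "('a::real_normed_vector \<Rightarrow> 'b::real_normed_vector) \<Rightarrow> bool" where
  "C_b_infinity f \<longleftrightarrow> smooth f \<and> (\<forall>vs. bounded (range (iterated_derivative f vs)))"

definition schwartz :: "('a::real_normed_vector \<Rightarrow> real) \<Rightarrow> bool" where
  "schwartz f \<longleftrightarrow> smooth f \<and>
     (\<forall>m vs. bounded (range (\<lambda>x. norm x ^ m * iterated_derivative f vs x)))"


section \<open>Fractional Brownian motion\<close>

definition fbm_cov :: "real \<Rightarrow> real \<Rightarrow> real \<Rightarrow> real" where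
  "fbm_cov H s t = (s powr (2 * H) + t powr (2 * H) - \<bar>t - s\<bar> powr (2 * H)) / 2"

definition centered_gaussian :: "real \<Rightarrow> real measure" where
  "centered_gaussian v =
     (if v = 0 then return borel 0 else density lborel (normal_density 0 (sqrt v)))"

text \<open>The coordinate process is a centered Gaussian process: every finite linear combination
  of the \<open>w\<^sup>i\<^sub>t\<close> is centered Gaussian with the variance given by the covariance.\<close>

definition fbm_law :: "real \<Rightarrow> real \<Rightarrow> real \<Rightarrow> 'd::finite path measure \<Rightarrow> bool" where
  "fbm_law T \<alpha> H \<mu> \<longleftrightarrow>
     prob_space \<mu> \<and> space \<mu> = little_hoelder_at T \<alpha> 0 \<and> sets \<mu> = sets (path_borel T \<alpha> 0) \<and>
     (\<forall>(J :: ('d \<times> real) set) c. finite J \<and> J \<subseteq> UNIV \<times> {0..T} \<longrightarrow>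
        distr \<mu> borel (\<lambda>w. \<Sum>(i, t)\<in>J. c (i, t) * w t $ i) =
        centered_gaussian (\<Sum>(i, s)\<in>J. \<Sum>(j, t)\<in>J.
          if i = j then c (i, s) * c (j, t) * fbm_cov H s t else 0))"


section \<open>Young differential equations\<close>

text \<open>\<open>\<integral>\<^sub>a\<^sup>b f dg\<close> as the limit of Riemann--Stieltjes sums as the mesh tends to 0
  (a constant gauge \<open>\<delta>\<close> controls the mesh).\<close>

definition has_young_integral ::
  "(real \<Rightarrow> 'a::real_normed_vector) \<Rightarrow> (real \<Rightarrow> real) \<Rightarrow> real \<Rightarrow> real \<Rightarrow> 'a \<Rightarrow> bool" where
  "has_young_integral f g a b I \<longleftrightarrow>
     (\<forall>\<epsilon>>0. \<exists>\<delta>>0. \<forall>p. p tagged_division_of {a..b} \<and> (\<lambda>x. ball x \<delta>) fine p \<longrightarrow>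
        norm ((\<Sum>(x, K)\<in>p. (g (Sup K) - g (Inf K)) *\<^sub>R f x) - I) < \<epsilon>)"

definition young_solution ::
  "real \<Rightarrow> real \<Rightarrow> (real ^ 'e \<Rightarrow> real ^ 'e) \<Rightarrow> ('d::finite \<Rightarrow> real ^ 'e \<Rightarrow> real ^ 'e) \<Rightarrow>
   real ^ 'e \<Rightarrow> 'd path \<Rightarrow> 'e::finite path \<Rightarrow> bool" where
  "young_solution T \<alpha> V0 V a w y \<longleftrightarrow>
     y \<in> little_hoelder_at T \<alpha> a \<and>
     (\<forall>t\<in>{0..T}. \<exists>I.
        (\<forall>j. has_young_integral (\<lambda>s. V j (y s)) (\<lambda>s. w s $ j) 0 t (I j)) \<and>
        y t = a + (\<Sum>j\<in>UNIV. I j) + integral {0..t} (\<lambda>s. V0 (y s)))"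


section \<open>Malliavin calculus on the abstract Wiener space\<close>

definition path_dual :: "real \<Rightarrow> real \<Rightarrow> ('d::finite path \<Rightarrow> real) set" where
  "path_dual T \<alpha> = {l.
     (\<forall>x\<in>little_hoelder_at T \<alpha> 0. \<forall>y\<in>little_hoelder_at T \<alpha> 0. \<forall>c.
        l (\<lambda>t. x t + c *\<^sub>R y t) = l x + c * l y) \<and>
     (\<exists>C. \<forall>x\<in>little_hoelder_at T \<alpha> 0. \<bar>l x\<bar> \<le> C * hoelder_norm T \<alpha> x)}"

definition Lp :: "'a measure \<Rightarrow> real \<Rightarrow> ('a \<Rightarrow> real) set" where
  "Lp \<mu> p = {F \<in> borel_measurable \<mu>. integrable \<mu> (\<lambda>w. \<bar>F w\<bar> powr p)}"

definition Lp_null_sequence :: "'a measure \<Rightarrow> real \<Rightarrow> (nat \<Rightarrow> 'a \<Rightarrow> real) \<Rightarrow> bool" where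
  "Lp_null_sequence \<mu> p X \<longleftrightarrow> (\<lambda>n. \<integral>\<^sup>+ w. ennreal (\<bar>X n w\<bar> powr p) \<partial>\<mu>) \<longlonglongrightarrow> 0"

subsection \<open>Cameron--Martin space\<close>

definition first_chaos ::
  "real \<Rightarrow> real \<Rightarrow> 'd::finite path measure \<Rightarrow> ('d path \<Rightarrow> real) set" where
  "first_chaos T \<alpha> \<mu> = {Z \<in> Lp \<mu> 2.
     \<exists>l. (\<forall>n. l n \<in> path_dual T \<alpha>) \<and> Lp_null_sequence \<mu> 2 (\<lambda>n w. Z w - l n w)}"

text \<open>\<open>cm_rep T \<alpha> \<mu> h Z\<close> says that \<open>h = \<integral> Z(w) w \<mu>(dw)\<close> weakly; the map from \<open>Z\<close> (mod null
  sets) to \<open>h\<close> is the isometry from the first chaos onto the Cameron--Martin space.\<close>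

definition cm_rep ::
  "real \<Rightarrow> real \<Rightarrow> 'd::finite path measure \<Rightarrow> 'd path \<Rightarrow> ('d path \<Rightarrow> real) \<Rightarrow> bool" where
  "cm_rep T \<alpha> \<mu> h Z \<longleftrightarrow> Z \<in> first_chaos T \<alpha> \<mu> \<and>
     (\<forall>l\<in>path_dual T \<alpha>. l h = (\<integral>w. Z w * l w \<partial>\<mu>))"

definition cameron_martin :: "real \<Rightarrow> real \<Rightarrow> 'd::finite path measure \<Rightarrow> 'd path set" where
  "cameron_martin T \<alpha> \<mu> = {h \<in> little_hoelder_at T \<alpha> 0. \<exists>Z. cm_rep T \<alpha> \<mu> h Z}"

definition wiener_integral ::
  "real \<Rightarrow> real \<Rightarrow> 'd::finite path measure \<Rightarrow> 'd path \<Rightarrow> 'd path \<Rightarrow> real" where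
  "wiener_integral T \<alpha> \<mu> h = (SOME Z. cm_rep T \<alpha> \<mu> h Z)"

definition cm_inner ::
  "real \<Rightarrow> real \<Rightarrow> 'd::finite path measure \<Rightarrow> 'd path \<Rightarrow> 'd path \<Rightarrow> real" where
  "cm_inner T \<alpha> \<mu> h k =
     (\<integral>w. wiener_integral T \<alpha> \<mu> h w * wiener_integral T \<alpha> \<mu> k w \<partial>\<mu>)"

definition cm_orthonormal ::
  "real \<Rightarrow> real \<Rightarrow> 'd::finite path measure \<Rightarrow> 'd path set \<Rightarrow> bool" where
  "cm_orthonormal T \<alpha> \<mu> E \<longleftrightarrow> E \<subseteq> cameron_martin T \<alpha> \<mu> \<and>
     (\<forall>h\<in>E. \<forall>k\<in>E. cm_inner T \<alpha> \<mu> h k = (if h = k then 1 else 0))"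

text \<open>Hilbert--Schmidt norm of a \<open>j\<close>-linear form \<open>A\<close> on the Cameron--Martin space, given as a
  function of the list of its \<open>j\<close> arguments. It is only used for forms whose norm is finite.\<close>

definition hs_norm ::
  "real \<Rightarrow> real \<Rightarrow> 'd::finite path measure \<Rightarrow> nat \<Rightarrow> ('d path list \<Rightarrow> real) \<Rightarrow> real" where
  "hs_norm T \<alpha> \<mu> j A = sqrt (SUP E\<in>{E. finite E \<and> cm_orthonormal T \<alpha> \<mu> E}.
     \<Sum>hs\<in>{hs. set hs \<subseteq> E \<and> length hs = j}. (A hs)\<^sup>2)"

subsection \<open>Gaussian Sobolev spaces\<close>

text \<open>Polynomials \<open>p(l\<^sub>1(w),\<dots>,l\<^sub>n(w))\<close> in continuous linear functionals.\<close>

inductive_set wiener_poly :: "real \<Rightarrow> real \<Rightarrow> ('d::finite path \<Rightarrow> real) set"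
  for T :: real and \<alpha> :: real where
  const: "(\<lambda>w. c) \<in> wiener_poly T \<alpha>"
| linear: "l \<in> path_dual T \<alpha> \<Longrightarrow> l \<in> wiener_poly T \<alpha>"
| add: "F \<in> wiener_poly T \<alpha> \<Longrightarrow> G \<in> wiener_poly T \<alpha> \<Longrightarrow> (\<lambda>w. F w + G w) \<in> wiener_poly T \<alpha>"
| mult: "F \<in> wiener_poly T \<alpha> \<Longrightarrow> G \<in> wiener_poly T \<alpha> \<Longrightarrow> (\<lambda>w. F w * G w) \<in> wiener_poly T \<alpha>"

text \<open>\<open>H_derivative F [h\<^sub>1,\<dots>,h\<^sub>j] w = D\<^sup>jF(w)[h\<^sub>1,\<dots>,h\<^sub>j]\<close>\<close>

fun H_derivative :: "('d::finite path \<Rightarrow> real) \<Rightarrow> 'd path list \<Rightarrow> 'd path \<Rightarrow> real" where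
  "H_derivative F [] w = F w"
| "H_derivative F (h # hs) w = deriv (\<lambda>s. H_derivative F hs (\<lambda>t. w t + s *\<^sub>R h t)) 0"

definition poly_sobolev_norm ::
  "real \<Rightarrow> real \<Rightarrow> 'd::finite path measure \<Rightarrow> real \<Rightarrow> nat \<Rightarrow> ('d path \<Rightarrow> real) \<Rightarrow> real" where
  "poly_sobolev_norm T \<alpha> \<mu> p k F =
     (\<Sum>j\<le>k. \<integral>w. hs_norm T \<alpha> \<mu> j (\<lambda>hs. H_derivative F hs w) powr p \<partial>\<mu>) powr (1 / p)"

text \<open>Completion of the polynomials: \<open>Fs\<close> is Cauchy for the \<open>(p,k)\<close>-norm with \<open>L\<^sup>p\<close>-limit \<open>F\<close>.\<close>

definition sobolev_approx ::
  "real \<Rightarrow> real \<Rightarrow> 'd::finite path measure \<Rightarrow> real \<Rightarrow> nat \<Rightarrow>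
   (nat \<Rightarrow> 'd path \<Rightarrow> real) \<Rightarrow> ('d path \<Rightarrow> real) \<Rightarrow> bool" where
  "sobolev_approx T \<alpha> \<mu> p k Fs F \<longleftrightarrow>
     (\<forall>n. Fs n \<in> wiener_poly T \<alpha>) \<and> Lp_null_sequence \<mu> p (\<lambda>n w. Fs n w - F w) \<and>
     (\<forall>\<epsilon>>0. \<exists>N. \<forall>m\<ge>N. \<forall>n\<ge>N. poly_sobolev_norm T \<alpha> \<mu> p k (\<lambda>w. Fs m w - Fs n w) < \<epsilon>)"

definition sobolev ::
  "real \<Rightarrow> real \<Rightarrow> 'd::finite path measure \<Rightarrow> real \<Rightarrow> nat \<Rightarrow> ('d path \<Rightarrow> real) set" where
  "sobolev T \<alpha> \<mu> p k = {F \<in> Lp \<mu> p. \<exists>Fs. sobolev_approx T \<alpha> \<mu> p k Fs F}"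

text \<open>By closability of the derivative operators the limit does not depend on the approximating
  sequence, so the infimum is over a singleton.\<close>

definition sobolev_norm ::
  "real \<Rightarrow> real \<Rightarrow> 'd::finite path measure \<Rightarrow> real \<Rightarrow> nat \<Rightarrow> ('d path \<Rightarrow> real) \<Rightarrow> real" where
  "sobolev_norm T \<alpha> \<mu> p k F = Inf {c. \<exists>Fs. sobolev_approx T \<alpha> \<mu> p k Fs F \<and>
     (\<lambda>n. poly_sobolev_norm T \<alpha> \<mu> p k (Fs n)) \<longlonglongrightarrow> c}"

definition D_infinity ::
  "real \<Rightarrow> real \<Rightarrow> 'd::finite path measure \<Rightarrow> ('d path \<Rightarrow> real) set" where
  "D_infinity T \<alpha> \<mu> = (\<Inter>p\<in>{1<..}. \<Inter>k. sobolev T \<alpha> \<mu> p k)"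

text \<open>The Sobolev space of order \<open>(p,-k)\<close> is the dual of that of order \<open>(q,k)\<close>,
  \<open>1/p + 1/q = 1\<close>, in which \<open>D_infinity\<close> is dense; its
  elements are given by their pairings with \<open>D_infinity\<close>.\<close>

definition D_minus_infinity ::
  "real \<Rightarrow> real \<Rightarrow> 'd::finite path measure \<Rightarrow> (('d path \<Rightarrow> real) \<Rightarrow> real) set" where
  "D_minus_infinity T \<alpha> \<mu> = {\<Lambda>.
     (\<forall>F\<in>D_infinity T \<alpha> \<mu>. \<forall>G\<in>D_infinity T \<alpha> \<mu>. \<forall>c. \<Lambda> (\<lambda>w. F w + c * G w) = \<Lambda> F + c * \<Lambda> G) \<and>
     (\<exists>q>1. \<exists>k C. \<forall>G\<in>D_infinity T \<alpha> \<mu>. \<bar>\<Lambda> G\<bar> \<le> C * sobolev_norm T \<alpha> \<mu> q k G)}"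

subsection \<open>Non-degeneracy and Watanabe's pullback\<close>

text \<open>\<open>DF\<close> is (a version of) the \<open>H\<close>-valued Malliavin derivative of \<open>F\<close>.\<close>

definition malliavin_derivative ::
  "real \<Rightarrow> real \<Rightarrow> 'd::finite path measure \<Rightarrow> ('d path \<Rightarrow> real) \<Rightarrow> ('d path \<Rightarrow> 'd path) \<Rightarrow> bool" where
  "malliavin_derivative T \<alpha> \<mu> F DF \<longleftrightarrow>
     (\<forall>w\<in>space \<mu>. DF w \<in> cameron_martin T \<alpha> \<mu>) \<and>
     (\<forall>h\<in>cameron_martin T \<alpha> \<mu>. (\<lambda>w. cm_inner T \<alpha> \<mu> (DF w) h) \<in> borel_measurable \<mu>) \<and>
     (\<exists>Fs. (\<forall>n. Fs n \<in> wiener_poly T \<alpha>) \<and> Lp_null_sequence \<mu> 2 (\<lambda>n w. Fs n w - F w) \<and>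
        Lp_null_sequence \<mu> 2 (\<lambda>n w.
          hs_norm T \<alpha> \<mu> 1 (\<lambda>hs. H_derivative (Fs n) hs w - cm_inner T \<alpha> \<mu> (DF w) (hd hs))))"

definition malliavin_covariance ::
  "real \<Rightarrow> real \<Rightarrow> 'd::finite path measure \<Rightarrow> ('e \<Rightarrow> 'd path \<Rightarrow> 'd path) \<Rightarrow> 'd path \<Rightarrow>
   real ^ 'e ^ 'e::finite" where
  "malliavin_covariance T \<alpha> \<mu> DF w = (\<chi> i j. cm_inner T \<alpha> \<mu> (DF i w) (DF j w))"

definition nondegenerate ::
  "real \<Rightarrow> real \<Rightarrow> 'd::finite path measure \<Rightarrow> ('d path \<Rightarrow> real ^ 'e::finite) \<Rightarrow> bool" where
  "nondegenerate T \<alpha> \<mu> F \<longleftrightarrow>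
     (\<forall>i. (\<lambda>w. F w $ i) \<in> D_infinity T \<alpha> \<mu>) \<and>
     (\<exists>DF. (\<forall>i. malliavin_derivative T \<alpha> \<mu> (\<lambda>w. F w $ i) (DF i)) \<and>
        (AE w in \<mu>. det (malliavin_covariance T \<alpha> \<mu> DF w) \<noteq> 0) \<and>
        (\<forall>p>1. (\<lambda>w. inverse (det (malliavin_covariance T \<alpha> \<mu> DF w))) \<in> Lp \<mu> p))"

text \<open>\<open>\<delta> b\<close> is \<open>\<delta>\<^sub>b(F)\<close>.\<close>

definition watanabe_pullback ::
  "real \<Rightarrow> real \<Rightarrow> 'd::finite path measure \<Rightarrow> ('d path \<Rightarrow> real ^ 'e::finite) \<Rightarrow>
   (real ^ 'e \<Rightarrow> ('d path \<Rightarrow> real) \<Rightarrow> real) \<Rightarrow> bool" where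
  "watanabe_pullback T \<alpha> \<mu> F \<delta> \<longleftrightarrow>
     (\<forall>b. \<delta> b \<in> D_minus_infinity T \<alpha> \<mu>) \<and>
     (\<forall>G\<in>D_infinity T \<alpha> \<mu>. continuous_on UNIV (\<lambda>b. \<delta> b G) \<and>
        (\<forall>\<phi>. schwartz \<phi> \<longrightarrow>
          has_bochner_integral lborel (\<lambda>b. \<phi> b * \<delta> b G) (\<integral>w. \<phi> (F w) * G w \<partial>\<mu>)))"

subsection \<open>Quasi-continuity and Sugita's correspondence\<close>

text \<open>Capacity of an open set \<open>U\<close>.\<close>

definition capacity ::
  "real \<Rightarrow> real \<Rightarrow> 'd::finite path measure \<Rightarrow> real \<Rightarrow> nat \<Rightarrow> 'd path set \<Rightarrow> real" where
  "capacity T \<alpha> \<mu> q k U = Inf {sobolev_norm T \<alpha> \<mu> q k F powr q | F.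
     F \<in> sobolev T \<alpha> \<mu> q k \<and> (AE w in \<mu>. w \<in> U \<longrightarrow> 1 \<le> F w)}"

definition quasi_continuous_modification ::
  "real \<Rightarrow> real \<Rightarrow> 'd::finite path measure \<Rightarrow> ('d path \<Rightarrow> real) \<Rightarrow> ('d path \<Rightarrow> real) \<Rightarrow> bool" where
  "quasi_continuous_modification T \<alpha> \<mu> G G' \<longleftrightarrow>
     G' \<in> borel_measurable \<mu> \<and> (AE w in \<mu>. G' w = G w) \<and>
     (\<forall>q>1. \<forall>k. \<forall>\<epsilon>>0. \<exists>U. openin (path_topology T \<alpha> 0) U \<and> capacity T \<alpha> \<mu> q k U < \<epsilon> \<and>
        continuous_map (subtopology (path_topology T \<alpha> 0) (little_hoelder_at T \<alpha> 0 - U))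
          euclideanreal G')"

definition sugita_measure ::
  "real \<Rightarrow> real \<Rightarrow> 'd::finite path measure \<Rightarrow> (('d path \<Rightarrow> real) \<Rightarrow> real) \<Rightarrow>
   'd path measure \<Rightarrow> bool" where
  "sugita_measure T \<alpha> \<mu> \<Lambda> \<nu> \<longleftrightarrow>
     finite_measure \<nu> \<and> space \<nu> = little_hoelder_at T \<alpha> 0 \<and> sets \<nu> = sets (path_borel T \<alpha> 0) \<and>
     (\<forall>G\<in>D_infinity T \<alpha> \<mu>. \<forall>G'. quasi_continuous_modification T \<alpha> \<mu> G G' \<longrightarrow>
        has_bochner_integral \<nu> G' (\<Lambda> G))"


section \<open>Bridge measures and regular conditional probabilities\<close>

definition linear_path :: "real \<Rightarrow> real ^ 'e \<Rightarrow> real ^ 'e \<Rightarrow> 'e::finite path" where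
  "linear_path T a b t = (if t \<in> {0..T} then a + (t / T) *\<^sub>R (b - a) else 0)"

definition bridge_law ::
  "real \<Rightarrow> real \<Rightarrow> real ^ 'e \<Rightarrow> ('d::finite path \<Rightarrow> 'e::finite path) \<Rightarrow> (real ^ 'e \<Rightarrow> real) \<Rightarrow>
   (real ^ 'e \<Rightarrow> 'd path measure) \<Rightarrow> real ^ 'e \<Rightarrow> 'e path measure" where
  "bridge_law T \<alpha> a \<Phi> p \<mu>b b =
     (if p b > 0 then distr (\<mu>b b) (path_borel T \<alpha> a) \<Phi>
      else return (path_borel T \<alpha> a) (linear_path T a b))"

definition regular_conditional_probability ::
  "'a measure \<Rightarrow> 'b measure \<Rightarrow> ('a \<Rightarrow> 'b) \<Rightarrow> ('b \<Rightarrow> 'a measure) \<Rightarrow> bool" where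
  "regular_conditional_probability Q N f K \<longleftrightarrow>
     (\<forall>b\<in>space N. prob_space (K b) \<and> space (K b) = space Q \<and> sets (K b) = sets Q) \<and>
     (\<forall>A\<in>sets Q. (\<lambda>b. emeasure (K b) A) \<in> borel_measurable N) \<and>
     (\<forall>A\<in>sets Q. \<forall>E\<in>sets N.
        emeasure Q (A \<inter> f -` E) = (\<integral>\<^sup>+ b\<in>E. emeasure (K b) A \<partial>distr Q N f))"

end

theory Submission
  imports Defs
begin

text \<open>Write \<open>F w = \<Phi> w T\<close>. The test functions \<open>G = cos (l(w) + \<theta>)\<close>, with \<open>l\<close> a finite linear combination of
  coordinates \<open>w\<^sup>i\<^sub>t\<close>, are continuous, hence their own quasi-continuous modifications, and they lie in
  \<open>D_infinity\<close> because their Taylor polynomials converge in every Sobolev norm. For such \<open>G\<close>, pairing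
  \<open>\<delta>\<^sub>b(F)\<close> with Schwartz functions shows that \<open>p(b) \<plusminus> \<langle>\<delta>\<^sub>b(F), G\<rangle>\<close> is the density of the image under \<open>F\<close> of
  \<open>(1 \<plusminus> G) \<mu>\<close>. Consequently \<open>\<bar>\<langle>\<delta>\<^sub>b(F), G\<rangle>\<bar> \<le> p(b)\<close>, so that \<open>\<langle>\<delta>\<^sub>b(F), G\<rangle> = p(b) \<integral> G d\<mu>\<^sub>a\<^sub>,\<^sub>b\<close> also where \<open>p\<close>
  vanishes, and \<open>\<integral> G 1\<^sub>E(F) d\<mu> = \<integral>\<^sub>E p(b) (\<integral> G d\<mu>\<^sub>a\<^sub>,\<^sub>b) db\<close>. The span of these \<open>G\<close> is an algebra, and it
  generates the Borel sets of the separable space of little Hoelder paths; a functional monotone class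
  argument extends the identity, as well as measurability in \<open>b\<close>, to all Borel sets. Pushing forward
  along \<open>\<Phi>\<close>, which is continuous by Young's estimates, gives the claim.\<close>

section \<open>A functional monotone class theorem\<close>

text \<open>Sugita's correspondence only speaks about \<open>D_infinity\<close> functionals with a
  quasi-continuous modification, so indicators are out of its direct reach and a generating class of
  test functions has to be verified by hand. Cosines of linear functionals are bounded by 1, which
  makes \<open>1 + r * G\<close> a nonnegative density; the product of two is a combination of two
  others; and the free phase \<theta> absorbs sines as well as derivatives, since each
  differentiation shifts \<theta> by pi/2. Sobolev convergence thereby reduces to Lp convergence of
  scalar Taylor polynomials under a Gaussian law. Two obstacles shape the rest. The bridge measures
  are constrained only where \<open>p\<close> is positive, so identities in b have to carry the
  factor \<open>p b\<close>. The Young integral is given only as a limit of Riemann--Stieltjes sums,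
  so continuity of \<open>\<Phi>\<close> is drawn from dyadic sums by sewing, on short intervals
  first and then chained over [0,T].\<close>

inductive_set bounded_limit_closure :: "'a set \<Rightarrow> ('a \<Rightarrow> real) set \<Rightarrow> ('a \<Rightarrow> real) set"
  for \<Omega> :: "'a set" and M :: "('a \<Rightarrow> real) set" where
  base: "f \<in> M \<Longrightarrow> f \<in> bounded_limit_closure \<Omega> M"
| lin: "f \<in> bounded_limit_closure \<Omega> M \<Longrightarrow> g \<in> bounded_limit_closure \<Omega> M \<Longrightarrow>
    (\<lambda>x. a * f x + b * g x) \<in> bounded_limit_closure \<Omega> M"
| lim: "(\<And>n. F n \<in> bounded_limit_closure \<Omega> M) \<Longrightarrow>
    (\<And>n x. x \<in> \<Omega> \<Longrightarrow> \<bar>F n x\<bar> \<le> C) \<Longrightarrow>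
    (\<And>x. x \<in> \<Omega> \<Longrightarrow> (\<lambda>n. F n x) \<longlonglongrightarrow> f x) \<Longrightarrow> f \<in> bounded_limit_closure \<Omega> M"

text \<open>Products are only asked to land in the closure: the product of two cosines is half the
  sum of two cosines, a combination of members of \<open>M\<close> rather than a member.\<close>

locale multiplicative_class =
  fixes \<Omega> :: "'a set" and M :: "('a \<Rightarrow> real) set"
  assumes bounded_M: "f \<in> M \<Longrightarrow> \<exists>C. \<forall>x\<in>\<Omega>. \<bar>f x\<bar> \<le> C"
    and mult_M: "f \<in> M \<Longrightarrow> g \<in> M \<Longrightarrow> (\<lambda>x. f x * g x) \<in> bounded_limit_closure \<Omega> M"
    and one_M: "(\<lambda>_. 1) \<in> M"
begin

abbreviation "cl \<equiv> bounded_limit_closure \<Omega> M"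

lemma closure_bounded:
  assumes "f \<in> cl" shows "\<exists>C. \<forall>x\<in>\<Omega>. \<bar>f x\<bar> \<le> C"
  using assms
proof induction
  case (base f)
  then show ?case by (rule bounded_M)
next
  case (lin f g a b)
  then obtain C D where C: "\<forall>x\<in>\<Omega>. \<bar>f x\<bar> \<le> C" and D: "\<forall>x\<in>\<Omega>. \<bar>g x\<bar> \<le> D" by blast
  have "\<bar>a * f x + b * g x\<bar> \<le> \<bar>a\<bar> * C + \<bar>b\<bar> * D" if "x \<in> \<Omega>" for x
  proof -
    have "\<bar>a * f x + b * g x\<bar> \<le> \<bar>a\<bar> * \<bar>f x\<bar> + \<bar>b\<bar> * \<bar>g x\<bar>"
      using abs_triangle_ineq[of "a * f x" "b * g x"] by (simp add: abs_mult)
    also have "\<dots> \<le> \<bar>a\<bar> * C + \<bar>b\<bar> * D"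
      using C D that by (intro add_mono mult_left_mono) auto
    finally show ?thesis .
  qed
  then show ?case by blast
next
  case (lim F C f)
  have "\<bar>f x\<bar> \<le> C" if "x \<in> \<Omega>" for x
    using tendsto_rabs[OF lim.hyps(3)[OF that]] lim.hyps(2)[OF that] by (blast intro: LIMSEQ_le_const2)
  then show ?case by blast
qed

text \<open>The \<open>lim\<close> rule sees functions only on \<Omega>, so a constant sequence
  replaces f by any function agreeing with it there; boundedness supplies the constant that the rule
  asks for.\<close>

lemma closure_cong: "f \<in> cl \<Longrightarrow> (\<And>x. x \<in> \<Omega> \<Longrightarrow> g x = f x) \<Longrightarrow> g \<in> cl"
  using closure_bounded[of f] by (fastforce intro: bounded_limit_closure.lim[where F = "\<lambda>_. f"])

text \<open>\<open>mult_M\<close> controls products inside \<open>M\<close> only. One factor is kept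
  in \<open>M\<close> while the other runs through the closure; \<open>closure_mult\<close> then
  lets the first factor vary as well.\<close>

lemma closure_mult_base:
  assumes "f \<in> M" "g \<in> cl" shows "(\<lambda>x. f x * g x) \<in> cl"
  using assms(2)
proof induction
  case (base g)
  then show ?case using mult_M assms(1) by blast
next
  case (lin g h a b)
  have "(\<lambda>x. f x * (a * g x + b * h x)) = (\<lambda>x. a * (f x * g x) + b * (f x * h x))"
    by (simp add: algebra_simps)
  then show ?case using bounded_limit_closure.lin[OF lin(3,4)] by simp
next
  case (lim F C g)
  obtain D where D: "\<forall>x\<in>\<Omega>. \<bar>f x\<bar> \<le> D" using bounded_M[OF assms(1)] by blast
  show ?case
  proof (rule bounded_limit_closure.lim[OF lim.IH])
    show "\<bar>f x * F n x\<bar> \<le> D * C" if "x \<in> \<Omega>" for n x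
      using D lim.hyps(2)[OF that] that by (simp add: abs_mult mult_mono')
    show "(\<lambda>n. f x * F n x) \<longlonglongrightarrow> f x * g x" if "x \<in> \<Omega>" for x
      using lim.hyps(3)[OF that] by (intro tendsto_intros)
  qed
qed

lemma closure_mult:
  assumes "f \<in> cl" "g \<in> cl" shows "(\<lambda>x. f x * g x) \<in> cl"
  using assms(1)
proof induction
  case (base f)
  then show ?case using closure_mult_base assms(2) by blast
next
  case (lin f h a b)
  have "(\<lambda>x. (a * f x + b * h x) * g x) = (\<lambda>x. a * (f x * g x) + b * (h x * g x))"
    by (simp add: algebra_simps)
  then show ?case using bounded_limit_closure.lin[OF lin(3,4)] by simp
next
  case (lim F C f)
  obtain D where D: "\<forall>x\<in>\<Omega>. \<bar>g x\<bar> \<le> D" using closure_bounded[OF assms(2)] by blast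
  show ?case
  proof (rule bounded_limit_closure.lim[OF lim.IH])
    show "\<bar>F n x * g x\<bar> \<le> C * D" if "x \<in> \<Omega>" for n x
      using D lim.hyps(2)[OF that] that by (simp add: abs_mult mult_mono')
    show "(\<lambda>n. F n x * g x) \<longlonglongrightarrow> f x * g x" if "x \<in> \<Omega>" for x
      using lim.hyps(3)[OF that] by (intro tendsto_intros)
  qed
qed

lemma closure_const: "(\<lambda>_. c) \<in> cl"
  using bounded_limit_closure.lin[OF bounded_limit_closure.base[OF one_M]
      bounded_limit_closure.base[OF one_M], of c 0] by simp

lemma closure_add: "f \<in> cl \<Longrightarrow> g \<in> cl \<Longrightarrow> (\<lambda>x. f x + g x) \<in> cl"
  using bounded_limit_closure.lin[of f \<Omega> M g 1 1] by simp

lemma closure_diff: "f \<in> cl \<Longrightarrow> g \<in> cl \<Longrightarrow> (\<lambda>x. f x - g x) \<in> cl"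
  using bounded_limit_closure.lin[of f \<Omega> M g 1 "-1"] by simp

lemma closure_polynomial:
  assumes "real_polynomial_function P" "f \<in> cl" shows "(\<lambda>x. P (f x)) \<in> cl"
  using assms(1)
proof induction
  case (linear L)
  then obtain c where "L = (\<lambda>y. y * c)" using real_bounded_linear by blast
  then have "(\<lambda>x. L (f x)) = (\<lambda>x. c * f x)" by auto
  then show ?case using closure_mult[OF closure_const assms(2), of c] by simp
qed (auto intro: closure_const closure_add closure_mult)

text \<open>The range of f on \<Omega> lies in a compact interval, where Weierstrass approximates h
  uniformly by polynomials; an algebra containing the constants is closed under those.\<close>

lemma closure_continuous:
  assumes h: "continuous_on UNIV (h :: real \<Rightarrow> real)" and f: "f \<in> cl"
  shows "(\<lambda>x. h (f x)) \<in> cl"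
proof -
  obtain C where C: "\<forall>x\<in>\<Omega>. \<bar>f x\<bar> \<le> C" using closure_bounded[OF f] by blast
  have "\<exists>P. real_polynomial_function P \<and> (\<forall>y\<in>{-C..C}. \<bar>h y - P y\<bar> < 1 / Suc n)" for n
    using Stone_Weierstrass_real_polynomial_function[of "{-C..C}" h "1 / Suc n",
        OF _ continuous_on_subset[OF h]] by (metis compact_Icc divide_pos_pos of_nat_0_less_iff
          subset_UNIV zero_less_Suc zero_less_one)
  then obtain P where P: "\<And>n. real_polynomial_function (P n)"
    and Ph: "\<And>n y. y \<in> {-C..C} \<Longrightarrow> \<bar>h y - P n y\<bar> < 1 / Suc n" by metis
  have "bounded (h ` {-C..C})"
    by (intro compact_imp_bounded compact_continuous_image continuous_on_subset[OF h]) auto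
  then obtain D where D: "\<And>y. y \<in> {-C..C} \<Longrightarrow> \<bar>h y\<bar> \<le> D"
    unfolding bounded_iff by (auto simp del: atLeastAtMost_iff)
  have mem: "f x \<in> {-C..C}" if "x \<in> \<Omega>" for x using C that by (auto simp: abs_le_iff)
  show ?thesis
  \<comment> \<open>\<open>D + 1\<close> bounds every approximant because each lies within 1 of h on
    the interval.\<close>
  proof (rule bounded_limit_closure.lim[where F = "\<lambda>n x. P n (f x)" and C = "D + 1"])
    show "(\<lambda>x. P n (f x)) \<in> cl" for n by (rule closure_polynomial[OF P f])
    show "\<bar>P n (f x)\<bar> \<le> D + 1" if "x \<in> \<Omega>" for n x
    proof -
      have "1 / real (Suc n) \<le> 1" by simp
      then show ?thesis using Ph[OF mem[OF that], of n] D[OF mem[OF that]] by linarith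
    qed
    show "(\<lambda>n. P n (f x)) \<longlonglongrightarrow> h (f x)" if "x \<in> \<Omega>" for x
    proof (rule LIM_zero_cancel, rule Lim_null_comparison)
      show "\<forall>\<^sub>F n in sequentially. norm (P n (f x) - h (f x)) \<le> 1 / Suc n"
        using Ph[OF mem[OF that]] by (auto simp: abs_minus_commute less_imp_le)
      show "(\<lambda>n. 1 / real (Suc n)) \<longlonglongrightarrow> 0" using LIMSEQ_inverse_real_of_nat by (simp add: inverse_eq_divide)
    qed
  qed
qed

text \<open>Continuous ramps, steeper with n, increase to the indicator of the open half line; at
  the level c itself every ramp is 0, matching the strict inequality.\<close>

lemma closure_superlevel:
  assumes f: "f \<in> cl" shows "indicator (f -` {c<..} \<inter> \<Omega>) \<in> cl"
proof (rule bounded_limit_closure.lim[where C = 1])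
  fix n :: nat
  show "(\<lambda>x. min 1 (real n * max 0 (f x - c))) \<in> cl"
    by (rule closure_continuous[where h = "\<lambda>y. min 1 (real n * max 0 (y - c))", OF _ f])
      (intro continuous_intros)
  show "\<bar>min 1 (real n * max 0 (f x - c))\<bar> \<le> 1" for x
  proof -
    have "0 \<le> real n * max 0 (f x - c)" by simp
    then show ?thesis by (auto simp: abs_le_iff min_def)
  qed
next
  fix x assume x: "x \<in> \<Omega>"
  show "(\<lambda>n. min 1 (real n * max 0 (f x - c))) \<longlonglongrightarrow> indicator (f -` {c<..} \<inter> \<Omega>) x"
  proof (cases "f x > c")
    case True
    obtain N where N: "1 / (f x - c) < real N" using reals_Archimedean2 by blast
    have "min 1 (real n * max 0 (f x - c)) = 1" if "n \<ge> N" for n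
    proof -
      have "1 / (f x - c) < real n" using N that by linarith
      then show ?thesis using True by (simp add: divide_less_eq max_def)
    qed
    then have "\<forall>\<^sub>F n in sequentially. min 1 (real n * max 0 (f x - c)) = 1"
      using eventually_sequentially by blast
    then show ?thesis using True x by (simp add: tendsto_eventually)
  next
    case False
    then show ?thesis by simp
  qed
qed

text \<open>Since the closure is an algebra, a countable union is reached as 1 minus a limit of
  finite products of complements, which copes with overlapping sets.\<close>

theorem indicator_in_closure:
  assumes "B \<in> sigma_sets \<Omega> {f -` {c<..} \<inter> \<Omega> | f c. f \<in> M}"
  shows "indicator B \<in> cl"
  using assms
proof induction
  case (Basic B)
  then show ?case by (auto intro: closure_superlevel[OF bounded_limit_closure.base])
next
  case Empty
  then show ?case using closure_const[of 0] by (simp add: indicator_def)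
next
  case (Compl B)
  show ?case
    by (rule closure_cong[OF closure_diff[OF closure_const[of 1] Compl(2)]])
      (auto simp: indicator_def)
next
  case (Union B)
  have prod: "(\<lambda>x. \<Prod>i<n. 1 - indicator (B i) x) \<in> cl" for n :: nat
    by (induction n) (auto simp: closure_const intro!: closure_mult closure_diff Union)
  show ?case
  proof (rule bounded_limit_closure.lim[where C = 1])
    fix n :: nat
    show "(\<lambda>x. 1 - (\<Prod>i<n. 1 - indicator (B i) x)) \<in> cl"
      by (intro closure_diff closure_const prod)
    show "\<bar>1 - (\<Prod>i<n. 1 - indicator (B i) x)\<bar> \<le> (1::real)" for x
      using prod_nonneg[of "{..<n}" "\<lambda>i. 1 - indicator (B i) x :: real"]
        prod_le_1[of "{..<n}" "\<lambda>i. 1 - indicator (B i) x :: real"]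
      by (auto simp: abs_le_iff indicator_def)
  next
    fix x
    show "(\<lambda>n. 1 - (\<Prod>i<n. 1 - indicator (B i) x)) \<longlonglongrightarrow> (indicator (\<Union>i. B i) x :: real)"
    proof (cases "x \<in> (\<Union>i. B i)")
      case True
      then obtain j where j: "x \<in> B j" by blast
      have "1 - (\<Prod>i<n. 1 - indicator (B i) x) = (1::real)" if "n \<ge> Suc j" for n
      proof -
        have "(\<Prod>i<n. 1 - indicator (B i) x :: real) = 0"
          using that j by (intro prod_zero) (auto intro!: bexI[of _ j])
        then show ?thesis by simp
      qed
      then have "\<forall>\<^sub>F n in sequentially. 1 - (\<Prod>i<n. 1 - indicator (B i) x) = (1::real)"
        using eventually_sequentially by blast
      then show ?thesis using True by (simp add: tendsto_eventually)
    next
      case False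
      then show ?thesis by (simp add: indicator_def)
    qed
  qed
qed

section \<open>Measurability and weighted integrals of closure elements\<close>

lemma closure_measurable:
  assumes "f \<in> cl" "space N = \<Omega>" "M \<subseteq> borel_measurable N"
  shows "f \<in> borel_measurable N"
  using assms(1)
proof induction
  case (base f)
  then show ?case using assms(3) by blast
next
  case (lin f g a b)
  show ?case using lin.IH by measurable
next
  case (lim F C f)
  show ?case
    by (rule borel_measurable_LIMSEQ_real[where u = F, OF _ lim.IH]) (use lim.hyps(3) assms(2) in blast)
qed

text \<open>The weight h carries the integrability, so N may have infinite mass, as Lebesgue measure
  does in \<open>schwartz_weak_density\<close>.\<close>

lemma closure_weighted_integrable:
  assumes "f \<in> cl" "space N = \<Omega>" "M \<subseteq> borel_measurable N" "integrable N h"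
  shows "integrable N (\<lambda>x. f x * h x :: real)"
proof -
  obtain C where C: "\<forall>x\<in>\<Omega>. \<bar>f x\<bar> \<le> C" using closure_bounded[OF assms(1)] by blast
  show ?thesis
  proof (rule Bochner_Integration.integrable_bound)
    show "integrable N (\<lambda>x. C * h x)" using assms(4) by simp
    show "(\<lambda>x. f x * h x) \<in> borel_measurable N"
      using closure_measurable[OF assms(1-3)] assms(4) by measurable
    show "AE x in N. norm (f x * h x) \<le> norm (C * h x)"
    proof (rule AE_I2)
      fix x assume "x \<in> space N"
      then have "\<bar>f x\<bar> \<le> \<bar>C\<bar>" using C assms(2) by force
      then show "norm (f x * h x) \<le> norm (C * h x)" by (simp add: abs_mult mult_right_mono)
    qed
  qed
qed

lemma closure_weighted_integral_tendsto:
  assumes F: "\<And>n. F n \<in> cl" "\<And>n x. x \<in> \<Omega> \<Longrightarrow> \<bar>F n x\<bar> \<le> C"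
    "\<And>x. x \<in> \<Omega> \<Longrightarrow> (\<lambda>n. F n x) \<longlonglongrightarrow> f x"
    and N: "space N = \<Omega>" "M \<subseteq> borel_measurable N" "integrable N h"
  shows "(\<lambda>n. \<integral>x. F n x * h x \<partial>N) \<longlonglongrightarrow> (\<integral>x. f x * h x \<partial>N :: real)"
proof (rule integral_dominated_convergence[where w = "\<lambda>x. C * \<bar>h x\<bar>"])
  have "f \<in> cl" using F by (rule bounded_limit_closure.lim)
  then show "(\<lambda>x. f x * h x) \<in> borel_measurable N"
    using closure_measurable[OF _ N(1,2)] N(3) by measurable
  show "(\<lambda>x. F n x * h x) \<in> borel_measurable N" for n
    using closure_measurable[OF F(1) N(1,2)] N(3) by measurable
  show "integrable N (\<lambda>x. C * \<bar>h x\<bar>)" using N(3) by simp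
  show "AE x in N. (\<lambda>n. F n x * h x) \<longlonglongrightarrow> f x * h x"
    using F(3) N(1) by (intro AE_I2 tendsto_intros) auto
  show "AE x in N. norm (F n x * h x) \<le> C * \<bar>h x\<bar>" for n
    using F(2)[of _ n] N(1) by (intro AE_I2) (simp add: abs_mult mult_right_mono)
qed

text \<open>Both sides are linear and pass to bounded limits by dominated convergence, so equality
  propagates from \<open>M\<close>. Applied to indicators, it identifies two weighted measures on
  the generated sigma-algebra.\<close>

lemma closure_weighted_integral_eq:
  assumes f: "f \<in> cl"
    and N1: "space N1 = \<Omega>" "M \<subseteq> borel_measurable N1" "integrable N1 h1"
    and N2: "space N2 = \<Omega>" "M \<subseteq> borel_measurable N2" "integrable N2 h2"
    and eq: "\<And>f. f \<in> M \<Longrightarrow> (\<integral>x. f x * h1 x \<partial>N1) = (\<integral>x. f x * h2 x \<partial>N2 :: real)"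
  shows "(\<integral>x. f x * h1 x \<partial>N1) = (\<integral>x. f x * h2 x \<partial>N2)"
  using f
proof induction
  case (base f)
  then show ?case by (rule eq)
next
  case (lin f g a b)
  have *: "(\<integral>x. (a * f x + b * g x) * h x \<partial>N) = a * (\<integral>x. f x * h x \<partial>N) + b * (\<integral>x. g x * h x \<partial>N)"
    if "space N = \<Omega>" "M \<subseteq> borel_measurable N" "integrable N h" for N and h :: "'a \<Rightarrow> real"
    using closure_weighted_integrable[OF lin.hyps(1) that]
      closure_weighted_integrable[OF lin.hyps(2) that]
    by (simp add: distrib_right mult.assoc)
  show ?case by (simp only: *[OF N1] *[OF N2] lin.IH)
next
  case (lim F C f)
  show ?case
    using closure_weighted_integral_tendsto[OF lim.hyps N1]
      closure_weighted_integral_tendsto[OF lim.hyps N2]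
    unfolding lim.IH by (rule LIMSEQ_unique)
qed

end

section \<open>Weak densities tested by Schwartz functions\<close>

text \<open>For a fixed direction u the derivative is again polynomial in x, the form needed for
  iterating directional derivatives.\<close>

lemma real_polynomial_function_has_derivative:
  assumes "real_polynomial_function (P :: 'a::real_normed_vector \<Rightarrow> real)"
  shows "\<exists>P'. (\<forall>u. real_polynomial_function (\<lambda>x. P' x u)) \<and> (\<forall>x. (P has_derivative P' x) (at x))"
  using assms
proof induction
  case (linear f)
  then show ?case
    by (intro exI[of _ "\<lambda>_. f"]) (auto intro: bounded_linear_imp_has_derivative)
next
  case (const c)
  then show ?case by (intro exI[of _ "\<lambda>_ _. 0"]) auto
next
  case (add f g)
  then obtain f' g' where
    "\<forall>u. real_polynomial_function (\<lambda>x. f' x u)" "\<forall>x. (f has_derivative f' x) (at x)"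
    "\<forall>u. real_polynomial_function (\<lambda>x. g' x u)" "\<forall>x. (g has_derivative g' x) (at x)" by blast
  then show ?case
    by (intro exI[of _ "\<lambda>x u. f' x u + g' x u"])
      (auto intro!: has_derivative_add real_polynomial_function.intros(3))
next
  case (mult f g)
  then obtain f' g' where
    "\<forall>u. real_polynomial_function (\<lambda>x. f' x u)" "\<forall>x. (f has_derivative f' x) (at x)"
    "\<forall>u. real_polynomial_function (\<lambda>x. g' x u)" "\<forall>x. (g has_derivative g' x) (at x)" by blast
  then show ?case
    using mult.hyps by (intro exI[of _ "\<lambda>x u. f x * g' x u + f' x u * g x"])
      (auto intro!: has_derivative_mult real_polynomial_function.intros(3) real_polynomial_function.intros(4))
qed

text \<open>The base \<open>1 + norm x\<close> is at least 1, so bounds of different degree can be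
  brought to a common exponent.\<close>

lemma real_polynomial_function_growth:
  assumes "real_polynomial_function (P :: 'a::real_normed_vector \<Rightarrow> real)"
  shows "\<exists>C n. \<forall>x. \<bar>P x\<bar> \<le> C * (1 + norm x) ^ n"
  using assms
proof induction
  case (linear f)
  then obtain K where K: "\<And>x. norm (f x) \<le> norm x * K" "K > 0" by (metis bounded_linear.pos_bounded)
  have "\<bar>f x\<bar> \<le> K * (1 + norm x) ^ 1" for x
    using K(1)[of x] K(2) by (simp add: algebra_simps)
  then show ?case by blast
next
  case (const c)
  have "\<forall>x::'a. \<bar>c\<bar> \<le> \<bar>c\<bar> * (1 + norm x) ^ 0" by simp
  then show ?case by blast
next
  case (add f g)
  then obtain C n D m where f: "\<And>x. \<bar>f x\<bar> \<le> C * (1 + norm x) ^ n"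
    and g: "\<And>x. \<bar>g x\<bar> \<le> D * (1 + norm x) ^ m" by blast
  have "\<bar>f x + g x\<bar> \<le> (\<bar>C\<bar> + \<bar>D\<bar>) * (1 + norm x) ^ (n + m)" for x
  proof -
    have "C * (1 + norm x) ^ n \<le> \<bar>C\<bar> * (1 + norm x) ^ (n + m)"
      "D * (1 + norm x) ^ m \<le> \<bar>D\<bar> * (1 + norm x) ^ (n + m)"
      by (auto intro!: mult_mono power_increasing)
    then show ?thesis using f[of x] g[of x] by (simp add: distrib_right)
  qed
  then show ?case by blast
next
  case (mult f g)
  then obtain C n D m where f: "\<And>x. \<bar>f x\<bar> \<le> C * (1 + norm x) ^ n"
    and g: "\<And>x. \<bar>g x\<bar> \<le> D * (1 + norm x) ^ m" by blast
  have "\<bar>f x * g x\<bar> \<le> (C * D) * (1 + norm x) ^ (n + m)" for x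
    using mult_mono'[OF f[of x] g[of x]] by (simp add: abs_mult power_add mult_ac)
  then show ?case by blast
qed

text \<open>Completing the square; the maximum over r sits at b / (2 \<kappa>).\<close>

lemma exp_linear_minus_square_le:
  fixes \<kappa> :: real assumes "\<kappa> > 0"
  shows "exp (b * r - \<kappa> * r\<^sup>2) \<le> exp (b\<^sup>2 / (4 * \<kappa>))"
proof -
  have "b\<^sup>2 / (4 * \<kappa>) - (b * r - \<kappa> * r\<^sup>2) = (2 * \<kappa> * r - b)\<^sup>2 / (4 * \<kappa>)"
    using assms by (simp add: field_simps power2_eq_square)
  also have "\<dots> \<ge> 0" using assms by simp
  finally show ?thesis by simp
qed

text \<open>All polynomial factors are absorbed into \<open>exp (real (m + n) * norm x)\<close>
  through 1 + r <= exp r, and the quadratic term beats the resulting linear exponent.\<close>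

lemma polynomial_gaussian_bounded:
  assumes "real_polynomial_function (P :: 'a::real_inner \<Rightarrow> real)" "\<kappa> > 0"
  shows "bounded (range (\<lambda>x. norm x ^ m * (P x * exp (v \<bullet> x - \<kappa> * (x \<bullet> x)))))"
proof -
  obtain C n where P: "\<And>x. \<bar>P x\<bar> \<le> C * (1 + norm x) ^ n"
    using real_polynomial_function_growth[OF assms(1)] by blast
  have "norm (norm x ^ m * (P x * exp (v \<bullet> x - \<kappa> * (x \<bullet> x))))
      \<le> \<bar>C\<bar> * exp ((real (m + n) + norm v)\<^sup>2 / (4 * \<kappa>))" for x
  proof -
    have "\<bar>P x\<bar> \<le> \<bar>C\<bar> * (1 + norm x) ^ n"
      using P[of x] by (rule order_trans) (auto intro!: mult_right_mono)
    moreover have "norm x ^ m \<le> (1 + norm x) ^ m" by (intro power_mono) auto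
    ultimately have "norm x ^ m * \<bar>P x\<bar> \<le> (1 + norm x) ^ m * (\<bar>C\<bar> * (1 + norm x) ^ n)"
      by (intro mult_mono) auto
    also have "\<dots> = \<bar>C\<bar> * (1 + norm x) ^ (m + n)" by (simp add: power_add)
    also have "\<dots> \<le> \<bar>C\<bar> * exp (norm x) ^ (m + n)"
      by (intro mult_left_mono power_mono exp_ge_add_one_self) auto
    finally have 1: "norm x ^ m * \<bar>P x\<bar> \<le> \<bar>C\<bar> * exp (real (m + n) * norm x)"
      unfolding exp_of_nat_mult .
    have "v \<bullet> x - \<kappa> * (x \<bullet> x) \<le> norm v * norm x - \<kappa> * (norm x)\<^sup>2"
      using norm_cauchy_schwarz[of v x] by (simp add: power2_norm_eq_inner)
    then have "(norm x ^ m * \<bar>P x\<bar>) * exp (v \<bullet> x - \<kappa> * (x \<bullet> x))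
        \<le> (\<bar>C\<bar> * exp (real (m + n) * norm x)) * exp (norm v * norm x - \<kappa> * (norm x)\<^sup>2)"
      by (intro mult_mono[OF 1]) auto
    also have "\<dots> = \<bar>C\<bar> * exp ((real (m + n) + norm v) * norm x - \<kappa> * (norm x)\<^sup>2)"
      by (simp add: exp_add[symmetric] algebra_simps)
    also have "\<dots> \<le> \<bar>C\<bar> * exp ((real (m + n) + norm v)\<^sup>2 / (4 * \<kappa>))"
      by (intro mult_left_mono exp_linear_minus_square_le assms(2)) auto
    finally show ?thesis by (simp add: abs_mult mult.assoc)
  qed
  then show ?thesis unfolding bounded_iff by blast
qed

text \<open>Differentiating in a direction keeps the shape "polynomial times the same exponential".
  Differentiability is included because \<open>smooth\<close> asks for it at every stage.\<close>

lemma gaussian_iterated_derivative: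
  fixes v :: "'a::real_inner"
  shows "\<exists>P. real_polynomial_function P \<and>
    iterated_derivative (\<lambda>x. exp (v \<bullet> x - \<kappa> * (x \<bullet> x))) vs = (\<lambda>x. P x * exp (v \<bullet> x - \<kappa> * (x \<bullet> x)))
    \<and> (\<forall>x. iterated_derivative (\<lambda>x. exp (v \<bullet> x - \<kappa> * (x \<bullet> x))) vs differentiable (at x))"
proof -
  let ?E = "\<lambda>x. exp (v \<bullet> x - \<kappa> * (x \<bullet> x))"
  have E': "(?E has_derivative (\<lambda>u. ?E x * (v \<bullet> u - \<kappa> * (2 * (x \<bullet> u))))) (at x)" for x
    by (rule derivative_eq_intros refl | simp add: inner_commute mult.commute fun_eq_iff)+
  have D: "((\<lambda>x. P x * ?E x) has_derivative
      (\<lambda>u. (P' x u + P x * (v \<bullet> u - \<kappa> * (2 * (x \<bullet> u)))) * ?E x)) (at x)"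
    if "(P has_derivative P' x) (at x)" for P P' x
    by (rule has_derivative_eq_rhs[OF has_derivative_mult[OF that E']]) (auto simp: algebra_simps)
  have diff: "(\<lambda>x. P x * ?E x) differentiable (at x)" if P: "real_polynomial_function P" for P x
    using real_polynomial_function_has_derivative[OF P] D by (meson differentiableI)
  have "\<exists>P. real_polynomial_function P \<and> iterated_derivative ?E vs = (\<lambda>x. P x * ?E x)"
  proof (induction vs)
    case Nil
    have "real_polynomial_function (\<lambda>x::'a. 1)" by (rule real_polynomial_function.intros)
    then show ?case by (force simp: fun_eq_iff)
  next
    case (Cons u vs)
    then obtain P where P: "real_polynomial_function P"
      and vs: "iterated_derivative ?E vs = (\<lambda>x. P x * ?E x)" by blast
    obtain P' where P': "\<And>u. real_polynomial_function (\<lambda>x. P' x u)"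
      "\<And>x. (P has_derivative P' x) (at x)"
      using real_polynomial_function_has_derivative[OF P] by blast
    let ?Q = "\<lambda>x. P' x u + P x * (v \<bullet> u - \<kappa> * (2 * (x \<bullet> u)))"
    have "iterated_derivative ?E (u # vs) x = ?Q x * ?E x" for x
      using frechet_derivative_at[OF D[of P P' x, OF P'(2)]] by (simp add: vs fun_eq_iff)
    moreover have "real_polynomial_function ?Q"
      by (intro real_polynomial_function.intros P P' real_polynomial_function_diff
          bounded_linear_inner_left)
    ultimately show ?case by blast
  qed
  then obtain P where "real_polynomial_function P" "iterated_derivative ?E vs = (\<lambda>x. P x * ?E x)"
    by blast
  then show ?thesis using diff[of P] by (intro exI[of _ P]) simp
qed

lemma schwartz_gaussian:
  fixes v :: "'a::real_inner"
  assumes "\<kappa> > 0" shows "schwartz (\<lambda>x. exp (v \<bullet> x - \<kappa> * (x \<bullet> x)))"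
  unfolding schwartz_def smooth_def
proof (intro conjI allI)
  show "iterated_derivative (\<lambda>x. exp (v \<bullet> x - \<kappa> * (x \<bullet> x))) vs differentiable at x" for vs x
    using gaussian_iterated_derivative by blast
  fix m vs
  obtain P where P: "real_polynomial_function P"
    "iterated_derivative (\<lambda>x. exp (v \<bullet> x - \<kappa> * (x \<bullet> x))) vs = (\<lambda>x. P x * exp (v \<bullet> x - \<kappa> * (x \<bullet> x)))"
    using gaussian_iterated_derivative by blast
  show "bounded (range (\<lambda>x. norm x ^ m * iterated_derivative (\<lambda>x. exp (v \<bullet> x - \<kappa> * (x \<bullet> x))) vs x))"
    unfolding P(2) by (rule polynomial_gaussian_bounded[OF P(1) assms])
qed

text \<open>Expanding the squared distance shows that a ball around c is a superlevel set of the
  Gaussian with v = 2c and \<kappa> = 1; by Lindeloef every open set is a countable union of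
  balls.\<close>

lemma sets_borel_subset_gaussian_superlevels:
  assumes "G \<in> sets (borel :: 'a::euclidean_space measure)"
  shows "G \<in> sigma_sets UNIV {f -` {c<..} \<inter> UNIV | f c. f \<in> insert (\<lambda>_. 1)
    {\<lambda>x::'a. exp (v \<bullet> x - \<kappa> * (x \<bullet> x)) | v \<kappa>. \<kappa> > (0::real)}}" (is "_ \<in> sigma_sets _ ?S")
proof -
  have ball: "ball c r \<in> ?S" for c r
  proof (cases "r > 0")
    case True
    have "x \<in> ball c r \<longleftrightarrow> exp ((2 *\<^sub>R c) \<bullet> x - 1 * (x \<bullet> x)) > exp (c \<bullet> c - r\<^sup>2)" for x
    proof -
      have "x \<in> ball c r \<longleftrightarrow> (dist c x)\<^sup>2 < r\<^sup>2" using True by (auto intro: power2_less_imp_less power_strict_mono)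
      also have "(dist c x)\<^sup>2 = c \<bullet> c - (2 *\<^sub>R c) \<bullet> x + x \<bullet> x"
        by (simp add: dist_norm power2_norm_eq_inner algebra_simps inner_commute)
      finally show ?thesis by auto
    qed
    then have "ball c r = (\<lambda>x. exp ((2 *\<^sub>R c) \<bullet> x - 1 * (x \<bullet> x))) -` {exp (c \<bullet> c - r\<^sup>2)<..} \<inter> UNIV"
      by auto
    then show ?thesis by (blast intro: zero_less_one)
  next
    case False
    \<comment> \<open>A ball of nonpositive radius is empty, and the constant 1 provides the empty
      superlevel set.\<close>
    then have "ball c r = (\<lambda>_. 1) -` {1::real<..} \<inter> UNIV" by auto
    then show ?thesis by blast
  qed
  have "U \<in> sigma_sets UNIV ?S" if "open U" for U :: "'a set"
  proof -
    obtain r where r: "\<And>x. x \<in> U \<Longrightarrow> r x > 0 \<and> ball x (r x) \<subseteq> U"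
      using \<open>open U\<close> unfolding open_contains_ball by metis
    obtain B where B: "B \<subseteq> (\<lambda>x. ball x (r x)) ` U" "countable B" "\<Union>B = (\<Union>x\<in>U. ball x (r x))"
      by (rule Lindelof[of "(\<lambda>x. ball x (r x)) ` U"]) auto
    have "(\<Union>x\<in>U. ball x (r x)) = U" using r by force
    moreover have "b \<in> sigma_sets UNIV ?S" if "b \<in> B" for b
      using that B(1) ball by (auto intro!: sigma_sets.Basic)
    ultimately show ?thesis using sigma_sets_UNION[OF B(2), of UNIV ?S] B(3) by simp
  qed
  then have "sigma_sets UNIV {U. open U} \<subseteq> sigma_sets UNIV ?S"
    by (intro sigma_sets_mono) auto
  then show ?thesis using assms by (auto simp: borel_def)
qed


text \<open>The constant \<open>1\<close> of the multiplicative class is not known to be integrable against \<open>g\<close>, hence the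
  weight \<open>exp (- (x \<bullet> x))\<close>.\<close>

lemma schwartz_weak_density:
  fixes g :: "'a::euclidean_space \<Rightarrow> real"
  assumes \<nu>: "finite_measure \<nu>" "sets \<nu> = sets borel" and g: "continuous_on UNIV g"
    and weak: "\<And>\<phi>. schwartz \<phi> \<Longrightarrow> has_bochner_integral lborel (\<lambda>b. \<phi> b * g b) (\<integral>x. \<phi> x \<partial>\<nu>)"
  shows "g b \<ge> 0" "\<nu> = density lborel (\<lambda>b. ennreal (g b))"
proof -
  interpret \<nu>: finite_measure \<nu> by (rule \<nu>(1))
  have sp: "space \<nu> = UNIV" using sets_eq_imp_space_eq[OF \<nu>(2)] by simp
  \<comment> \<open>The weight is spelled like a member of the Gaussian family, so that its product
    with any member is again a Gaussian to which \<open>weak\<close> applies.\<close>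
  let ?w = "\<lambda>x::'a. exp (0 \<bullet> x - 1 * (x \<bullet> x))"
  let ?M = "insert (\<lambda>_. 1) {\<lambda>x::'a. exp (v \<bullet> x - \<kappa> * (x \<bullet> x)) | v \<kappa>. \<kappa> > (0::real)}"
  have w01: "0 \<le> ?w x" "?w x \<le> 1" for x by auto
  have meas[measurable]: "(\<lambda>x::'a. exp (v \<bullet> x - \<kappa> * (x \<bullet> x))) \<in> borel_measurable borel" for v \<kappa>
    by (intro borel_measurable_continuous_onI continuous_intros)
  have g_meas[measurable]: "g \<in> borel_measurable borel"
    by (rule borel_measurable_continuous_onI[OF g])
  interpret multiplicative_class UNIV ?M
  proof
    show "(\<lambda>_. 1) \<in> ?M" by simp
    fix f assume f: "f \<in> ?M"
    show "\<exists>C. \<forall>x\<in>UNIV. \<bar>f x\<bar> \<le> C"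
    proof (cases "f = (\<lambda>_. 1)")
      case False
      then obtain v \<kappa> where f: "f = (\<lambda>x. exp (v \<bullet> x - \<kappa> * (x \<bullet> x)))" "\<kappa> > 0" using f by auto
      have "bounded (range (\<lambda>x. norm x ^ 0 * (1 * exp (v \<bullet> x - \<kappa> * (x \<bullet> x)))))"
        by (intro polynomial_gaussian_bounded real_polynomial_function.intros(2) f(2))
      then show ?thesis unfolding bounded_iff f(1) by auto
    qed auto
    fix h assume h: "h \<in> ?M"
    have "(\<lambda>x. f x * h x) \<in> ?M"
    proof (cases "f = (\<lambda>_. 1) \<or> h = (\<lambda>_. 1)")
      case False
      then obtain v \<kappa> u l where *: "f = (\<lambda>x. exp (v \<bullet> x - \<kappa> * (x \<bullet> x)))" "\<kappa> > 0"
        "h = (\<lambda>x. exp (u \<bullet> x - l * (x \<bullet> x)))" "l > 0" using f h by auto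
      have "(\<lambda>x. f x * h x) = (\<lambda>x. exp ((v + u) \<bullet> x - (\<kappa> + l) * (x \<bullet> x)))"
        unfolding * by (simp add: exp_add[symmetric] algebra_simps)
      moreover have "\<kappa> + l > 0" using * by simp
      ultimately show ?thesis by blast
    qed (use f h in auto)
    then show "(\<lambda>x. f x * h x) \<in> bounded_limit_closure UNIV ?M"
      by (rule bounded_limit_closure.base)
  qed
  have M_meas: "?M \<subseteq> borel_measurable lborel" by auto
  have int_w: "integrable lborel (\<lambda>x. ?w x * g x)"
    using weak[OF schwartz_gaussian[of 1 0]] by (auto simp: has_bochner_integral_iff)
  have int_w\<nu>: "integrable \<nu> ?w"
    using w01 meas[of 0 1] \<nu>(2) by (intro \<nu>.integrable_const_bound[of _ 1]) (auto cong: measurable_cong_sets)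
  have eq: "(\<integral>x. indicator B x * (?w x * g x) \<partial>lborel) = (\<integral>x. indicator B x * ?w x \<partial>\<nu>)"
    if B: "B \<in> sets borel" for B
  proof (rule closure_weighted_integral_eq[OF _ _ _ int_w _ _ int_w\<nu>])
    show "indicator B \<in> bounded_limit_closure UNIV ?M"
      by (rule indicator_in_closure[OF sets_borel_subset_gaussian_superlevels[OF B]])
    show "?M \<subseteq> borel_measurable lborel" by (rule M_meas)
    then show "?M \<subseteq> borel_measurable \<nu>" using \<nu>(2) by (simp cong: measurable_cong_sets)
    fix f assume f: "f \<in> ?M"
    show "(\<integral>x. f x * (?w x * g x) \<partial>lborel) = (\<integral>x. f x * ?w x \<partial>\<nu>)"
    proof (cases "f = (\<lambda>_. 1)")
      case True
      then show ?thesis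
        using weak[OF schwartz_gaussian[of 1 0]] by (simp add: has_bochner_integral_iff)
    next
      case False
      then obtain v \<kappa> where *: "f = (\<lambda>x. exp (v \<bullet> x - \<kappa> * (x \<bullet> x)))" "\<kappa> > 0" using f by auto
      have "(\<lambda>x. f x * ?w x) = (\<lambda>x. exp (v \<bullet> x - (\<kappa> + 1) * (x \<bullet> x)))"
        unfolding * by (simp add: exp_add[symmetric] algebra_simps)
      then show ?thesis
        using weak[OF schwartz_gaussian[of "\<kappa> + 1" v]] *(2)
        by (simp add: has_bochner_integral_iff fun_eq_iff mult.assoc[symmetric])
    qed
  qed (use sp in auto)
  \<comment> \<open>If g were negative somewhere, it would be so on an open set U by continuity. The
    weighted integral over U is then at most 0, but it equals an integral against \<nu> and is at
    least 0; so U would be a Lebesgue null set, which a nonempty open set is not.\<close>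
  have nonneg: "g x \<ge> 0" for x
  proof (rule ccontr)
    assume "\<not> g x \<ge> 0"
    define U where "U = {x. g x < 0}"
    have "open U" unfolding U_def by (intro open_Collect_less g continuous_intros)
    then have U[measurable]: "U \<in> sets borel" by simp
    have *: "0 \<le> (\<integral>x. indicator U x * (?w x * g x) \<partial>lborel)"
      unfolding eq[OF U] by (intro Bochner_Integration.integral_nonneg) auto
    define k where "k = (\<lambda>x. - (indicator U x * (?w x * g x)))"
    have k0: "0 \<le> k x" for x
      by (auto simp: k_def U_def indicator_def mult_nonneg_nonpos)
    have "integrable lborel (\<lambda>x. indicator U x * (?w x * g x))"
      by (rule closure_weighted_integrable[OF indicator_in_closure[OF sets_borel_subset_gaussian_superlevels[OF U]]
          _ M_meas int_w]) simp
    then have k: "integrable lborel k" unfolding k_def by (rule Bochner_Integration.integrable_minus)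
    have "integral\<^sup>L lborel k = - (\<integral>x. indicator U x * (?w x * g x) \<partial>lborel)"
      unfolding k_def by (rule Bochner_Integration.integral_minus)
    then have "integral\<^sup>L lborel k \<le> 0" using * by simp
    then have "integral\<^sup>L lborel k = 0"
      using k0 by (intro antisym Bochner_Integration.integral_nonneg) auto
    then have "AE x in lborel. k x = 0"
      using integral_nonneg_eq_0_iff_AE[OF k] k0 by simp
    then have "AE x in lborel. x \<notin> U" by eventually_elim (auto simp: k_def U_def)
    then have "U \<in> null_sets lborel" using U by (simp add: AE_iff_null_sets)
    then have "negligible U" by (simp add: negligible_iff_null_sets null_sets_completionI)
    then show False using open_not_negligible[OF \<open>open U\<close>] \<open>\<not> g x \<ge> 0\<close> by (auto simp: U_def not_le)
  qed
  show "g b \<ge> 0" by (rule nonneg)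
  have "density lborel (\<lambda>x. ennreal (?w x * g x)) = density \<nu> (\<lambda>x. ennreal (?w x))"
  proof (rule measure_eqI)
    fix B assume "B \<in> sets (density lborel (\<lambda>x. ennreal (?w x * g x)))"
    then have B: "B \<in> sets borel" by simp
    then have [measurable]: "B \<in> sets \<nu>" using \<nu>(2) by simp
    note B[measurable]
    have [measurable]: "(\<lambda>x. exp (- (x \<bullet> x))) \<in> borel_measurable \<nu>"
      using meas[of 0 1] \<nu>(2) by (simp cong: measurable_cong_sets)
    have ind: "indicator B \<in> bounded_limit_closure UNIV ?M"
      by (rule indicator_in_closure[OF sets_borel_subset_gaussian_superlevels[OF B]])
    have "emeasure (density lborel (\<lambda>x. ennreal (?w x * g x))) B
        = (\<integral>\<^sup>+x. ennreal (indicator B x * (?w x * g x)) \<partial>lborel)"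
      by (subst emeasure_density) (auto intro!: nn_integral_cong simp: indicator_def)
    also have "\<dots> = ennreal (\<integral>x. indicator B x * (?w x * g x) \<partial>lborel)"
      using closure_weighted_integrable[OF ind _ M_meas int_w] nonneg
      by (intro nn_integral_eq_integral) auto
    also have "\<dots> = ennreal (\<integral>x. indicator B x * ?w x \<partial>\<nu>)" by (simp only: eq[OF B])
    also have "\<dots> = (\<integral>\<^sup>+x. ennreal (indicator B x * ?w x) \<partial>\<nu>)"
    proof (rule nn_integral_eq_integral[symmetric])
      show "integrable \<nu> (\<lambda>x. indicator B x * ?w x)"
        using integrable_real_mult_indicator[OF _ int_w\<nu>, of B] by (simp add: mult.commute)
    qed simp
    also have "\<dots> = emeasure (density \<nu> (\<lambda>x. ennreal (?w x))) B"
      by (subst emeasure_density) (auto intro!: nn_integral_cong simp: indicator_def)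
    finally show "emeasure (density lborel (\<lambda>x. ennreal (?w x * g x))) B
      = emeasure (density \<nu> (\<lambda>x. ennreal (?w x))) B" .
  qed (use \<nu>(2) in simp)
  \<comment> \<open>The reciprocal weight is finite everywhere, so multiplying by it undoes the
    weighting on either side.\<close>
  then have *: "density (density lborel (\<lambda>x. ennreal (?w x * g x))) (\<lambda>x. ennreal (inverse (?w x)))
      = density (density \<nu> (\<lambda>x. ennreal (?w x))) (\<lambda>x. ennreal (inverse (?w x)))" by simp
  have [measurable]: "(\<lambda>x. exp (- (x \<bullet> x))) \<in> borel_measurable \<nu>"
      using meas[of 0 1] \<nu>(2) by (simp cong: measurable_cong_sets)
  have [measurable]: "(\<lambda>x. exp (x \<bullet> x)) \<in> borel_measurable \<nu>"
    using meas[of 0 "-1"] \<nu>(2) by (simp cong: measurable_cong_sets)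
  have "density (density \<nu> (\<lambda>x. ennreal (?w x))) (\<lambda>x. ennreal (inverse (?w x))) = \<nu>"
    by (subst density_density_eq) (auto simp: ennreal_mult[symmetric] exp_minus[symmetric] exp_add[symmetric] density_1)
  moreover have "density (density lborel (\<lambda>x. ennreal (?w x * g x))) (\<lambda>x. ennreal (inverse (?w x)))
      = density lborel (\<lambda>b. ennreal (g b))"
    by (subst density_density_eq) (auto simp: ennreal_mult[symmetric] nonneg mult.commute[of _ "g _"] intro!: density_cong)
  ultimately show "\<nu> = density lborel (\<lambda>b. ennreal (g b))" using * by simp
qed

section \<open>Little Hoelder spaces\<close>

locale hoelder_setting =
  fixes T \<alpha> :: real
  assumes T_pos: "0 < T" and \<alpha>_pos: "0 < \<alpha>" and \<alpha>_le: "\<alpha> \<le> 1"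
begin

abbreviation "paths \<equiv> little_hoelder_at T \<alpha>"
abbreviation "hdist \<equiv> hoelder_dist T \<alpha>"
abbreviation "ptop \<equiv> path_topology T \<alpha>"
abbreviation "pborel \<equiv> path_borel T \<alpha>"
abbreviation "seminorm x \<equiv> Sup (hoelder_quotients T \<alpha> x)"

lemma hoelder_pathsI:
  assumes "\<And>t. t \<notin> {0..T} \<Longrightarrow> x t = 0"
    "\<And>s t. 0 \<le> s \<Longrightarrow> s < t \<Longrightarrow> t \<le> T \<Longrightarrow> norm (x t - x s) \<le> C * (t - s) powr \<alpha>"
  shows "x \<in> hoelder_paths T \<alpha>"
proof -
  have "bdd_above (hoelder_quotients T \<alpha> x)"
    unfolding bdd_above_def hoelder_quotients_def
    by (rule exI[of _ C]) (use assms(2) in \<open>auto simp: divide_le_eq\<close>)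
  then show ?thesis using assms(1) by (simp add: hoelder_paths_def)
qed

lemma hoelder_increment:
  assumes "x \<in> hoelder_paths T \<alpha>" "0 \<le> s" "s \<le> t" "t \<le> T"
  shows "norm (x t - x s) \<le> seminorm x * (t - s) powr \<alpha>"
proof (cases "s = t")
  case False
  then show ?thesis
    using hoelder_quotient_le[OF assms(1,2) _ assms(4)] assms(3) by (simp add: divide_le_eq)
qed simp

lemma hoelder_increment_abs:
  assumes "x \<in> hoelder_paths T \<alpha>" "s \<in> {0..T}" "t \<in> {0..T}"
  shows "norm (x t - x s) \<le> seminorm x * \<bar>t - s\<bar> powr \<alpha>"
proof (cases "s \<le> t")
  case True
  then show ?thesis using hoelder_increment[OF assms(1), of s t] assms(2,3) by simp
next
  case False
  then show ?thesis
    using hoelder_increment[OF assms(1), of t s] assms(2,3)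
    by (simp add: norm_minus_commute abs_minus_commute)
qed

lemma powr_tendsto_bound:
  "\<forall>e>0. \<exists>d>0. \<forall>h::real. \<bar>h\<bar> < d \<longrightarrow> C * \<bar>h\<bar> powr \<alpha> < e"
proof (intro allI impI)
  fix e :: real assume "e > 0"
  define d where "d = (e / (\<bar>C\<bar> + 1)) powr (1 / \<alpha>)"
  have "d > 0" using \<open>e > 0\<close> by (simp add: d_def)
  moreover have "C * \<bar>h\<bar> powr \<alpha> < e" if "\<bar>h\<bar> < d" for h
  proof -
    have "\<bar>h\<bar> powr \<alpha> < d powr \<alpha>" using that \<alpha>_pos by (intro powr_less_mono2) auto
    also have "\<dots> = e / (\<bar>C\<bar> + 1)" using \<open>e > 0\<close> \<alpha>_pos by (simp add: d_def powr_powr)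
    finally have "\<bar>h\<bar> powr \<alpha> * (\<bar>C\<bar> + 1) < e" by (simp add: less_divide_eq add_pos_nonneg)
    moreover have "C * \<bar>h\<bar> powr \<alpha> \<le> \<bar>h\<bar> powr \<alpha> * (\<bar>C\<bar> + 1)"
      by (subst mult.commute) (intro mult_left_mono, auto)
    ultimately show ?thesis by linarith
  qed
  ultimately show "\<exists>d>0. \<forall>h. \<bar>h\<bar> < d \<longrightarrow> C * \<bar>h\<bar> powr \<alpha> < e" by blast
qed

lemma hoelder_continuous:
  assumes "x \<in> hoelder_paths T \<alpha>" shows "continuous_on {0..T} x"
  unfolding continuous_on_iff
proof (intro ballI allI impI)
  fix s e :: real assume s: "s \<in> {0..T}" and "e > 0"
  then obtain d where d: "d > 0"
    "\<And>h::real. \<bar>h\<bar> < d \<Longrightarrow> seminorm x * \<bar>h\<bar> powr \<alpha> < e"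
    using powr_tendsto_bound by meson
  have "dist (x t) (x s) < e" if "t \<in> {0..T}" "dist t s < d" for t
    using hoelder_increment_abs[OF assms s that(1)] d(2)[of "t - s"] that(2)
    by (simp add: dist_norm dist_real_def)
  then show "\<exists>d>0. \<forall>t\<in>{0..T}. dist t s < d \<longrightarrow> dist (x t) (x s) < e" using d(1) by blast
qed

lemma little_hoelder_atD:
  assumes "x \<in> paths a"
  shows "x \<in> hoelder_paths T \<alpha>" "x 0 = a"
  using assms by (auto simp: little_hoelder_at_def little_hoelder_def)

text \<open>The common starting point cancels in the norm term, and the seminorm is nonnegative, so
  the absolute value disappears.\<close>

lemma hoelder_dist_eq:
  assumes "x \<in> paths a" "y \<in> paths a"
  shows "hdist x y = seminorm (\<lambda>t. x t - y t)"
  using hoelder_seminorm_nonneg[OF T_pos hoelder_paths_diff[OF little_hoelder_atD(1)[OF assms(1)]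
        little_hoelder_atD(1)[OF assms(2)]]]
    little_hoelder_atD(2)[OF assms(1)] little_hoelder_atD(2)[OF assms(2)]
  by (simp add: hoelder_dist_def hoelder_norm_def)

lemma hoelder_dist_le:
  assumes "x \<in> paths a" "y \<in> paths a"
    and "\<And>s t. 0 \<le> s \<Longrightarrow> s < t \<Longrightarrow> t \<le> T \<Longrightarrow>
      norm ((x t - y t) - (x s - y s)) \<le> C * (t - s) powr \<alpha>"
  shows "hdist x y \<le> C"
  unfolding hoelder_dist_eq[OF assms(1,2)]
proof (rule cSup_least[OF hoelder_quotients_nonempty[OF T_pos]])
  fix q assume "q \<in> hoelder_quotients T \<alpha> (\<lambda>t. x t - y t)"
  then show "q \<le> C" using assms(3) by (auto simp: hoelder_quotients_def divide_le_eq)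
qed

lemma hoelder_dist_increment:
  assumes "x \<in> paths a" "y \<in> paths a" "0 \<le> s" "s \<le> t" "t \<le> T"
  shows "norm ((x t - y t) - (x s - y s)) \<le> hdist x y * (t - s) powr \<alpha>"
  unfolding hoelder_dist_eq[OF assms(1,2)]
  using hoelder_increment[OF hoelder_paths_diff assms(3-5)] little_hoelder_atD assms(1,2) by blast

lemma hoelder_dist_nonneg: "0 \<le> hdist x y"
  by (simp add: hoelder_dist_def)

lemma hoelder_dist_eval:
  assumes "x \<in> paths a" "y \<in> paths a" "t \<in> {0..T}"
  shows "norm (x t - y t) \<le> hdist x y * T powr \<alpha>"
proof -
  have "norm (x t - y t) \<le> hdist x y * t powr \<alpha>"
    using hoelder_dist_increment[OF assms(1,2), of 0 t] assms(3)
      little_hoelder_atD(2)[OF assms(1)] little_hoelder_atD(2)[OF assms(2)] by simp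
  also have "\<dots> \<le> hdist x y * T powr \<alpha>"
    using assms(3) \<alpha>_pos by (intro mult_left_mono powr_mono2 hoelder_dist_nonneg) auto
  finally show ?thesis .
qed

section \<open>Topology and Borel sets of the path space\<close>

lemma openin_path_topology:
  "openin (ptop a) U \<longleftrightarrow> U \<subseteq> paths a \<and>
    (\<forall>x\<in>U. \<exists>r>0. \<forall>y\<in>paths a. hdist x y < r \<longrightarrow> y \<in> U)"
proof -
  interpret Metric_space "paths a" "hdist"
    by (rule Metric_space_little_hoelder[OF T_pos])
  show ?thesis unfolding path_topology_def openin_mtopology mball_def by blast
qed

lemma topspace_path_topology [simp]: "topspace (ptop a) = paths a"
  unfolding path_topology_def
  using Metric_space.topspace_mtopology[OF Metric_space_little_hoelder[OF T_pos]] .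

lemma path_topology_Pow: "{U. openin (ptop a) U} \<subseteq> Pow (paths a)"
  using openin_subset by fastforce

lemma space_path_borel [simp]: "space (pborel a) = paths a"
  unfolding path_borel_def using path_topology_Pow by (rule space_measure_of)

lemma sets_path_borel:
  "sets (pborel a) = sigma_sets (paths a) {U. openin (ptop a) U}"
  unfolding path_borel_def using path_topology_Pow by (rule sets_measure_of)

lemma continuous_map_path_topologyI:
  fixes f :: "'n::finite path \<Rightarrow> 'b::metric_space"
  assumes "\<And>x e. x \<in> paths a \<Longrightarrow> e > 0 \<Longrightarrow>
    \<exists>d>0. \<forall>y\<in>paths a. hdist x y < d \<longrightarrow> dist (f y) (f x) < e"
  shows "continuous_map (ptop a) euclidean f"
  unfolding continuous_map_def
proof (intro conjI allI impI)
  fix U :: "'b set" assume "openin euclidean U"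
  then have U: "open U" by simp
  show "openin (ptop a) {x \<in> topspace (ptop a). f x \<in> U}"
    unfolding openin_path_topology
  proof (intro conjI ballI)
    fix x assume "x \<in> {x \<in> topspace (ptop a). f x \<in> U}"
    then have x: "x \<in> paths a" "f x \<in> U" by auto
    then obtain e where "e > 0" and e: "\<And>y. dist y (f x) < e \<Longrightarrow> y \<in> U"
      using U unfolding open_dist by blast
    obtain d where "d > 0" and d: "\<And>y. y \<in> paths a \<Longrightarrow>
        hdist x y < d \<Longrightarrow> dist (f y) (f x) < e"
      using assms[OF x(1) \<open>e > 0\<close>] by blast
    then show "\<exists>r>0. \<forall>y\<in>paths a. hdist x y < r \<longrightarrow>
        y \<in> {x \<in> topspace (ptop a). f x \<in> U}"
      using e by (intro exI[of _ d]) auto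
  qed auto
qed auto

lemma continuous_map_measurable_path_borel:
  fixes f :: "'n::finite path \<Rightarrow> 'b::topological_space"
  assumes "continuous_map (ptop a) euclidean f"
  shows "f \<in> borel_measurable (pborel a)"
proof (rule borel_measurableI)
  fix S :: "'b set" assume "open S"
  then have "openin (ptop a) {x \<in> paths a. f x \<in> S}"
    using openin_continuous_map_preimage[OF assms] by simp
  then have "{x \<in> paths a. f x \<in> S} \<in> sets (pborel a)"
    by (auto simp: sets_path_borel)
  then show "f -` S \<inter> space (pborel a) \<in> sets (pborel a)"
    by (simp add: vimage_def Int_def conj_commute)
qed

lemma measurable_path_borelI:
  assumes "f \<in> space N \<rightarrow> paths a"
    and "\<And>U. openin (ptop a) U \<Longrightarrow> f -` U \<inter> space N \<in> sets N"
  shows "f \<in> measurable N (pborel a)"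
  unfolding path_borel_def using assms by (intro measurable_measure_of[OF path_topology_Pow]) auto

lemma measurable_path_borel_continuous:
  fixes f :: "'n::finite path \<Rightarrow> 'm::finite path"
  assumes "\<And>x. x \<in> paths a \<Longrightarrow> f x \<in> paths b"
    and "\<And>x e. x \<in> paths a \<Longrightarrow> e > 0 \<Longrightarrow>
      \<exists>d>0. \<forall>y\<in>paths a. hdist x y < d \<longrightarrow> hdist (f x) (f y) < e"
  shows "f \<in> measurable (pborel a) (pborel b)"
proof (rule measurable_path_borelI)
  fix U :: "'m path set" assume U: "openin (ptop b) U"
  have "openin (ptop a) (f -` U \<inter> paths a)"
    unfolding openin_path_topology
  proof (intro conjI ballI)
    fix x assume x: "x \<in> f -` U \<inter> paths a"
    then obtain r where r: "r > 0"
      "\<And>y. y \<in> paths b \<Longrightarrow> hdist (f x) y < r \<Longrightarrow> y \<in> U"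
      using U unfolding openin_path_topology by blast
    then show "\<exists>r>0. \<forall>y\<in>paths a. hdist x y < r \<longrightarrow>
        y \<in> f -` U \<inter> paths a"
      using assms(2)[of x r] assms(1) x by (metis IntD2 IntI vimageI)
  qed auto
  then show "f -` U \<inter> space (pborel a) \<in> sets (pborel a)"
    by (auto simp: sets_path_borel)
qed (use assms(1) in auto)

lemma continuous_map_eval:
  assumes "t \<in> {0..T}"
  shows "continuous_map (ptop a) euclidean (\<lambda>x. x t)"
proof (rule continuous_map_path_topologyI)
  fix x e assume x: "x \<in> paths a" and "(e::real) > 0"
  have T: "T powr \<alpha> > 0" using T_pos by simp
  have "dist (y t) (x t) < e"
    if y: "y \<in> paths a" and d: "hdist x y < e / T powr \<alpha>" for y
  proof -
    have "norm (x t - y t) < e"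
      using hoelder_dist_eval[OF x y assms] d T by (simp add: less_divide_eq)
    then show ?thesis by (simp add: dist_norm norm_minus_commute)
  qed
  then show "\<exists>d>0. \<forall>y\<in>paths a. hdist x y < d \<longrightarrow> dist (y t) (x t) < e"
    using T \<open>e > 0\<close> by (intro exI[of _ "e / T powr \<alpha>"]) auto
qed

section \<open>Lipschitz estimates, C1 paths and straight lines\<close>

text \<open>As \<alpha> is at most 1, every Lipschitz estimate on [0,T] becomes an \<alpha>-Hoelder
  estimate at the price of a power of T.\<close>

lemma le_powr_hoelder:
  assumes "0 \<le> d" "d \<le> T" shows "d \<le> T powr (1 - \<alpha>) * d powr \<alpha>"
proof (cases "d = 0")
  case False
  then have "d = d powr (1 - \<alpha>) * d powr \<alpha>" using assms by (simp add: powr_add[symmetric])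
  also have "\<dots> \<le> T powr (1 - \<alpha>) * d powr \<alpha>"
    using assms \<alpha>_le by (intro mult_right_mono powr_mono2) auto
  finally show ?thesis .
qed simp

lemma vector_derivative_increment_bound:
  fixes z :: "real \<Rightarrow> 'b::real_normed_vector"
  assumes "\<And>u. u \<in> {0..T} \<Longrightarrow> (z has_vector_derivative z' u) (at u within {0..T})"
    and "\<And>u. u \<in> {0..T} \<Longrightarrow> norm (z' u) \<le> B"
    and "s \<in> {0..T}" "t \<in> {0..T}"
  shows "norm (z t - z s) \<le> B * \<bar>t - s\<bar>"
proof -
  have "norm (z t - z s) \<le> B * norm (t - s)"
  proof (rule differentiable_bound[where S = "{0..T}" and f' = "\<lambda>u v. v *\<^sub>R z' u"])
    show "onorm (\<lambda>v. v *\<^sub>R z' u) \<le> B" if "u \<in> {0..T}" for u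
      using mult_left_mono[OF assms(2)[OF that] abs_ge_zero]
      by (intro onorm_le) (simp add: mult.commute)
  qed (use assms in \<open>auto simp: has_vector_derivative_def\<close>)
  then show ?thesis by simp
qed

lemma C1_paths_hoelder:
  assumes "z \<in> C1_paths T" shows "z \<in> hoelder_paths T \<alpha>"
proof -
  obtain z' where z': "continuous_on {0..T} z'"
    "\<And>t. t \<in> {0..T} \<Longrightarrow> (z has_vector_derivative z' t) (at t within {0..T})"
    using assms unfolding C1_paths_def by blast
  have "bounded (z' ` {0..T})"
    by (intro compact_imp_bounded compact_continuous_image z'(1)) auto
  then obtain B where B: "B > 0" "\<And>u. u \<in> {0..T} \<Longrightarrow> norm (z' u) \<le> B"
    unfolding bounded_pos by (auto simp del: atLeastAtMost_iff)
  show ?thesis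
  proof (rule hoelder_pathsI)
    fix s t assume st: "0 \<le> s" "s < t" "t \<le> T"
    have "norm (z t - z s) \<le> B * \<bar>t - s\<bar>"
      by (rule vector_derivative_increment_bound[OF z'(2) B(2)]) (use st in auto)
    also have "\<dots> \<le> B * (T powr (1 - \<alpha>) * \<bar>t - s\<bar> powr \<alpha>)"
      using st B(1) by (intro mult_left_mono le_powr_hoelder) auto
    finally show "norm (z t - z s) \<le> (B * T powr (1 - \<alpha>)) * (t - s) powr \<alpha>"
      using st by (simp add: mult.assoc)
  qed (use assms in \<open>simp add: C1_paths_def\<close>)
qed

lemma linear_path_mem: "linear_path T a b \<in> paths a"
proof -
  let ?l = "linear_path T a b"
  have C1: "?l \<in> C1_paths T"
  proof -
    have "((\<lambda>t. a + (t / T) *\<^sub>R (b - a)) has_vector_derivative (1 / T) *\<^sub>R (b - a)) (at t within {0..T})" for t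
      by (auto intro!: derivative_eq_intros simp: divide_inverse)
    then have "(?l has_vector_derivative (1 / T) *\<^sub>R (b - a)) (at t within {0..T})" if "t \<in> {0..T}" for t
      using that by (auto intro: has_vector_derivative_transform simp: linear_path_def)
    then show ?thesis
      unfolding C1_paths_def by (auto simp: linear_path_def intro!: exI[of _ "\<lambda>_. (1 / T) *\<^sub>R (b - a)"])
  qed
  note H = C1_paths_hoelder[OF C1]
  have "hoelder_quotients T \<alpha> (\<lambda>t. 0 :: real ^ 'a) = {0}"
    using T_pos by (force simp: hoelder_quotients_def)
  then have "hoelder_norm T \<alpha> (\<lambda>t. ?l t - ?l t) = 0"
    by (simp add: hoelder_norm_def)
  then show ?thesis
    using C1 H T_pos unfolding little_hoelder_at_def little_hoelder_def
    by (force simp: linear_path_def)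
qed

text \<open>The line depends on its endpoint in a Lipschitz way. This makes the Dirac part of
  \<open>bridge_law\<close> measurable in b.\<close>

lemma linear_path_measurable:
  "linear_path T a \<in> measurable borel (pborel (a :: real ^ 'n::finite))"
proof (rule measurable_path_borelI)
  fix U :: "'n path set" assume U: "openin (ptop a) U"
  have dist: "hdist (linear_path T a b) (linear_path T a c)
      \<le> dist c b * (1 / T * T powr (1 - \<alpha>))" for b c
  proof (rule hoelder_dist_le[OF linear_path_mem linear_path_mem])
    fix s t assume st: "0 \<le> s" "s < t" "t \<le> T"
    then have "(linear_path T a b t - linear_path T a c t) - (linear_path T a b s - linear_path T a c s)
        = ((t - s) / T) *\<^sub>R (b - c)"
      by (simp add: linear_path_def algebra_simps diff_divide_distrib)
    then have "norm ((linear_path T a b t - linear_path T a c t) - (linear_path T a b s - linear_path T a c s))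
        = (dist c b / T) * (t - s)"
      using st T_pos by (simp add: dist_norm norm_minus_commute)
    also have "\<dots> \<le> (dist c b / T) * (T powr (1 - \<alpha>) * (t - s) powr \<alpha>)"
      using st T_pos by (intro mult_left_mono le_powr_hoelder) auto
    finally show "norm ((linear_path T a b t - linear_path T a c t) - (linear_path T a b s - linear_path T a c s))
        \<le> dist c b * (1 / T * T powr (1 - \<alpha>)) * (t - s) powr \<alpha>"
      by (simp add: mult.assoc)
  qed
  have pos: "1 / T * T powr (1 - \<alpha>) > 0" using T_pos by simp
  have "open (linear_path T a -` U)"
    unfolding open_dist
  proof
    fix b assume "b \<in> linear_path T a -` U"
    then obtain r where r: "r > 0"
      "\<And>y. y \<in> paths a \<Longrightarrow> hdist (linear_path T a b) y < r \<Longrightarrow> y \<in> U"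
      using U unfolding openin_path_topology by blast
    have "linear_path T a c \<in> U" if "dist c b < r / (1 / T * T powr (1 - \<alpha>))" for c
    proof (rule r(2)[OF linear_path_mem])
      have "dist c b * (1 / T * T powr (1 - \<alpha>)) < r" using that pos by (simp only: less_divide_eq)
      then show "hdist (linear_path T a b) (linear_path T a c) < r"
        using dist[of b c] by linarith
    qed
    then show "\<exists>e>0. \<forall>c. dist c b < e \<longrightarrow> c \<in> linear_path T a -` U"
      using divide_pos_pos[OF r(1) pos] by (intro exI[of _ "r / (1 / T * T powr (1 - \<alpha>))"]) simp
  qed
  then show "linear_path T a -` U \<inter> space borel \<in> sets borel" by simp
qed (use linear_path_mem in auto)


section \<open>Countable approximation and evaluation maps\<close>

text \<open>The inequality is closed in s and t, so it extends by continuity, one variable at a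
  time, from the rationals of the open interval, whose closure is all of [0,T].\<close>

lemma increment_bound_rational:
  fixes z :: "real \<Rightarrow> 'b::real_normed_vector"
  assumes z: "continuous_on {0..T} z"
    and le: "\<And>s t. s \<in> \<rat> \<inter> {0<..<T} \<Longrightarrow> t \<in> \<rat> \<inter> {0<..<T} \<Longrightarrow>
      norm (z t - z s) \<le> r * \<bar>t - s\<bar> powr \<alpha>"
    and st: "s \<in> {0..T}" "t \<in> {0..T}"
  shows "norm (z t - z s) \<le> r * \<bar>t - s\<bar> powr \<alpha>"
proof -
  have cl: "closure (\<rat> \<inter> {0<..<T}) = {0..T}"
    using closure_open_Int_superset[of "{0<..<T}" "\<rat>"] T_pos
    by (simp add: Rats_closure_real Int_commute)
  have cont: "continuous_on {0..T} (\<lambda>u. norm (z u - z v) - r * \<bar>u - v\<bar> powr \<alpha>)" for v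
    using \<alpha>_pos by (intro continuous_intros z continuous_on_powr') auto
  have 1: "norm (z u - z v) - r * \<bar>u - v\<bar> powr \<alpha> \<le> 0"
    if "v \<in> \<rat> \<inter> {0<..<T}" "u \<in> {0..T}" for u v
    by (rule continuous_le_on_closure[of "\<rat> \<inter> {0<..<T}"]) (use cont cl that le in auto)
  have "norm (z s - z t) - r * \<bar>s - t\<bar> powr \<alpha> \<le> 0"
  proof (rule continuous_le_on_closure[of "\<rat> \<inter> {0<..<T}" "\<lambda>u. norm (z u - z t) - r * \<bar>u - t\<bar> powr \<alpha>"])
    show "norm (z u - z t) - r * \<bar>u - t\<bar> powr \<alpha> \<le> 0" if "u \<in> \<rat> \<inter> {0<..<T}" for u
      using 1[OF that st(2)] by (simp add: norm_minus_commute abs_minus_commute)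
  qed (use cont cl st in auto)
  then show ?thesis by (simp add: norm_minus_commute abs_minus_commute)
qed

text \<open>Primitives of polynomials with rational coefficients. Approximation takes place at the
  level of the derivative, where uniform closeness yields Lipschitz and hence Hoelder closeness of
  the primitives; lists of rationals keep the family countable.\<close>

definition poly_path :: "('n::finite \<Rightarrow> rat list) \<Rightarrow> 'n path" where
  "poly_path q t =
     integral {0..t} (\<lambda>u. \<chi> i. \<Sum>k<length (q i). of_rat (q i ! k) * u ^ k)"

lemma continuous_on_rat_poly: "continuous_on A (\<lambda>u::real. \<chi> i. \<Sum>k<length (q i). of_rat (q i ! k) * u ^ k)"
  by (intro continuous_on_vec_lambda continuous_intros)

lemma poly_path_derivative:
  assumes "t \<in> {0..T}"
  shows "(poly_path q has_vector_derivative (\<chi> i. \<Sum>k<length (q i). of_rat (q i ! k) * t ^ k))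
    (at t within {0..T})"
  unfolding poly_path_def
  by (rule integral_has_vector_derivative[OF continuous_on_rat_poly assms])

lemma rat_poly_approx:
  fixes f :: "real \<Rightarrow> real"
  assumes f: "continuous_on {0..T} f" and "e > 0"
  shows "\<exists>q. \<forall>u\<in>{0..T}. \<bar>f u - (\<Sum>k<length q. of_rat (q ! k) * u ^ k)\<bar> < e"
proof -
  obtain g where g: "real_polynomial_function g" "\<And>u. u \<in> {0..T} \<Longrightarrow> \<bar>f u - g u\<bar> < e / 2"
    using Stone_Weierstrass_real_polynomial_function[OF compact_Icc f, of "e / 2"] \<open>e > 0\<close> by auto
  obtain a n where a: "g = (\<lambda>u. \<Sum>k\<le>n. a k * u ^ k)"
    using g(1) unfolding real_polynomial_function_iff_sum by blast
  have cancel: "e / 2 / X * X = e / 2" if "X > 0" for X :: real using that by simp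
  \<comment> \<open>The n + 1 coefficients, each off by less than h and multiplied by a power of u
    of size at most \<open>max 1 T ^ n\<close>, together cost e / 2.\<close>
  define h where "h = e / 2 / (real (Suc n) * max 1 T ^ n)"
  have D: "real (Suc n) * max 1 T ^ n > 0" by (intro mult_pos_pos zero_less_power) auto
  have "h > 0" unfolding h_def using \<open>e > 0\<close> D by (intro divide_pos_pos) auto
  have "\<exists>r::rat. \<bar>a k - of_rat r\<bar> < h" for k
  proof -
    obtain r where "a k - h < of_rat r" "of_rat r < a k + h"
      using of_rat_dense[of "a k - h" "a k + h"] \<open>h > 0\<close> by auto
    then show ?thesis by (intro exI[of _ r]) (simp add: abs_less_iff)
  qed
  then obtain r :: "nat \<Rightarrow> rat" where r: "\<And>k. \<bar>a k - of_rat (r k)\<bar> < h" by metis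
  let ?q = "map r [0..<Suc n]"
  have "\<bar>f u - (\<Sum>k<length ?q. of_rat (?q ! k) * u ^ k)\<bar> < e" if u: "u \<in> {0..T}" for u
  proof -
    have eq: "(\<Sum>k<length ?q. of_rat (?q ! k) * u ^ k) = (\<Sum>k\<le>n. of_rat (r k) * u ^ k)"
      unfolding lessThan_Suc_atMost[symmetric] by (intro sum.cong) (auto simp del: upt_Suc)
    have "\<bar>g u - (\<Sum>k\<le>n. of_rat (r k) * u ^ k)\<bar> = \<bar>\<Sum>k\<le>n. (a k - of_rat (r k)) * u ^ k\<bar>"
      unfolding a by (simp add: sum_subtractf left_diff_distrib)
    also have "\<dots> \<le> (\<Sum>k\<le>n. \<bar>(a k - of_rat (r k)) * u ^ k\<bar>)" by (rule sum_abs)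
    also have "\<dots> \<le> (\<Sum>k\<le>n. h * max 1 T ^ n)"
    proof (rule sum_mono)
      fix k assume "k \<in> {..n}"
      have "u ^ k \<le> max 1 T ^ k" using u by (intro power_mono) auto
      also have "\<dots> \<le> max 1 T ^ n" using \<open>k \<in> {..n}\<close> by (intro power_increasing) auto
      finally show "\<bar>(a k - of_rat (r k)) * u ^ k\<bar> \<le> h * max 1 T ^ n"
        unfolding abs_mult using u r[of k] by (intro mult_mono) auto
    qed
    also have "\<dots> = h * (real (Suc n) * max 1 T ^ n)" by simp
    also have "\<dots> = e / 2" unfolding h_def using D by (rule cancel)
    finally show ?thesis using g(2)[OF u] unfolding eq by linarith
  qed
  then show ?thesis by blast
qed

text \<open>A little Hoelder path is within e/2 of some C1 path, whose derivative is uniformly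
  approximated by rational polynomials. Only increments are compared, so the starting points may
  differ.\<close>

lemma poly_path_dense:
  fixes x :: "'n::finite path"
  assumes x: "x \<in> paths a" and "e > 0"
  shows "\<exists>q. \<forall>s\<in>{0..T}. \<forall>t\<in>{0..T}.
    norm ((x t - poly_path q t) - (x s - poly_path q s)) \<le> e * \<bar>t - s\<bar> powr \<alpha>"
proof -
  obtain z where z: "z \<in> C1_paths T" "hoelder_norm T \<alpha> (\<lambda>t. x t - z t) < e / 2"
    using x \<open>e > 0\<close> unfolding little_hoelder_at_def little_hoelder_def by (auto dest: spec[of _ "e / 2"])
  obtain z' where z': "continuous_on {0..T} z'"
    "\<And>t. t \<in> {0..T} \<Longrightarrow> (z has_vector_derivative z' t) (at t within {0..T})"
    using z(1) unfolding C1_paths_def by blast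
  have cancel: "e / 2 / X * X = e / 2" if "X > 0" for X :: real using that by simp
  \<comment> \<open>The factor \<open>CARD('n)\<close> pays for passing from components to the norm,
    \<open>T powr (1 - \<alpha>)\<close> for passing from Lipschitz to Hoelder.\<close>
  define h where "h = e / 2 / (T powr (1 - \<alpha>) * CARD('n))"
  have D: "T powr (1 - \<alpha>) * CARD('n) > 0" using T_pos by simp
  have "h > 0" unfolding h_def using \<open>e > 0\<close> D by (intro divide_pos_pos) auto
  have "\<exists>q. \<forall>u\<in>{0..T}. \<bar>z' u $ i - (\<Sum>k<length q. of_rat (q ! k) * u ^ k)\<bar> < h" for i
    by (rule rat_poly_approx[OF _ \<open>h > 0\<close>]) (intro continuous_intros z'(1))
  then obtain q where q: "\<And>i u. u \<in> {0..T} \<Longrightarrow>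
      \<bar>z' u $ i - (\<Sum>k<length (q i). of_rat (q i ! k) * u ^ k)\<bar> < h" by metis
  let ?c = "poly_path q" and ?p = "\<lambda>u. \<chi> i. \<Sum>k<length (q i). of_rat (q i ! k) * u ^ k"
  have c: "norm ((z t - ?c t) - (z s - ?c s)) \<le> (h * CARD('n)) * \<bar>t - s\<bar>"
    if "s \<in> {0..T}" "t \<in> {0..T}" for s t
  proof -
    have "norm ((\<lambda>t. z t - ?c t) t - (\<lambda>t. z t - ?c t) s) \<le> (h * CARD('n)) * \<bar>t - s\<bar>"
    proof (rule vector_derivative_increment_bound[OF _ _ that])
      show "((\<lambda>t. z t - ?c t) has_vector_derivative (z' u - ?p u)) (at u within {0..T})"
        if "u \<in> {0..T}" for u
        by (rule has_vector_derivative_diff[OF z'(2)[OF that] poly_path_derivative[OF that]])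
      fix u assume u: "u \<in> {0..T}"
      have "norm (z' u - ?p u) \<le> (\<Sum>i\<in>UNIV. \<bar>(z' u - ?p u) $ i\<bar>)" by (rule norm_le_l1_cart)
      also have "\<dots> \<le> (\<Sum>i\<in>(UNIV::'n set). h)"
        using q[OF u] by (intro sum_mono) (auto intro: less_imp_le)
      finally show "norm (z' u - ?p u) \<le> h * CARD('n)" by (simp add: mult.commute)
    qed
    then show ?thesis .
  qed
  have xz: "(\<lambda>t. x t - z t) \<in> hoelder_paths T \<alpha>"
    by (rule hoelder_paths_diff[OF little_hoelder_atD(1)[OF x] C1_paths_hoelder[OF z(1)]])
  have xz_S: "seminorm (\<lambda>t. x t - z t) \<le> e / 2"
    using z(2) by (simp add: hoelder_norm_def) (smt (verit) norm_ge_zero)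
  have "norm ((x t - ?c t) - (x s - ?c s)) \<le> e * \<bar>t - s\<bar> powr \<alpha>"
    if st: "s \<in> {0..T}" "t \<in> {0..T}" for s t
  proof -
    have "norm ((x t - z t) - (x s - z s)) \<le> seminorm (\<lambda>t. x t - z t) * \<bar>t - s\<bar> powr \<alpha>"
      by (rule hoelder_increment_abs[OF xz st])
    also have "\<dots> \<le> e / 2 * \<bar>t - s\<bar> powr \<alpha>" by (intro mult_right_mono xz_S) auto
    finally have 1: "norm ((x t - z t) - (x s - z s)) \<le> e / 2 * \<bar>t - s\<bar> powr \<alpha>" .
    have "norm ((z t - ?c t) - (z s - ?c s)) \<le> (h * CARD('n)) * \<bar>t - s\<bar>" by (rule c[OF st])
    also have "\<dots> \<le> (h * CARD('n)) * (T powr (1 - \<alpha>) * \<bar>t - s\<bar> powr \<alpha>)"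
      using st \<open>h > 0\<close> by (intro mult_left_mono le_powr_hoelder) auto
    also have "\<dots> = h * (T powr (1 - \<alpha>) * CARD('n)) * \<bar>t - s\<bar> powr \<alpha>" by (simp add: mult_ac)
    also have "h * (T powr (1 - \<alpha>) * CARD('n)) = e / 2"
      unfolding h_def using D by (rule cancel)
    finally have 2: "norm ((z t - ?c t) - (z s - ?c s)) \<le> e / 2 * \<bar>t - s\<bar> powr \<alpha>" .
    have "(x t - ?c t) - (x s - ?c s) = ((x t - z t) - (x s - z s)) + ((z t - ?c t) - (z s - ?c s))"
      by (simp add: algebra_simps)
    then have "norm ((x t - ?c t) - (x s - ?c s))
        \<le> norm ((x t - z t) - (x s - z s)) + norm ((z t - ?c t) - (z s - ?c s))"
      by (simp only: norm_triangle_ineq)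
    also have "\<dots> \<le> e / 2 * \<bar>t - s\<bar> powr \<alpha> + e / 2 * \<bar>t - s\<bar> powr \<alpha>"
      using 1 2 by (rule add_mono)
    finally show ?thesis by simp
  qed
  then show ?thesis by blast
qed

text \<open>Since the polynomial paths need not lie in the space, the sets \<open>B q r\<close> below are balls with
  centres outside of it.\<close>

lemma sets_path_borel_subset_evaluations:
  fixes a :: "real ^ 'n::finite" and S :: "'n path measure"
  assumes S: "space S = paths a"
    and ev: "\<And>t i. t \<in> {0..T} \<Longrightarrow> (\<lambda>x. x t $ i) \<in> borel_measurable S"
  shows "sets (pborel a) \<subseteq> sets S"
proof -
  let ?R = "\<rat> \<inter> {0<..<T}"
  have ev'[measurable]: "(\<lambda>x. x t) \<in> borel_measurable S" if "t \<in> {0..T}" for t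
    using ev[OF that] by (subst borel_measurable_euclidean_space) (auto simp: Basis_vec_def inner_axis)
  \<comment> \<open>Rational times determine the increments of continuous paths, so each
    \<open>B q r\<close> is cut out by countably many measurable conditions.\<close>
  define B where "B q r = {x \<in> space S. \<forall>s\<in>?R. \<forall>t\<in>?R.
      norm ((x t - poly_path q t) - (x s - poly_path q s)) \<le> r * \<bar>t - s\<bar> powr \<alpha>}"
    for q :: "'n \<Rightarrow> rat list" and r :: real
  have cR: "countable ?R" by (simp add: countable_rat)
  have B: "B q r \<in> sets S" for q r
    unfolding B_def
  proof (intro sets.sets_Collect_countable_All'[OF _ cR])
    fix s t assume st: "s \<in> ?R" "t \<in> ?R"
    have [measurable]: "(\<lambda>x. x s) \<in> borel_measurable S" "(\<lambda>x. x t) \<in> borel_measurable S"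
      using st by (auto intro!: ev')
    show "{x \<in> space S. norm ((x t - poly_path q t) - (x s - poly_path q s)) \<le> r * \<bar>t - s\<bar> powr \<alpha>} \<in> sets S"
      by measurable
  qed
  have pc: "continuous_on {0..T} (poly_path q :: 'n path)" for q
    using poly_path_derivative[of _ q]
    by (meson continuous_on_eq_continuous_within has_vector_derivative_continuous)
  have near: "hdist x y \<le> 2 * r" if x: "x \<in> B q r" and y: "y \<in> B q r" for x y q r
  proof (rule hoelder_dist_le)
    show xL: "x \<in> paths a" and yL: "y \<in> paths a"
      using x y S by (auto simp: B_def)
    have *: "norm ((u t - poly_path q t) - (u s - poly_path q s)) \<le> r * \<bar>t - s\<bar> powr \<alpha>"
      if "u \<in> B q r" "s \<in> {0..T}" "t \<in> {0..T}" for u s t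
    proof (rule increment_bound_rational[of "\<lambda>t. u t - poly_path q t", OF _ _ that(2,3)])
      have "u \<in> paths a" using that(1) S by (auto simp: B_def)
      then show "continuous_on {0..T} (\<lambda>t. u t - poly_path q t)"
        by (intro continuous_on_diff hoelder_continuous pc little_hoelder_atD(1))
    qed (use that(1) in \<open>auto simp: B_def\<close>)
    fix s t assume st: "0 \<le> s" "s < t" "t \<le> T"
    have "(x t - y t) - (x s - y s) = ((x t - poly_path q t) - (x s - poly_path q s))
        - ((y t - poly_path q t) - (y s - poly_path q s))"
      by (simp add: algebra_simps)
    then have "norm ((x t - y t) - (x s - y s)) \<le> norm ((x t - poly_path q t) - (x s - poly_path q s))
        + norm ((y t - poly_path q t) - (y s - poly_path q s))"
      by (simp only: norm_triangle_ineq4)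
    also have "\<dots> \<le> r * \<bar>t - s\<bar> powr \<alpha> + r * \<bar>t - s\<bar> powr \<alpha>"
      using st by (intro add_mono *[OF x] *[OF y]) auto
    finally show "norm ((x t - y t) - (x s - y s)) \<le> 2 * r * (t - s) powr \<alpha>" using st by simp
  qed
  have "U \<in> sets S" if U: "openin (ptop a) U" for U
  proof -
    let ?I = "{(q, r). B q (of_rat r) \<subseteq> U}"
    have "U = (\<Union>(q, r)\<in>?I. B q (of_rat r))"
    proof (intro equalityI subsetI)
      fix x assume x: "x \<in> U"
      then obtain r where r: "r > 0"
        "\<And>y. y \<in> paths a \<Longrightarrow> hdist x y < r \<Longrightarrow> y \<in> U"
        using U unfolding openin_path_topology by blast
      have xL: "x \<in> paths a" using U x unfolding openin_path_topology by blast
      \<comment> \<open>Two members of the same \<open>B q k\<close> lie within 2k of each other,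
        hence the bound \<open>r / 2\<close>.\<close>
      obtain k :: rat where k: "0 < real_of_rat k" "real_of_rat k < r / 2"
        using of_rat_dense[of 0 "r / 2"] r(1) by auto
      obtain q where q: "\<And>s t. s \<in> {0..T} \<Longrightarrow> t \<in> {0..T} \<Longrightarrow> norm ((x t - poly_path q t)
          - (x s - poly_path q s)) \<le> of_rat k * \<bar>t - s\<bar> powr \<alpha>"
        using poly_path_dense[OF xL k(1)] by blast
      have xB: "x \<in> B q (of_rat k)" using xL S q by (auto simp: B_def)
      have "B q (of_rat k) \<subseteq> U"
      proof
        fix y assume y: "y \<in> B q (of_rat k)"
        show "y \<in> U" using near[OF xB y] k(2) y S by (intro r(2)) (auto simp: B_def)
      qed
      then show "x \<in> (\<Union>(q, r)\<in>?I. B q (of_rat r))" using xB by blast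
    qed auto
    also have "\<dots> \<in> sets S" using B by (intro sets.countable_UN') auto
    finally show ?thesis .
  qed
  then show ?thesis
    unfolding sets_path_borel S[symmetric] by (intro sets.sigma_sets_subset) auto
qed

end

section \<open>Sewing and Young integrals\<close>

definition dyadic :: "real \<Rightarrow> real \<Rightarrow> nat \<Rightarrow> nat \<Rightarrow> real" where
  "dyadic s t n i = s + (t - s) * real i / 2 ^ n"

lemma dyadic_0 [simp]: "dyadic s t n 0 = s"
  by (simp add: dyadic_def)

lemma dyadic_last [simp]: "dyadic s t n (2 ^ n) = t"
  by (simp add: dyadic_def)

lemma dyadic_double: "dyadic s t (Suc n) (2 * i) = dyadic s t n i"
  by (simp add: dyadic_def)

lemma dyadic_step: "dyadic s t n (Suc i) - dyadic s t n i = (t - s) / 2 ^ n"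
  by (simp add: dyadic_def field_simps)

lemma dyadic_less: "s < t \<Longrightarrow> dyadic s t n i < dyadic s t n (Suc i)"
  using dyadic_step[of s t n i] by (metis diff_gt_0_iff_gt divide_pos_pos zero_less_numeral zero_less_power)

lemma dyadic_mem: "s \<le> t \<Longrightarrow> i \<le> 2 ^ n \<Longrightarrow> s \<le> dyadic s t n i \<and> dyadic s t n i \<le> t"
proof -
  assume "s \<le> t" "i \<le> 2 ^ n"
  then have "real i \<le> 2 ^ n" by (metis of_nat_le_iff of_nat_numeral of_nat_power)
  then have "(t - s) * (real i / 2 ^ n) \<le> (t - s) * 1"
    using \<open>s \<le> t\<close> by (intro mult_left_mono) auto
  then show ?thesis using \<open>s \<le> t\<close> by (simp add: dyadic_def)
qed

lemma sum_lessThan_double: "sum h {..<2 * m} = (\<Sum>i<m. h (2 * i) + h (Suc (2 * i)))"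
  for h :: "nat \<Rightarrow> 'b::comm_monoid_add"
  by (induction m) (auto simp: ac_simps)

text \<open>Refining the dyadic partition changes the sum by 2^n midpoint defects of size at most
  \<open>C * ((t - s) / 2 ^ Suc n) powr \<beta>\<close>, which gives a geometric series of ratio
  \<open>2 / 2 powr \<beta>\<close> below 1. Convergence to J is given, so only the distance of J
  from the one-interval sum has to be estimated.\<close>

lemma sewing_bound:
  fixes \<Xi> :: "real \<Rightarrow> real \<Rightarrow> 'b::real_normed_vector"
  assumes st: "s < t" and \<beta>: "1 < \<beta>"
    and lim: "(\<lambda>n. \<Sum>i<2 ^ n. \<Xi> (dyadic s t n i) (dyadic s t n (Suc i))) \<longlonglongrightarrow> J"
    and defect: "\<And>u m v. s \<le> u \<Longrightarrow> u < m \<Longrightarrow> m < v \<Longrightarrow> v \<le> t \<Longrightarrow> m - u = v - m \<Longrightarrow>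
      norm (\<Xi> u m + \<Xi> m v - \<Xi> u v) \<le> C * (v - m) powr \<beta>"
  shows "norm (J - \<Xi> s t) \<le> C * (t - s) powr \<beta> / (2 powr \<beta> - 2)"
proof -
  let ?d = "dyadic s t"
  define S where "S n = (\<Sum>i<2 ^ n. \<Xi> (?d n i) (?d n (Suc i)))" for n
  define r where "r = 2 / 2 powr \<beta>"
  have p2: "2 powr \<beta> > (2::real)" using powr_less_mono[OF \<beta>, of 2] by simp
  then have r: "0 < r" "r < 1" by (auto simp: r_def)
  define c where "c = C * (t - s) powr \<beta> / 2 powr \<beta>"
  \<comment> \<open>The sign of C is read off from the defect bound at the midpoint of
    [s,t].\<close>
  have C: "C \<ge> 0"
  proof -
    have "0 \<le> C * (t - (s + t) / 2) powr \<beta>"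
      by (rule order_trans[OF norm_ge_zero defect[of s "(s + t) / 2" t]]) (use st in \<open>auto simp: field_simps\<close>)
    moreover have "(t - (s + t) / 2) powr \<beta> > 0" using st by (simp add: field_simps)
    ultimately show ?thesis by (simp add: zero_le_mult_iff)
  qed
  have step: "norm (S (Suc n) - S n) \<le> c * r ^ n" for n
  proof -
    let ?a = "\<lambda>i. ?d (Suc n) (2 * i)" and ?m = "\<lambda>i. ?d (Suc n) (Suc (2 * i))"
    let ?e = "\<lambda>i. \<Xi> (?a i) (?m i) + \<Xi> (?m i) (?a (Suc i)) - \<Xi> (?a i) (?a (Suc i))"
    have "S (Suc n) = (\<Sum>i<2 ^ n. \<Xi> (?a i) (?m i)
        + \<Xi> (?m i) (?a (Suc i)))"
      unfolding S_def power_Suc sum_lessThan_double by simp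
    moreover have "S n = (\<Sum>i<2 ^ n. \<Xi> (?a i) (?a (Suc i)))"
      unfolding S_def dyadic_double ..
    ultimately have eq: "S (Suc n) - S n = (\<Sum>i<2 ^ n. ?e i)"
      by (simp only: sum_subtractf)
    have "norm (S (Suc n) - S n) \<le> (\<Sum>i<(2::nat) ^ n. C * ((t - s) / 2 ^ Suc n) powr \<beta>)"
      unfolding eq
    proof (rule sum_norm_le)
      fix i :: nat assume "i \<in> {..<2 ^ n}"
      then have i: "2 * Suc i \<le> 2 ^ Suc n" by simp
      have "norm (?e i)
        \<le> C * (?a (Suc i) - ?m i) powr \<beta>"
      proof (rule defect)
        show "s \<le> ?a i" using dyadic_mem[of s t "2 * i" "Suc n"] st i by simp
        show "?a (Suc i) \<le> t" using dyadic_mem[of s t "2 * Suc i" "Suc n"] st i by simp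
        show "?a i < ?m i" by (rule dyadic_less[OF st])
        show "?m i < ?a (Suc i)"
          using dyadic_less[OF st, of "Suc n" "Suc (2 * i)"] by simp
        show "?m i - ?a i = ?a (Suc i) - ?m i"
          using dyadic_step[of s t "Suc n" "2 * i"] dyadic_step[of s t "Suc n" "Suc (2 * i)"] by simp
      qed
      also have "?a (Suc i) - ?m i = (t - s) / 2 ^ Suc n"
        using dyadic_step[of s t "Suc n" "Suc (2 * i)"] by simp
      finally show "norm (?e i) \<le> C * ((t - s) / 2 ^ Suc n) powr \<beta>" .
    qed
    also have "\<dots> = 2 ^ n * (C * ((t - s) / 2 ^ Suc n) powr \<beta>)"
      by (simp only: sum_constant card_lessThan of_nat_power of_nat_numeral)
    also have "\<dots> = c * r ^ n"
    proof -
      have "(2 ^ Suc n) powr \<beta> = (2 powr \<beta>) ^ Suc n"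
        by (simp only: powr_realpow[symmetric, of 2] powr_power powr_powr zero_less_numeral)
      then show ?thesis by (simp add: powr_divide c_def r_def power_divide)
    qed
    finally show ?thesis .
  qed
  have "norm (S n - S 0) \<le> c / (1 - r)" for n
  proof -
    have "S n - S 0 = (\<Sum>k<n. S (Suc k) - S k)" by (rule sum_lessThan_telescope[symmetric])
    then have "norm (S n - S 0) \<le> (\<Sum>k<n. c * r ^ k)" by (simp add: sum_norm_le step)
    also have "\<dots> = c * ((1 - r ^ n) / (1 - r))"
      using r by (simp add: sum_distrib_left[symmetric] sum_gp_strict)
    also have "\<dots> \<le> c * (1 / (1 - r))"
      using r C by (intro mult_left_mono divide_right_mono) (auto simp: c_def)
    finally show ?thesis by simp
  qed
  moreover have "(\<lambda>n. norm (S n - S 0)) \<longlonglongrightarrow> norm (J - S 0)"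
    using lim unfolding S_def[symmetric] by (intro tendsto_intros)
  ultimately have "norm (J - S 0) \<le> c / (1 - r)" by (blast intro: LIMSEQ_le_const2)
  also have "c / (1 - r) = C * (t - s) powr \<beta> / (2 powr \<beta> - 2)"
    using p2 by (simp add: c_def r_def field_simps)
  also have "S 0 = \<Xi> s t" unfolding S_def using dyadic_last[of s t 0] by simp
  finally show ?thesis .
qed

lemma tagged_division_of_chain:
  fixes x :: "nat \<Rightarrow> real"
  assumes "\<And>i. x i < x (Suc i)"
  shows "(\<lambda>i. (x i, {x i..x (Suc i)})) ` {..<Suc N} tagged_division_of {x 0..x (Suc N)}"
proof (induction N)
  case 0
  have "{(x 0, cbox (x 0) (x 1))} tagged_division_of cbox (x 0) (x 1)"
    using assms[of 0] by (intro tagged_division_of_self) auto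
  then show ?case by (simp add: lessThan_Suc)
next
  case (Suc N)
  have mono: "x 0 \<le> x n" for n by (induction n) (use assms less_imp_le order_trans in blast)+
  have le: "x (Suc N) \<le> x (Suc (Suc N))" using assms[of "Suc N"] by simp
  have "{(x (Suc N), cbox (x (Suc N)) (x (Suc (Suc N))))} tagged_division_of cbox (x (Suc N)) (x (Suc (Suc N)))"
    using le by (intro tagged_division_of_self) auto
  then have "(\<lambda>i. (x i, {x i..x (Suc i)})) ` {..<Suc N} \<union> {(x (Suc N), {x (Suc N)..x (Suc (Suc N))})}
      tagged_division_of {x 0..x (Suc N)} \<union> {x (Suc N)..x (Suc (Suc N))}"
    by (intro tagged_division_Un Suc) auto
  moreover have "{x 0..x (Suc N)} \<union> {x (Suc N)..x (Suc (Suc N))} = {x 0..x (Suc (Suc N))}"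
    using mono[of "Suc N"] le by auto
  ultimately show ?case by (simp add: lessThan_Suc[of "Suc N"] Un_commute)
qed

text \<open>Both integrals start at 0. A fine division p of [0,s] joined with the dyadic one of
  [s,t] is a fine division of [0,t]; taking the Riemann sum over p away from the one over the union
  leaves the dyadic sum.\<close>

lemma young_integral_dyadic:
  fixes f :: "real \<Rightarrow> 'b::real_normed_vector"
  assumes Is: "has_young_integral f g 0 s Is" and It: "has_young_integral f g 0 t It"
    and st: "0 \<le> s" "s < t"
  shows "(\<lambda>n. \<Sum>i<2 ^ n. (g (dyadic s t n (Suc i)) - g (dyadic s t n i)) *\<^sub>R f (dyadic s t n i))
    \<longlonglongrightarrow> It - Is"
proof (rule LIMSEQ_I)
  fix e :: real assume "e > 0"
  let ?d = "dyadic s t"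
  let ?R = "\<lambda>p. \<Sum>(x, K)\<in>p. (g (Sup K) - g (Inf K)) *\<^sub>R f x"
  obtain d1 where d1: "d1 > 0" "\<And>p. p tagged_division_of {0..s} \<Longrightarrow> (\<lambda>x. ball x d1) fine p \<Longrightarrow>
      norm (?R p - Is) < e / 2"
    using Is \<open>e > 0\<close> unfolding has_young_integral_def by (meson half_gt_zero)
  obtain d2 where d2: "d2 > 0" "\<And>p. p tagged_division_of {0..t} \<Longrightarrow> (\<lambda>x. ball x d2) fine p \<Longrightarrow>
      norm (?R p - It) < e / 2"
    using It \<open>e > 0\<close> unfolding has_young_integral_def by (meson half_gt_zero)
  \<comment> \<open>p has to be fine for both meshes: it is compared with \<open>Is\<close> on its
    own and with \<open>It\<close> as a part of the union.\<close>
  have "gauge (\<lambda>x::real. ball x (min d1 d2))" using d1 d2 by (intro gauge_ball) auto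
  then obtain p where p: "p tagged_division_of {0..s}" "(\<lambda>x. ball x (min d1 d2)) fine p"
    using fine_division_exists_real by blast
  have p1: "norm (?R p - Is) < e / 2"
    using p by (intro d1(2)) (auto simp: fine_def subset_eq)
  have "(\<lambda>n. (t - s) * (1 / 2) ^ n) \<longlonglongrightarrow> (t - s) * 0" by (intro tendsto_intros LIMSEQ_power_zero) auto
  then have "\<forall>\<^sub>F n in sequentially. (t - s) * (1 / 2) ^ n < d2"
    using d2(1) by (intro order_tendstoD(2)[where a = d2]) auto
  then obtain N where N: "\<And>n. n \<ge> N \<Longrightarrow> (t - s) / 2 ^ n < d2"
    by (auto simp: eventually_sequentially power_divide)
  have "norm ((\<Sum>i<2 ^ n. (g (?d n (Suc i)) - g (?d n i)) *\<^sub>R f (?d n i)) - (It - Is)) < e"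
    if "n \<ge> N" for n
  proof -
    define q where "q = (\<lambda>i. (?d n i, {?d n i..?d n (Suc i)})) ` {..<2 ^ n}"
    have pow: "(2::nat) ^ n = Suc (2 ^ n - 1)" by simp
    have q: "q tagged_division_of {s..t}"
      unfolding q_def using tagged_division_of_chain[of "?d n" "2 ^ n - 1", OF dyadic_less[OF st(2)]]
      unfolding pow[symmetric] by simp
    have inj: "inj_on (\<lambda>i. (?d n i, {?d n i..?d n (Suc i)})) {..<2 ^ n}"
    proof (rule inj_onI)
      fix i j assume "(?d n i, {?d n i..?d n (Suc i)}) = (?d n j, {?d n j..?d n (Suc j)})"
      then show "i = j" using st by (simp add: dyadic_def)
    qed
    have fq: "(\<lambda>x. ball x d2) fine q"
    proof (rule fineI)
      fix x K assume "(x, K) \<in> q"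
      then obtain i where "x = ?d n i" "K = {?d n i..?d n (Suc i)}" by (auto simp: q_def)
      then show "K \<subseteq> ball x d2"
        using N[OF that] dyadic_step[of s t n i] by (auto simp: dist_real_def)
    qed
    \<comment> \<open>Disjointness lets the Riemann sum over the union split: a common interval
      would have positive length and lie on both sides of s.\<close>
    have pq: "p \<inter> q = {}"
    proof (rule ccontr)
      assume "p \<inter> q \<noteq> {}"
      then obtain i where i: "(?d n i, {?d n i..?d n (Suc i)}) \<in> p" "i < 2 ^ n" by (auto simp: q_def)
      then have "{?d n i..?d n (Suc i)} \<subseteq> {0..s}" using tagged_division_ofD(3)[OF p(1) i(1)] by simp
      then have "?d n (Suc i) \<le> s" using dyadic_less[OF st(2), of n i] by auto
      moreover have "s \<le> ?d n i" using dyadic_mem[of s t i n] st i by simp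
      ultimately show False using dyadic_less[OF st(2), of n i] by simp
    qed
    have "p \<union> q tagged_division_of {0..s} \<union> {s..t}"
      by (rule tagged_division_Un[OF p(1) q]) auto
    then have "p \<union> q tagged_division_of {0..t}" using st by (simp add: ivl_disj_un_two_touch)
    moreover have "(\<lambda>x. ball x d2) fine (p \<union> q)"
      using p(2) fq by (auto simp: fine_def subset_eq)
    ultimately have p2: "norm (?R (p \<union> q) - It) < e / 2" by (rule d2(2))
    have Rq: "?R q = (\<Sum>i<2 ^ n. (g (?d n (Suc i)) - g (?d n i)) *\<^sub>R f (?d n i))"
      unfolding q_def sum.reindex[OF inj] using dyadic_less[OF st(2), of n]
      by (intro sum.cong) (auto simp: less_imp_le)
    have "?R (p \<union> q) = ?R p + ?R q"
      using p(1) q pq by (intro sum.union_disjoint) (auto dest: tagged_division_of_finite)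
    then have "?R q - (It - Is) = (?R (p \<union> q) - It) - (?R p - Is)" by simp
    then have "norm (?R q - (It - Is)) \<le> norm (?R (p \<union> q) - It) + norm (?R p - Is)"
      by (simp only: norm_triangle_ineq4)
    then show ?thesis using p1 p2 unfolding Rq by simp
  qed
  then show "\<exists>N. \<forall>n\<ge>N. norm ((\<Sum>i<2 ^ n. (g (?d n (Suc i)) - g (?d n i)) *\<^sub>R f (?d n i)) - (It - Is)) < e"
    by blast
qed

text \<open>The improvement N -> c + N/2 contracts to its fixed point 2c, so the initial constant N0
  disappears in the limit: a merely finite Hoelder constant turns into an explicit one.\<close>

lemma hoelder_bootstrap:
  fixes z :: "real \<Rightarrow> 'b::real_normed_vector"
  assumes start: "\<And>s t. p \<le> s \<Longrightarrow> s < t \<Longrightarrow> t \<le> q \<Longrightarrow> norm (z t - z s) \<le> N0 * (t - s) powr \<alpha>"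
    and "0 \<le> N0" "0 \<le> c"
    and improve: "\<And>N s t. 0 \<le> N \<Longrightarrow>
      (\<And>s t. p \<le> s \<Longrightarrow> s < t \<Longrightarrow> t \<le> q \<Longrightarrow> norm (z t - z s) \<le> N * (t - s) powr \<alpha>) \<Longrightarrow>
      p \<le> s \<Longrightarrow> s < t \<Longrightarrow> t \<le> q \<Longrightarrow> norm (z t - z s) \<le> (c + N / 2) * (t - s) powr \<alpha>"
    and st: "p \<le> s" "s < t" "t \<le> q"
  shows "norm (z t - z s) \<le> 2 * c * (t - s) powr \<alpha>"
proof -
  have *: "norm (z t - z s) \<le> (2 * c + N0 / 2 ^ n) * (t - s) powr \<alpha>"
    if "p \<le> s" "s < t" "t \<le> q" for s t n
    using that
  proof (induction n arbitrary: s t)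
    case 0
    have "N0 * (t - s) powr \<alpha> \<le> (2 * c + N0 / 2 ^ 0) * (t - s) powr \<alpha>"
      using \<open>0 \<le> c\<close> by (intro mult_right_mono) auto
    then show ?case using start[OF 0] by linarith
  next
    case (Suc n)
    have "norm (z t - z s) \<le> (c + (2 * c + N0 / 2 ^ n) / 2) * (t - s) powr \<alpha>"
      using \<open>0 \<le> c\<close> \<open>0 \<le> N0\<close> by (intro improve Suc) auto
    then show ?case by (simp add: field_simps)
  qed
  have "(\<lambda>n. (2 * c + N0 * (1 / 2) ^ n) * (t - s) powr \<alpha>) \<longlonglongrightarrow> (2 * c + N0 * 0) * (t - s) powr \<alpha>"
    by (intro tendsto_intros LIMSEQ_power_zero) auto
  then have "(\<lambda>n. (2 * c + N0 / 2 ^ n) * (t - s) powr \<alpha>) \<longlonglongrightarrow> 2 * c * (t - s) powr \<alpha>"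
    by (simp add: power_divide)
  then show ?thesis by (rule LIMSEQ_le_const) (use *[OF st] in blast)
qed

section \<open>Continuity of the solution map\<close>

text \<open>The assumptions extract from \<open>C_b_infinity\<close> what the Young estimates use,
  with one constant M for all fields. \<open>V_four\<close> bounds a second difference, the form in
  which a Lipschitz derivative enters when two solutions are compared. D counts the driver
  components.\<close>

locale young_flow = hoelder_setting T \<alpha> for T \<alpha> +
  fixes V0 :: "real ^ 'e::finite \<Rightarrow> real ^ 'e" and V :: "'d::finite \<Rightarrow> real ^ 'e \<Rightarrow> real ^ 'e"
    and a :: "real ^ 'e" and D M :: real
  assumes D_eq: "D = real CARD('d)" and \<alpha>_gt: "1 / 2 < \<alpha>" and M_pos: "0 < M"
    and V0_bound: "norm (V0 x) \<le> M" and V0_lip: "norm (V0 x - V0 y) \<le> M * norm (x - y)"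
    and V_bound: "norm (V j x) \<le> M" and V_lip: "norm (V j x - V j y) \<le> M * norm (x - y)"
    and V_four: "norm ((V j x - V j y) - (V j x' - V j y')) \<le>
      M * norm ((x - y) - (x' - y')) + M * (norm (x - y) + norm (x' - y')) * norm (y - y')"
begin

abbreviation "solves w y \<equiv> w \<in> paths 0 \<and> young_solution T \<alpha> V0 V a w y"
abbreviation "\<kappa> \<equiv> 1 / (2 powr (2 * \<alpha>) - 2)"

definition hoelder_on :: "real \<Rightarrow> real \<Rightarrow> real \<Rightarrow> (real \<Rightarrow> 'b::real_normed_vector) \<Rightarrow> bool" where
  "hoelder_on p q N z \<longleftrightarrow> 0 \<le> N \<and>
    (\<forall>s t. p \<le> s \<longrightarrow> s < t \<longrightarrow> t \<le> q \<longrightarrow> norm (z t - z s) \<le> N * (t - s) powr \<alpha>)"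

lemma hoelder_onD:
  "hoelder_on p q N z \<Longrightarrow> 0 \<le> N"
  "hoelder_on p q N z \<Longrightarrow> p \<le> s \<Longrightarrow> s < t \<Longrightarrow> t \<le> q \<Longrightarrow> norm (z t - z s) \<le> N * (t - s) powr \<alpha>"
  by (auto simp: hoelder_on_def)

lemma hoelder_on_path:
  assumes "x \<in> paths b"
  shows "hoelder_on 0 T (seminorm x) x"
  using hoelder_increment[OF little_hoelder_atD(1)[OF assms]]
    hoelder_seminorm_nonneg[OF T_pos little_hoelder_atD(1)[OF assms]]
  by (auto simp: hoelder_on_def)

text \<open>\<open>\<kappa>\<close> is the sewing constant for the exponent 2 \<alpha>, positive
  because this exponent exceeds 1.\<close>

lemma \<kappa>_pos: "0 < \<kappa>"
proof -
  have "2 powr (2 * \<alpha>) > (2::real)" using powr_less_mono[of 1 "2 * \<alpha>" 2] \<alpha>_gt by simp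
  then show ?thesis by simp
qed

text \<open>Of the exponent 2 \<alpha> only one \<alpha> is kept as modulus; the other becomes
  \<open>(q - p) powr \<alpha>\<close>, the small factor that later absorbs an unknown Hoelder
  constant on short intervals.\<close>

lemma sewing_increment:
  fixes \<Xi> :: "real \<Rightarrow> real \<Rightarrow> 'b::real_normed_vector"
  assumes st: "p \<le> s" "s < t" "t \<le> q"
    and lim: "(\<lambda>n. \<Sum>i<2 ^ n. \<Xi> (dyadic s t n i) (dyadic s t n (Suc i))) \<longlonglongrightarrow> J"
    and germ: "norm (\<Xi> s t) \<le> A * (t - s) powr \<alpha>"
    and defect: "\<And>u m v. s \<le> u \<Longrightarrow> u < m \<Longrightarrow> m < v \<Longrightarrow> v \<le> t \<Longrightarrow> m - u = v - m \<Longrightarrow>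
      norm (\<Xi> u m + \<Xi> m v - \<Xi> u v) \<le> C * (v - m) powr (2 * \<alpha>)" and "0 \<le> C"
  shows "norm J \<le> (A + \<kappa> * C * (q - p) powr \<alpha>) * (t - s) powr \<alpha>"
proof -
  have "norm (J - \<Xi> s t) \<le> C * (t - s) powr (2 * \<alpha>) / (2 powr (2 * \<alpha>) - 2)"
    by (rule sewing_bound[OF st(2) _ lim defect]) (use \<alpha>_gt in auto)
  also have "\<dots> = \<kappa> * C * ((t - s) powr \<alpha> * (t - s) powr \<alpha>)"
    by (simp add: powr_add[symmetric])
  also have "\<dots> \<le> \<kappa> * C * ((q - p) powr \<alpha> * (t - s) powr \<alpha>)"
    using st \<alpha>_pos \<kappa>_pos \<open>0 \<le> C\<close>
    by (intro mult_left_mono mult_right_mono powr_mono2 mult_nonneg_nonneg) auto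
  finally have "norm (J - \<Xi> s t) \<le> \<kappa> * C * (q - p) powr \<alpha> * (t - s) powr \<alpha>"
    by (simp only: mult.assoc)
  then show ?thesis
    using germ norm_triangle_ineq[of "J - \<Xi> s t" "\<Xi> s t"] by (simp add: distrib_right)
qed

lemma D_nonneg [simp]: "0 \<le> D"
  by (simp add: D_eq)

lemma norm_sum_d:
  assumes "\<And>j. norm (f j) \<le> B" shows "norm (\<Sum>j\<in>(UNIV :: 'd set). f j :: real ^ 'e) \<le> D * B"
  using sum_norm_le[of UNIV f "\<lambda>_. B"] assms by (simp add: D_eq)

lemma V0_continuous: "continuous_on {0..T} y \<Longrightarrow> continuous_on {0..T} (\<lambda>s. V0 (y s))"
proof (rule continuous_on_compose2[of UNIV V0])
  have "M-lipschitz_on UNIV V0"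
    using V0_lip M_pos by (intro lipschitz_onI) (auto simp: dist_norm)
  then show "continuous_on UNIV V0" by (rule lipschitz_on_continuous_on)
qed auto

text \<open>The equation at s is subtracted from that at t. The Young part stays a limit of dyadic
  left-point sums over all components at once, the input of \<open>sewing_increment\<close>.\<close>

lemma solution_increment:
  assumes sol: "solves w y" and st: "0 \<le> s" "s < t" "t \<le> T"
  obtains J where
    "(\<lambda>n. \<Sum>i<2 ^ n. \<Sum>j\<in>UNIV. (w (dyadic s t n (Suc i)) $ j - w (dyadic s t n i) $ j)
        *\<^sub>R V j (y (dyadic s t n i))) \<longlonglongrightarrow> J"
    "y t - y s = J + integral {s..t} (\<lambda>r. V0 (y r))"
proof -
  have y: "y \<in> paths a" and eq: "\<And>t. t \<in> {0..T} \<Longrightarrow> \<exists>I.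
      (\<forall>j. has_young_integral (\<lambda>s. V j (y s)) (\<lambda>s. w s $ j) 0 t (I j)) \<and>
      y t = a + (\<Sum>j\<in>UNIV. I j) + integral {0..t} (\<lambda>s. V0 (y s))"
    using sol by (auto simp: young_solution_def)
  obtain Is where Is: "\<And>j. has_young_integral (\<lambda>s. V j (y s)) (\<lambda>s. w s $ j) 0 s (Is j)"
    "y s = a + (\<Sum>j\<in>UNIV. Is j) + integral {0..s} (\<lambda>s. V0 (y s))"
    using eq[of s] st by auto
  obtain It where It: "\<And>j. has_young_integral (\<lambda>s. V j (y s)) (\<lambda>s. w s $ j) 0 t (It j)"
    "y t = a + (\<Sum>j\<in>UNIV. It j) + integral {0..t} (\<lambda>s. V0 (y s))"
    using eq[of t] st by auto
  have "(\<lambda>n. \<Sum>j\<in>UNIV. \<Sum>i<2 ^ n. (w (dyadic s t n (Suc i)) $ j - w (dyadic s t n i) $ j)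
        *\<^sub>R V j (y (dyadic s t n i))) \<longlonglongrightarrow> (\<Sum>j\<in>UNIV. It j - Is j)"
    by (intro tendsto_sum young_integral_dyadic[OF Is(1) It(1) st(1,2)])
  then have 1: "(\<lambda>n. \<Sum>i<2 ^ n. \<Sum>j\<in>UNIV. (w (dyadic s t n (Suc i)) $ j - w (dyadic s t n i) $ j)
        *\<^sub>R V j (y (dyadic s t n i))) \<longlonglongrightarrow> (\<Sum>j\<in>UNIV. It j - Is j)"
    by (subst sum.swap)
  have "(\<lambda>r. V0 (y r)) integrable_on {0..t}"
    using st by (intro integrable_continuous_real continuous_on_subset[OF
          V0_continuous[OF hoelder_continuous[OF little_hoelder_atD(1)[OF y]]]]) auto
  then have "integral {0..t} (\<lambda>r. V0 (y r)) = integral {0..s} (\<lambda>r. V0 (y r)) + integral {s..t} (\<lambda>r. V0 (y r))"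
    using st by (intro Henstock_Kurzweil_Integration.integral_combine[symmetric]) auto
  then have "y t - y s = (\<Sum>j\<in>UNIV. It j - Is j) + integral {s..t} (\<lambda>r. V0 (y r))"
    unfolding Is(2) It(2) by (simp add: sum_subtractf)
  then show thesis using 1 that by blast
qed

section \<open>A priori bound for solutions\<close>

lemma driver_component:
  assumes "hoelder_on p q R w" "p \<le> s" "s < t" "t \<le> q"
  shows "\<bar>w t $ j - w s $ j\<bar> \<le> R * (t - s) powr \<alpha>"
  using component_le_norm_cart[of "w t - w s" j] hoelder_onD(2)[OF assms] by simp

text \<open>The defect of the left-point germ at m is an increment of w times an increment of
  \<open>V j\<close> along y, hence of order 2 \<alpha> once y has some Hoelder constant N. This N
  reappears only together with \<open>(q - p) powr \<alpha>\<close>.\<close>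

lemma apriori_step:
  assumes sol: "solves w y" and w: "hoelder_on 0 T R w" and pq: "0 \<le> p" "q \<le> T"
    and y: "hoelder_on p q N y" and st: "p \<le> s" "s < t" "t \<le> q"
  shows "norm (y t - y s) \<le>
    (D * R * M + M * T powr (1 - \<alpha>) + \<kappa> * (D * R * M * N) * (q - p) powr \<alpha>) * (t - s) powr \<alpha>"
proof -
  let ?\<Xi> = "\<lambda>u v. \<Sum>j\<in>UNIV. (w v $ j - w u $ j) *\<^sub>R V j (y u)"
  have R: "0 \<le> R" and N: "0 \<le> N" using w y by (auto dest: hoelder_onD(1))
  obtain J where lim: "(\<lambda>n. \<Sum>i<2 ^ n. ?\<Xi> (dyadic s t n i) (dyadic s t n (Suc i))) \<longlonglongrightarrow> J"
    and eq: "y t - y s = J + integral {s..t} (\<lambda>r. V0 (y r))"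
    using solution_increment[OF sol, of s t] st pq by auto
  have wj: "\<bar>w t $ j - w s $ j\<bar> \<le> R * (t - s) powr \<alpha>" if "p \<le> s" "s < t" "t \<le> q" for s t j
    using that pq by (intro driver_component[OF w]) auto
  have J: "norm J \<le> (D * R * M + \<kappa> * (D * R * M * N) * (q - p) powr \<alpha>) * (t - s) powr \<alpha>"
  proof (rule sewing_increment[OF st lim])
    have "norm (?\<Xi> s t) \<le> D * (R * (t - s) powr \<alpha> * M)"
      using wj[OF st] V_bound M_pos R by (intro norm_sum_d) (simp add: mult_mono')
    then show "norm (?\<Xi> s t) \<le> D * R * M * (t - s) powr \<alpha>" by (simp add: mult_ac)
    fix u m v assume uv: "s \<le> u" "u < m" "m < v" "v \<le> t" "m - u = v - m"
    have "?\<Xi> u m + ?\<Xi> m v - ?\<Xi> u v = (\<Sum>j\<in>UNIV. (w v $ j - w m $ j) *\<^sub>R (V j (y m) - V j (y u)))"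
      by (simp add: sum.distrib[symmetric] sum_subtractf[symmetric] algebra_simps)
    also have "norm \<dots> \<le> D * (R * (v - m) powr \<alpha> * (M * (N * (v - m) powr \<alpha>)))"
    proof (rule norm_sum_d)
      fix j
      have "norm (V j (y m) - V j (y u)) \<le> M * (N * (v - m) powr \<alpha>)"
        using V_lip[of j "y m" "y u"] hoelder_onD(2)[OF y, of u m] uv st M_pos
        by (smt (verit) mult_left_mono)
      then show "norm ((w v $ j - w m $ j) *\<^sub>R (V j (y m) - V j (y u)))
          \<le> R * (v - m) powr \<alpha> * (M * (N * (v - m) powr \<alpha>))"
        using wj[of m v j] uv st R by (simp add: mult_mono')
    qed
    also have "\<dots> = D * R * M * N * ((v - m) powr \<alpha> * (v - m) powr \<alpha>)"
      by (simp only: mult_ac)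
    also have "(v - m) powr \<alpha> * (v - m) powr \<alpha> = (v - m) powr (2 * \<alpha>)"
      by (simp only: mult_2 powr_add)
    finally show "norm (?\<Xi> u m + ?\<Xi> m v - ?\<Xi> u v) \<le> D * R * M * N * (v - m) powr (2 * \<alpha>)" .
  qed (use R N M_pos in auto)
  have cont: "continuous_on {s..t} (\<lambda>r. V0 (y r))"
    using sol st pq by (intro continuous_on_subset[OF V0_continuous[OF hoelder_continuous]])
      (auto simp: young_solution_def dest: little_hoelder_atD(1))
  have "norm (integral {s..t} (\<lambda>r. V0 (y r))) \<le> M * (t - s)"
    by (rule integral_bound[OF _ cont]) (use V0_bound st in auto)
  also have "\<dots> \<le> M * (T powr (1 - \<alpha>) * (t - s) powr \<alpha>)"
    using st pq M_pos by (intro mult_left_mono le_powr_hoelder) auto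
  finally show ?thesis
    using J norm_triangle_ineq[of J "integral {s..t} (\<lambda>r. V0 (y r))"] unfolding eq
    by (simp add: algebra_simps)
qed

text \<open>Neither the smallness condition nor the resulting constant involves y; the finite
  seminorm of y merely starts the bootstrap.\<close>

lemma apriori_bound:
  assumes sol: "solves w y" and w: "hoelder_on 0 T R w" and pq: "0 \<le> p" "q \<le> T"
    and small: "\<kappa> * (D * R * M) * (q - p) powr \<alpha> \<le> 1 / 2"
  shows "hoelder_on p q (2 * (D * R * M + M * T powr (1 - \<alpha>))) y"
proof -
  let ?c = "D * R * M + M * T powr (1 - \<alpha>)"
  have R: "0 \<le> R" using w by (auto dest: hoelder_onD(1))
  have c: "0 \<le> ?c" using R M_pos by (intro add_nonneg_nonneg mult_nonneg_nonneg) auto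
  have y: "y \<in> paths a" using sol by (simp add: young_solution_def)
  have "norm (y t - y s) \<le> 2 * ?c * (t - s) powr \<alpha>" if st: "p \<le> s" "s < t" "t \<le> q" for s t
  proof (rule hoelder_bootstrap[OF _ _ c _ st])
    note y0 = hoelder_on_path[OF y]
    show "0 \<le> seminorm y" using y0 by (rule hoelder_onD(1))
    show "norm (y t - y s) \<le> seminorm y * (t - s) powr \<alpha>"
      if "p \<le> s" "s < t" "t \<le> q" for s t
      by (rule hoelder_onD(2)[OF y0]) (use that pq in auto)
    fix N s t assume N: "0 \<le> N" "\<And>s t. p \<le> s \<Longrightarrow> s < t \<Longrightarrow> t \<le> q \<Longrightarrow> norm (y t - y s) \<le> N * (t - s) powr \<alpha>"
      and st: "p \<le> s" "s < t" "t \<le> q"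
    then have "hoelder_on p q N y" by (simp add: hoelder_on_def)
    note apriori_step[OF sol w pq this st]
    also have "(?c + \<kappa> * (D * R * M * N) * (q - p) powr \<alpha>) * (t - s) powr \<alpha>
        \<le> (?c + N / 2) * (t - s) powr \<alpha>"
      using mult_right_mono[OF small N(1)] by (intro mult_right_mono add_left_mono) (auto simp: mult_ac)
    finally show "norm (y t - y s) \<le> (?c + N / 2) * (t - s) powr \<alpha>" .
  qed
  then show ?thesis using c unfolding hoelder_on_def by auto
qed

text \<open>The integrals of \<open>V j (y' _)\<close> against \<open>w\<close> are not known to exist, so the difference is taken on the
  level of the germs, before sewing.\<close>

lemma difference_step:
  assumes sol: "solves w y" and sol': "solves w' y'"
    and w: "hoelder_on 0 T R w" and ww': "hoelder_on 0 T \<epsilon> (\<lambda>t. w t - w' t)"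
    and pq: "0 \<le> p" "q \<le> T"
    and y': "hoelder_on p q N y'" and u: "hoelder_on p q L (\<lambda>t. y t - y' t)"
    and S: "\<And>r. p \<le> r \<Longrightarrow> r \<le> q \<Longrightarrow> norm (y r - y' r) \<le> S"
    and st: "p \<le> s" "s < t" "t \<le> q"
  shows "norm ((y t - y' t) - (y s - y' s)) \<le>
    (D * (R * (M * S) + \<epsilon> * M) + M * S * T powr (1 - \<alpha>)
      + \<kappa> * (D * (R * (M * L + M * (S + S) * N) + \<epsilon> * (M * N))) * (q - p) powr \<alpha>) * (t - s) powr \<alpha>"
proof -
  let ?\<Xi> = "\<lambda>u v. \<Sum>j\<in>UNIV. (w v $ j - w u $ j) *\<^sub>R V j (y u)"
  let ?\<Xi>' = "\<lambda>u v. \<Sum>j\<in>UNIV. (w' v $ j - w' u $ j) *\<^sub>R V j (y' u)"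
  have R: "0 \<le> R" and N: "0 \<le> N" and e: "0 \<le> \<epsilon>" and L: "0 \<le> L"
    using w y' ww' u by (auto dest: hoelder_onD(1))
  have S0: "0 \<le> S" using order_trans[OF norm_ge_zero S[of s]] st by simp
  obtain J where lim: "(\<lambda>n. \<Sum>i<2 ^ n. ?\<Xi> (dyadic s t n i) (dyadic s t n (Suc i))) \<longlonglongrightarrow> J"
    and eq: "y t - y s = J + integral {s..t} (\<lambda>r. V0 (y r))"
    using solution_increment[OF sol, of s t] st pq by auto
  obtain J' where lim': "(\<lambda>n. \<Sum>i<2 ^ n. ?\<Xi>' (dyadic s t n i) (dyadic s t n (Suc i))) \<longlonglongrightarrow> J'"
    and eq': "y' t - y' s = J' + integral {s..t} (\<lambda>r. V0 (y' r))"
    using solution_increment[OF sol', of s t] st pq by auto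
  have LIM: "(\<lambda>n. \<Sum>i<2 ^ n. ?\<Xi> (dyadic s t n i) (dyadic s t n (Suc i))
      - ?\<Xi>' (dyadic s t n i) (dyadic s t n (Suc i))) \<longlonglongrightarrow> J - J'"
    using tendsto_diff[OF lim lim'] by (simp only: sum_subtractf)
  have wj: "\<bar>w t $ j - w s $ j\<bar> \<le> R * (t - s) powr \<alpha>" if "p \<le> s" "s < t" "t \<le> q" for s t j
    using that pq by (intro driver_component[OF w]) auto
  have dj: "\<bar>(w t $ j - w' t $ j) - (w s $ j - w' s $ j)\<bar> \<le> \<epsilon> * (t - s) powr \<alpha>"
    if "p \<le> s" "s < t" "t \<le> q" for s t j
    using driver_component[OF ww', of s t j] that pq by simp
  \<comment> \<open>Discrete product rule: it separates the error in the driver from the error in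
    the solution.\<close>
  have split: "norm (c *\<^sub>R x - c' *\<^sub>R x') \<le> \<bar>c\<bar> * norm (x - x') + \<bar>c - c'\<bar> * norm x'"
    for c c' :: real and x x' :: "real ^ 'e"
  proof -
    have "c *\<^sub>R x - c' *\<^sub>R x' = c *\<^sub>R (x - x') + (c - c') *\<^sub>R x'" by (simp add: algebra_simps)
    then show ?thesis using norm_triangle_ineq[of "c *\<^sub>R (x - x')" "(c - c') *\<^sub>R x'"] by simp
  qed
  have J: "norm (J - J') \<le> (D * (R * (M * S) + \<epsilon> * M)
      + \<kappa> * (D * (R * (M * L + M * (S + S) * N) + \<epsilon> * (M * N))) * (q - p) powr \<alpha>) * (t - s) powr \<alpha>"
  proof (rule sewing_increment[OF st LIM])
    let ?h = "(t - s) powr \<alpha>"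
    have "norm (\<Sum>j\<in>UNIV. (w t $ j - w s $ j) *\<^sub>R V j (y s) - (w' t $ j - w' s $ j) *\<^sub>R V j (y' s))
        \<le> D * (R * ?h * (M * S) + \<epsilon> * ?h * M)"
    proof (rule norm_sum_d)
      fix j
      have "norm (V j (y s) - V j (y' s)) \<le> M * S"
        using V_lip[of j "y s" "y' s"] S[of s] st M_pos by (smt (verit) mult_left_mono)
      moreover have "\<bar>(w t $ j - w s $ j) - (w' t $ j - w' s $ j)\<bar> \<le> \<epsilon> * ?h"
        using dj[OF st, of j] by (simp add: algebra_simps)
      ultimately have "\<bar>w t $ j - w s $ j\<bar> * norm (V j (y s) - V j (y' s))
          + \<bar>(w t $ j - w s $ j) - (w' t $ j - w' s $ j)\<bar> * norm (V j (y' s))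
          \<le> R * ?h * (M * S) + \<epsilon> * ?h * M"
        using wj[OF st, of j] V_bound[of j "y' s"] by (intro add_mono mult_mono') auto
      then show "norm ((w t $ j - w s $ j) *\<^sub>R V j (y s) - (w' t $ j - w' s $ j) *\<^sub>R V j (y' s))
          \<le> R * ?h * (M * S) + \<epsilon> * ?h * M"
        using split order_trans by blast
    qed
    then have "norm (?\<Xi> s t - ?\<Xi>' s t) \<le> D * (R * ?h * (M * S) + \<epsilon> * ?h * M)"
      by (simp only: sum_subtractf)
    also have "\<dots> = D * (R * (M * S) + \<epsilon> * M) * ?h" by (simp add: algebra_simps)
    finally show "norm (?\<Xi> s t - ?\<Xi>' s t) \<le> D * (R * (M * S) + \<epsilon> * M) * ?h" .
  next
    fix u m v assume uv: "s \<le> u" "u < m" "m < v" "v \<le> t" "m - u = v - m"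
    let ?h = "(v - m) powr \<alpha>"
    have "(?\<Xi> u m - ?\<Xi>' u m) + (?\<Xi> m v - ?\<Xi>' m v) - (?\<Xi> u v - ?\<Xi>' u v)
      = (\<Sum>j\<in>UNIV. (w v $ j - w m $ j) *\<^sub>R (V j (y m) - V j (y u))
          - (w' v $ j - w' m $ j) *\<^sub>R (V j (y' m) - V j (y' u)))"
      by (simp add: sum.distrib[symmetric] sum_subtractf[symmetric] algebra_simps)
    also have "norm \<dots> \<le> D * (R * ?h * (M * (L * ?h) + M * (S + S) * (N * ?h)) + \<epsilon> * ?h * (M * (N * ?h)))"
    proof (rule norm_sum_d)
      fix j
      have y'mu: "norm (y' m - y' u) \<le> N * ?h" using hoelder_onD(2)[OF y', of u m] uv st by simp
      have V': "norm (V j (y' m) - V j (y' u)) \<le> M * (N * ?h)"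
        using V_lip[of j "y' m" "y' u"] y'mu M_pos by (smt (verit) mult_left_mono)
      \<comment> \<open>Regrouping pairs y with y' at equal times, so that \<open>V_four\<close>
        produces increments of y - y' and of y'.\<close>
      have "norm ((V j (y m) - V j (y u)) - (V j (y' m) - V j (y' u)))
          = norm ((V j (y m) - V j (y' m)) - (V j (y u) - V j (y' u)))"
        by (rule arg_cong[where f = norm]) (simp add: algebra_simps)
      also have "\<dots> \<le> M * norm ((y m - y' m) - (y u - y' u))
          + M * (norm (y m - y' m) + norm (y u - y' u)) * norm (y' m - y' u)" by (rule V_four)
      also have "\<dots> \<le> M * (L * ?h) + M * (S + S) * (N * ?h)"
        using hoelder_onD(2)[OF u, of u m] S[of m] S[of u] y'mu uv st M_pos S0
        by (intro add_mono mult_mono mult_left_mono) auto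
      finally have D: "norm ((V j (y m) - V j (y u)) - (V j (y' m) - V j (y' u)))
          \<le> M * (L * ?h) + M * (S + S) * (N * ?h)" .
      have "\<bar>(w v $ j - w m $ j) - (w' v $ j - w' m $ j)\<bar> \<le> \<epsilon> * ?h"
        using dj[of m v j] uv st by (simp add: algebra_simps)
      then have "\<bar>w v $ j - w m $ j\<bar> * norm ((V j (y m) - V j (y u)) - (V j (y' m) - V j (y' u)))
          + \<bar>(w v $ j - w m $ j) - (w' v $ j - w' m $ j)\<bar> * norm (V j (y' m) - V j (y' u))
          \<le> R * ?h * (M * (L * ?h) + M * (S + S) * (N * ?h)) + \<epsilon> * ?h * (M * (N * ?h))"
        using wj[of m v j] uv st D V' by (intro add_mono mult_mono') auto
      then show "norm ((w v $ j - w m $ j) *\<^sub>R (V j (y m) - V j (y u))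
          - (w' v $ j - w' m $ j) *\<^sub>R (V j (y' m) - V j (y' u)))
        \<le> R * ?h * (M * (L * ?h) + M * (S + S) * (N * ?h)) + \<epsilon> * ?h * (M * (N * ?h))"
        using split order_trans by blast
    qed
    also have "\<dots> = D * (R * (M * L + M * (S + S) * N) + \<epsilon> * (M * N)) * (?h * ?h)"
      by (simp add: algebra_simps)
    also have "?h * ?h = (v - m) powr (2 * \<alpha>)" by (simp only: mult_2 powr_add)
    finally show "norm ((?\<Xi> u m - ?\<Xi>' u m) + (?\<Xi> m v - ?\<Xi>' m v) - (?\<Xi> u v - ?\<Xi>' u v))
        \<le> D * (R * (M * L + M * (S + S) * N) + \<epsilon> * (M * N)) * (v - m) powr (2 * \<alpha>)" .
  qed (use R N L S0 e M_pos in \<open>intro add_nonneg_nonneg mult_nonneg_nonneg; simp\<close>)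
  have cont: "continuous_on {s..t} (\<lambda>r. V0 (y r))" "continuous_on {s..t} (\<lambda>r. V0 (y' r))"
    using sol sol' st pq by (auto intro!: continuous_on_subset[OF V0_continuous[OF hoelder_continuous]]
      simp: young_solution_def dest: little_hoelder_atD(1))
  have "norm (integral {s..t} (\<lambda>r. V0 (y r) - V0 (y' r))) \<le> (M * S) * (t - s)"
  proof (rule integral_bound)
    fix r assume "r \<in> {s..t}"
    then show "norm (V0 (y r) - V0 (y' r)) \<le> M * S"
      using V0_lip[of "y r" "y' r"] S[of r] st M_pos by (smt (verit) mult_left_mono atLeastAtMost_iff)
  qed (use cont st in \<open>auto intro!: continuous_intros\<close>)
  also have "\<dots> \<le> (M * S) * (T powr (1 - \<alpha>) * (t - s) powr \<alpha>)"
    using st pq M_pos S0 by (intro mult_left_mono le_powr_hoelder) auto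
  finally have I: "norm (integral {s..t} (\<lambda>r. V0 (y r)) - integral {s..t} (\<lambda>r. V0 (y' r)))
      \<le> M * S * T powr (1 - \<alpha>) * (t - s) powr \<alpha>"
    using cont by (simp add: Henstock_Kurzweil_Integration.integral_diff integrable_continuous_real mult.assoc)
  have "(y t - y' t) - (y s - y' s) = (J - J')
      + (integral {s..t} (\<lambda>r. V0 (y r)) - integral {s..t} (\<lambda>r. V0 (y' r)))"
    using eq eq' by (simp add: algebra_simps)
  then have "norm ((y t - y' t) - (y s - y' s)) \<le> norm (J - J')
      + norm (integral {s..t} (\<lambda>r. V0 (y r)) - integral {s..t} (\<lambda>r. V0 (y' r)))"
    by (simp only: norm_triangle_ineq)
  then show ?thesis using J I by (simp add: algebra_simps)
qed

section \<open>Local Lipschitz dependence on the driver\<close>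

text \<open>The coefficients of the initial difference and of \<epsilon> in
  \<open>difference_step\<close>, with \<open>(q - p) powr \<alpha>\<close> enlarged to
  \<open>T powr \<alpha>\<close>. They are added up so that one constant dominates both.\<close>

definition gain :: "real \<Rightarrow> real \<Rightarrow> real" where
  "gain R N = D * R * M + M * T powr (1 - \<alpha>)
    + 2 * \<kappa> * (D * R * M * N) * T powr \<alpha>
    + D * M + \<kappa> * (D * M * N) * T powr \<alpha>"

lemma gain_nonneg: "0 \<le> R \<Longrightarrow> 0 \<le> N \<Longrightarrow> 0 \<le> gain R N"
  unfolding gain_def using M_pos \<kappa>_pos by (intro add_nonneg_nonneg mult_nonneg_nonneg) auto

text \<open>The difference is bounded on [p,q] by its value at p plus
  \<open>L * (q - p) powr \<alpha>\<close>. Hence every occurrence of the unknown L carries a power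
  of the interval length, and \<open>small\<close> collects these coefficients to reach L/2.\<close>

lemma difference_bound:
  assumes sol: "solves w y" and sol': "solves w' y'"
    and w: "hoelder_on 0 T R w" and ww': "hoelder_on 0 T \<epsilon> (\<lambda>t. w t - w' t)"
    and pq: "0 \<le> p" "p \<le> q" "q \<le> T" and y': "hoelder_on p q N y'"
    and small: "(q - p) powr \<alpha> * (D * R * M + M * T powr (1 - \<alpha>) + \<kappa> * (D * R * M)
      + 2 * \<kappa> * (D * R * M * N) * T powr \<alpha>) \<le> 1 / 2"
  shows "hoelder_on p q (2 * (gain R N * (norm (y p - y' p) + \<epsilon>))) (\<lambda>t. y t - y' t)"
proof -
  let ?u = "\<lambda>t. y t - y' t" and ?h = "(q - p) powr \<alpha>"
  let ?c = "gain R N * (norm (?u p) + \<epsilon>)"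
  have R: "0 \<le> R" and N: "0 \<le> N" and e: "0 \<le> \<epsilon>"
    using w y' ww' by (auto dest: hoelder_onD(1))
  have c: "0 \<le> ?c" using gain_nonneg[OF R N] e by (intro mult_nonneg_nonneg) auto
  have hT: "?h \<le> T powr \<alpha>" using pq \<alpha>_pos by (intro powr_mono2) auto
  have yL: "y \<in> paths a" "y' \<in> paths a"
    using sol sol' by (auto simp: young_solution_def)
  let ?N0 = "hdist y y'"
  have "norm (?u t - ?u s) \<le> 2 * ?c * (t - s) powr \<alpha>" if st: "p \<le> s" "s < t" "t \<le> q" for s t
  proof (rule hoelder_bootstrap[OF _ _ c _ st])
    show "0 \<le> ?N0" by (rule hoelder_dist_nonneg)
    show "norm (?u t - ?u s) \<le> ?N0 * (t - s) powr \<alpha>" if "p \<le> s" "s < t" "t \<le> q" for s t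
      by (rule hoelder_dist_increment[OF yL]) (use that pq in auto)
    fix L s t assume L: "0 \<le> L" "\<And>s t. p \<le> s \<Longrightarrow> s < t \<Longrightarrow> t \<le> q \<Longrightarrow> norm (?u t - ?u s) \<le> L * (t - s) powr \<alpha>"
      and st: "p \<le> s" "s < t" "t \<le> q"
    have u: "hoelder_on p q L ?u" using L by (simp add: hoelder_on_def)
    define S where "S = norm (?u p) + L * ?h"
    have S: "norm (?u r) \<le> S" if "p \<le> r" "r \<le> q" for r
    proof (cases "r = p")
      case True
      then show ?thesis using L(1) by (simp add: S_def)
    next
      case False
      then have "norm (?u r - ?u p) \<le> L * (r - p) powr \<alpha>" using that by (intro L(2)) auto
      also have "\<dots> \<le> L * ?h" using that L(1) \<alpha>_pos by (intro mult_left_mono powr_mono2) auto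
      finally show ?thesis using norm_triangle_ineq[of "?u p" "?u r - ?u p"] by (simp add: S_def)
    qed
    let ?T1 = "T powr (1 - \<alpha>)" and ?Ta = "T powr \<alpha>"
    have hp: "0 \<le> ?h" by simp
    have 1: "norm (?u t - ?u s) \<le> (D * (R * (M * S) + \<epsilon> * M) + M * S * ?T1
      + \<kappa> * (D * (R * (M * L + M * (S + S) * N) + \<epsilon> * (M * N))) * ?h) * (t - s) powr \<alpha>"
      by (rule difference_step[OF sol sol' w ww' pq(1,3) y' u S st])
    have S0: "0 \<le> S" using order_trans[OF norm_ge_zero S[of p]] pq by simp
    have "\<kappa> * (D * (R * (M * L + M * (S + S) * N) + \<epsilon> * (M * N))) * ?h
      = \<kappa> * D * R * M * L * ?h + 2 * \<kappa> * (D * R * M * N) * S * ?h + \<kappa> * (D * M * N) * \<epsilon> * ?h"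
      by (simp add: algebra_simps)
    also have "\<dots> \<le> \<kappa> * D * R * M * L * ?h + 2 * \<kappa> * (D * R * M * N) * S * ?Ta + \<kappa> * (D * M * N) * \<epsilon> * ?Ta"
      using hT \<kappa>_pos M_pos R N S0 e L(1) by (intro add_mono mult_left_mono mult_nonneg_nonneg) auto
    finally have "D * (R * (M * S) + \<epsilon> * M) + M * S * ?T1
      + \<kappa> * (D * (R * (M * L + M * (S + S) * N) + \<epsilon> * (M * N))) * ?h
      \<le> D * (R * (M * S) + \<epsilon> * M) + M * S * ?T1
        + (\<kappa> * D * R * M * L * ?h + 2 * \<kappa> * (D * R * M * N) * S * ?Ta + \<kappa> * (D * M * N) * \<epsilon> * ?Ta)"
      by simp
    also have "\<dots> = norm (?u p) * (D * R * M + M * ?T1 + 2 * \<kappa> * (D * R * M * N) * ?Ta)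
        + \<epsilon> * (D * M + \<kappa> * (D * M * N) * ?Ta)
        + L * (?h * (D * R * M + M * ?T1 + \<kappa> * (D * R * M) + 2 * \<kappa> * (D * R * M * N) * ?Ta))"
      unfolding S_def by (simp add: algebra_simps add_divide_distrib)
    also have "\<dots> \<le> norm (?u p) * gain R N + \<epsilon> * gain R N + L * (1 / 2)"
    proof (intro add_mono mult_left_mono small)
      have nn: "0 \<le> D * R * M" "0 \<le> M * ?T1" "0 \<le> 2 * \<kappa> * (D * R * M * N) * ?Ta"
        "0 \<le> D * M" "0 \<le> \<kappa> * (D * M * N) * ?Ta"
        using M_pos \<kappa>_pos R N by (auto intro!: mult_nonneg_nonneg divide_nonneg_nonneg)
      then show "D * R * M + M * ?T1 + 2 * \<kappa> * (D * R * M * N) * ?Ta \<le> gain R N"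
        "D * M + \<kappa> * (D * M * N) * ?Ta \<le> gain R N"
        unfolding gain_def by linarith+
    qed (use e L in auto)
    also have "\<dots> = ?c + L / 2" by (simp add: algebra_simps)
    finally have "D * (R * (M * S) + \<epsilon> * M) + M * S * ?T1
      + \<kappa> * (D * (R * (M * L + M * (S + S) * N) + \<epsilon> * (M * N))) * ?h \<le> ?c + L / 2" .
    then show "norm (?u t - ?u s) \<le> (?c + L / 2) * (t - s) powr \<alpha>"
      using 1 mult_right_mono[OF _ powr_ge_zero] order_trans by blast
  qed
  then show ?thesis using c unfolding hoelder_on_def by auto
qed

text \<open>Drivers with a common Hoelder constant R share a step length h. Over one step the
  difference of the solutions plus \<epsilon> grows at most by the factor G, and n steps cover
  [0,T].\<close>

lemma flow_locally_lipschitz: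
  assumes "0 \<le> R"
  shows "\<exists>C\<ge>0. \<forall>w y w' y'. solves w y \<longrightarrow> solves w' y' \<longrightarrow> hoelder_on 0 T R w \<longrightarrow> hoelder_on 0 T R w' \<longrightarrow>
    hdist y y' \<le> C * hdist w w'"
proof -
  define N where "N = 2 * (D * R * M + M * T powr (1 - \<alpha>))"
  have N: "0 \<le> N" unfolding N_def using \<open>0 \<le> R\<close> M_pos by (intro mult_nonneg_nonneg add_nonneg_nonneg) auto
  define X where "X = D * R * M + M * T powr (1 - \<alpha>) + \<kappa> * (D * R * M)
      + 2 * \<kappa> * (D * R * M * N) * T powr \<alpha>"
  have nn: "0 \<le> D * R * M" "0 \<le> M * T powr (1 - \<alpha>)" "0 \<le> \<kappa> * (D * R * M)"
    "0 \<le> 2 * \<kappa> * (D * R * M * N) * T powr \<alpha>"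
    using M_pos \<kappa>_pos \<open>0 \<le> R\<close> N by (auto intro!: mult_nonneg_nonneg divide_nonneg_nonneg)
  have X: "\<kappa> * (D * R * M) \<le> X" "0 \<le> X" unfolding X_def using nn by linarith+
  \<comment> \<open>Chosen so that \<open>h powr \<alpha> * X\<close> stays below 1/2; X majorises
    the coefficients in the smallness conditions of both \<open>apriori_bound\<close> and
    \<open>difference_bound\<close>.\<close>
  define h where "h = (1 / (2 * (X + 1))) powr (1 / \<alpha>)"
  have h: "0 < h" using X(2) by (simp add: h_def)
  have ha: "h powr \<alpha> = 1 / (2 * (X + 1))" using X(2) \<alpha>_pos by (simp add: h_def powr_powr)
  have small: "(q - p) powr \<alpha> * X \<le> 1 / 2" if "p \<le> q" "q - p \<le> h" for p q
  proof -
    have "(q - p) powr \<alpha> \<le> h powr \<alpha>" using that \<alpha>_pos by (intro powr_mono2) auto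
    then have "(q - p) powr \<alpha> * X \<le> 1 / (2 * (X + 1)) * X" unfolding ha by (intro mult_right_mono X(2))
    also have "\<dots> \<le> 1 / 2" using X(2) by (simp add: field_simps)
    finally show ?thesis .
  qed
  define G where "G = 1 + 2 * gain R N * T powr \<alpha>"
  have gn: "0 \<le> gain R N" by (rule gain_nonneg[OF \<open>0 \<le> R\<close> N])
  then have G: "1 \<le> G" by (simp add: G_def)
  obtain n where n: "T / h \<le> real n" using real_arch_simple by blast
  \<comment> \<open>The first summand serves increments over at most h, through the local bound. The
    second serves longer ones, through the supremum bound, as
    \<open>(t - s) powr \<alpha> / h powr \<alpha>\<close> is then at least 1.\<close>
  define C where "C = (2 * gain R N + 2 / h powr \<alpha>) * G ^ n"
  have "0 \<le> C" unfolding C_def using gn G by (intro mult_nonneg_nonneg add_nonneg_nonneg) auto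
  moreover have "hdist y y' \<le> C * hdist w w'"
    if sol: "solves w y" and sol': "solves w' y'" and w: "hoelder_on 0 T R w" and w': "hoelder_on 0 T R w'"
    for w y w' y'
  proof -
    let ?u = "\<lambda>t. y t - y' t"
    define \<epsilon> where "\<epsilon> = hdist w w'"
    have e: "0 \<le> \<epsilon>" unfolding \<epsilon>_def by (rule hoelder_dist_nonneg)
    have yL: "y \<in> paths a" "y' \<in> paths a"
      using sol sol' by (auto simp: young_solution_def)
    have ww': "hoelder_on 0 T \<epsilon> (\<lambda>t. w t - w' t)"
      unfolding hoelder_on_def using e hoelder_dist_increment[of w 0 w'] sol sol' by (auto simp: \<epsilon>_def)
    have loc: "hoelder_on p q (2 * (gain R N * (norm (?u p) + \<epsilon>))) ?u"
      if pq: "0 \<le> p" "p \<le> q" "q \<le> T" "q - p \<le> h" for p q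
    proof (rule difference_bound[OF sol sol' w ww' pq(1-3)])
      have "\<kappa> * (D * R * M) * (q - p) powr \<alpha> \<le> X * (q - p) powr \<alpha>"
        by (intro mult_right_mono X(1)) simp
      also have "\<dots> \<le> 1 / 2" using small[OF pq(2,4)] by (simp add: mult.commute)
      finally show "hoelder_on p q N y'"
        unfolding N_def by (rule apriori_bound[OF sol' w' pq(1,3)])
    qed (use small[OF pq(2,4)] in \<open>simp only: X_def\<close>)
    have step: "norm (?u q) + \<epsilon> \<le> G * (norm (?u p) + \<epsilon>)"
      if pq: "0 \<le> p" "p \<le> q" "q \<le> T" "q - p \<le> h" for p q
    proof (cases "p = q")
      case True
      have "1 * (norm (?u p) + \<epsilon>) \<le> G * (norm (?u p) + \<epsilon>)" using G e by (intro mult_right_mono) auto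
      then show ?thesis using True by simp
    next
      case False
      have "norm (?u q - ?u p) \<le> 2 * (gain R N * (norm (?u p) + \<epsilon>)) * (q - p) powr \<alpha>"
        by (rule hoelder_onD(2)[OF loc[OF pq]]) (use pq False in auto)
      also have "\<dots> \<le> 2 * (gain R N * (norm (?u p) + \<epsilon>)) * T powr \<alpha>"
        using pq \<alpha>_pos gn e by (intro mult_left_mono powr_mono2 mult_nonneg_nonneg add_nonneg_nonneg) auto
      finally have "norm (?u q) \<le> norm (?u p) + 2 * (gain R N * (norm (?u p) + \<epsilon>)) * T powr \<alpha>"
        using norm_triangle_ineq[of "?u p" "?u q - ?u p"] by simp
      then show ?thesis by (simp add: G_def algebra_simps)
    qed
    have grow: "norm (?u r) + \<epsilon> \<le> G ^ k * \<epsilon>" if "0 \<le> r" "r \<le> T" "r \<le> real k * h" for k r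
      using that
    proof (induction k arbitrary: r)
      case 0
      then have "r = 0" by simp
      then show ?case using little_hoelder_atD(2)[OF yL(1)] little_hoelder_atD(2)[OF yL(2)] by simp
    next
      case (Suc k)
      \<comment> \<open>The preceding grid point; the minimum covers an r that has not yet passed
        it.\<close>
      let ?p = "min r (real k * h)"
      have "norm (?u r) + \<epsilon> \<le> G * (norm (?u ?p) + \<epsilon>)"
        by (rule step) (use Suc.prems h in \<open>auto simp: algebra_simps min_def\<close>)
      also have "\<dots> \<le> G * (G ^ k * \<epsilon>)"
        using Suc.prems h G by (intro mult_left_mono Suc.IH) auto
      finally show ?case by simp
    qed
    have nh: "T \<le> real n * h" using n h by (simp add: field_simps)
    have sup: "norm (?u r) + \<epsilon> \<le> G ^ n * \<epsilon>" if "0 \<le> r" "r \<le> T" for r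
      by (rule grow) (use that nh in auto)
    show ?thesis
      unfolding \<epsilon>_def[symmetric]
    proof (rule hoelder_dist_le[OF yL])
      fix s t assume st: "0 \<le> s" "s < t" "t \<le> T"
      have Ge: "0 \<le> G ^ n * \<epsilon>" using G e by (intro mult_nonneg_nonneg) auto
      show "norm (?u t - ?u s) \<le> C * \<epsilon> * (t - s) powr \<alpha>"
      proof (cases "t - s \<le> h")
        case True
        have "norm (?u t - ?u s) \<le> 2 * (gain R N * (norm (?u s) + \<epsilon>)) * (t - s) powr \<alpha>"
          by (rule hoelder_onD(2)[OF loc[of s t]]) (use st True in auto)
        also have "\<dots> \<le> 2 * (gain R N * (G ^ n * \<epsilon>)) * (t - s) powr \<alpha>"
          using st gn by (intro mult_right_mono mult_left_mono sup) auto
        also have "\<dots> = (2 * gain R N * G ^ n * \<epsilon>) * (t - s) powr \<alpha>" by simp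
        also have "\<dots> \<le> (C * \<epsilon>) * (t - s) powr \<alpha>"
          unfolding C_def using Ge G e by (intro mult_right_mono) (auto simp: algebra_simps)
        finally show ?thesis .
      next
        case False
        have "norm (?u t - ?u s) \<le> norm (?u t) + norm (?u s)" by (rule norm_triangle_ineq4)
        also have "\<dots> \<le> 2 * (G ^ n * \<epsilon>) * 1"
          using sup[of s] sup[of t] st e by simp
        also have "\<dots> \<le> 2 * (G ^ n * \<epsilon>) * ((t - s) powr \<alpha> / h powr \<alpha>)"
        proof (intro mult_left_mono)
          have "h powr \<alpha> \<le> (t - s) powr \<alpha>" using False h \<alpha>_pos by (intro powr_mono2) auto
          then show "1 \<le> (t - s) powr \<alpha> / h powr \<alpha>" using h by (simp add: le_divide_eq)
        qed (use Ge in auto)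
        also have "\<dots> = (2 / h powr \<alpha> * (G ^ n * \<epsilon>)) * (t - s) powr \<alpha>" by simp
        also have "\<dots> \<le> (C * \<epsilon>) * (t - s) powr \<alpha>"
          unfolding C_def using mult_nonneg_nonneg[OF gn Ge] by (intro mult_right_mono) (auto simp: algebra_simps)
        finally show ?thesis .
      qed
    qed
  qed
  ultimately show ?thesis by blast
qed

text \<open>All drivers within distance 1 of w have Hoelder constant at most
  \<open>seminorm w + 1\<close>, so one Lipschitz constant works near w, and continuity gives
  measurability.\<close>

lemma flow_measurable:
  assumes flow: "\<And>w. w \<in> paths 0 \<Longrightarrow> young_solution T \<alpha> V0 V a w (\<Phi> w)"
  shows "\<Phi> \<in> measurable (pborel 0) (pborel a)"
proof (rule measurable_path_borel_continuous)
  show "\<Phi> w \<in> paths a" if "w \<in> paths 0" for w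
    using flow[OF that] by (simp add: young_solution_def)
  fix w :: "'d path" and e :: real assume w: "w \<in> paths 0" and "e > 0"
  let ?S = "seminorm w"
  have S0: "0 \<le> ?S" using hoelder_on_path[OF w] by (rule hoelder_onD(1))
  obtain C where C: "C \<ge> 0" "\<And>w y w' y'. solves w y \<Longrightarrow> solves w' y' \<Longrightarrow> hoelder_on 0 T (?S + 1) w \<Longrightarrow>
      hoelder_on 0 T (?S + 1) w' \<Longrightarrow> hdist y y' \<le> C * hdist w w'"
    using flow_locally_lipschitz[of "?S + 1"] S0 by auto
  have "hdist (\<Phi> w) (\<Phi> w') < e"
    if w': "w' \<in> paths 0" and d: "hdist w w' < min 1 (e / (C + 1))" for w'
  proof -
    have inc: "norm (w t - w s) \<le> ?S * (t - s) powr \<alpha>" if "0 \<le> s" "s < t" "t \<le> T" for s t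
      by (rule hoelder_onD(2)[OF hoelder_on_path[OF w] that])
    have "norm (w' t - w' s) \<le> (?S + 1) * (t - s) powr \<alpha>" if st: "0 \<le> s" "s < t" "t \<le> T" for s t
    proof -
      have "norm ((w t - w' t) - (w s - w' s)) \<le> hdist w w' * (t - s) powr \<alpha>"
        by (rule hoelder_dist_increment[OF w w']) (use st in auto)
      also have "\<dots> \<le> 1 * (t - s) powr \<alpha>" using d by (intro mult_right_mono) auto
      finally have "norm ((w t - w' t) - (w s - w' s)) \<le> (t - s) powr \<alpha>" by simp
      moreover have "w' t - w' s = (w t - w s) - ((w t - w' t) - (w s - w' s))" by simp
      then have "norm (w' t - w' s) \<le> norm (w t - w s) + norm ((w t - w' t) - (w s - w' s))"
        by (metis norm_triangle_ineq4)
      ultimately show ?thesis using inc[OF st] by (simp add: distrib_right)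
    qed
    then have Hw': "hoelder_on 0 T (?S + 1) w'" using S0 by (simp add: hoelder_on_def)
    have "norm (w t - w s) \<le> (?S + 1) * (t - s) powr \<alpha>" if "0 \<le> s" "s < t" "t \<le> T" for s t
      using inc[OF that] powr_ge_zero[of "t - s" \<alpha>] unfolding distrib_right by linarith
    then have "hoelder_on 0 T (?S + 1) w" using S0 by (simp add: hoelder_on_def)
    then have "hdist (\<Phi> w) (\<Phi> w') \<le> C * hdist w w'"
      using w w' flow Hw' by (intro C(2)) auto
    also have "\<dots> \<le> C * (e / (C + 1))" using d C(1) by (intro mult_left_mono) auto
    also have "\<dots> < e" using C(1) \<open>e > 0\<close> by (simp add: field_simps)
    finally show ?thesis .
  qed
  then show "\<exists>d>0. \<forall>w'\<in>paths 0. hdist w w' < d \<longrightarrow>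
      hdist (\<Phi> w) (\<Phi> w') < e"
    using C(1) \<open>e > 0\<close> by (intro exI[of _ "min 1 (e / (C + 1))"]) auto
qed

end

section \<open>Estimates for bounded smooth vector fields\<close>

text \<open>\<open>C_b_infinity\<close> bounds derivatives one fixed direction at a time; expanding
  v in the basis turns this into an operator bound.\<close>

lemma partial_derivatives_bound:
  fixes g :: "'a::euclidean_space \<Rightarrow> 'b::real_normed_vector"
  assumes g: "\<And>x. g differentiable (at x)"
    and K: "\<And>x b. b \<in> Basis \<Longrightarrow> norm (frechet_derivative g (at x) b) \<le> K b"
  shows "norm (frechet_derivative g (at x) v) \<le> (\<Sum>b\<in>Basis. K b) * norm v"
    and "norm (g x - g y) \<le> (\<Sum>b\<in>Basis. K b) * norm (x - y)"
proof -
  have D: "(g has_derivative frechet_derivative g (at x)) (at x)" for x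
    using g frechet_derivative_works by blast
  have *: "norm (frechet_derivative g (at x) v) \<le> (\<Sum>b\<in>Basis. K b) * norm v" for x v
  proof -
    interpret bounded_linear "frechet_derivative g (at x)" using D by (rule has_derivative_bounded_linear)
    have "frechet_derivative g (at x) v = frechet_derivative g (at x) (\<Sum>b\<in>Basis. (v \<bullet> b) *\<^sub>R b)"
      by (simp add: euclidean_representation)
    also have "\<dots> = (\<Sum>b\<in>Basis. (v \<bullet> b) *\<^sub>R frechet_derivative g (at x) b)"
      by (simp add: sum scaleR)
    finally have eq: "frechet_derivative g (at x) v = (\<Sum>b\<in>Basis. (v \<bullet> b) *\<^sub>R frechet_derivative g (at x) b)" .
    have "norm (frechet_derivative g (at x) v) \<le> (\<Sum>b\<in>Basis. norm v * K b)"
      unfolding eq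
    proof (rule sum_norm_le)
      fix b :: 'a assume "b \<in> Basis"
      then show "norm ((v \<bullet> b) *\<^sub>R frechet_derivative g (at x) b) \<le> norm v * K b"
        using K[of b x] Basis_le_norm[of b v] by (simp add: mult_mono')
    qed
    also have "\<dots> = (\<Sum>b\<in>Basis. K b) * norm v" by (simp only: sum_distrib_left mult.commute[of _ "norm v"])
    finally show ?thesis .
  qed
  then show "norm (frechet_derivative g (at x) v) \<le> (\<Sum>b\<in>Basis. K b) * norm v" .
  show "norm (g x - g y) \<le> (\<Sum>b\<in>Basis. K b) * norm (x - y)"
    by (rule differentiable_bound[of UNIV, OF _ _ onorm_le[OF *]]) (use D in auto)
qed

text \<open>Mean value inequality for the difference of f along the segments from x' to x and from
  y' to y. Its derivative splits into D applied to the second difference and a change of base point,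
  which K controls.\<close>

lemma four_point_bound:
  fixes f :: "'a::real_normed_vector \<Rightarrow> 'b::real_normed_vector"
  assumes D: "\<And>x. (f has_derivative D x) (at x)"
    and L: "\<And>x v. norm (D x v) \<le> L * norm v"
    and K: "\<And>x y v. norm (D x v - D y v) \<le> K * norm (x - y) * norm v" and "0 \<le> K"
  shows "norm ((f x - f y) - (f x' - f y')) \<le>
    L * norm ((x - y) - (x' - y')) + K * (norm (x - y) + norm (x' - y')) * norm (y - y')"
proof -
  let ?p = "\<lambda>\<theta>::real. x' + \<theta> *\<^sub>R (x - x')" and ?q = "\<lambda>\<theta>::real. y' + \<theta> *\<^sub>R (y - y')"
  let ?B = "L * norm ((x - y) - (x' - y')) + K * (norm (x - y) + norm (x' - y')) * norm (y - y')"
  let ?\<phi> = "\<lambda>\<theta>. f (?p \<theta>) - f (?q \<theta>)"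
  let ?d = "\<lambda>\<theta> v. D (?p \<theta>) (v *\<^sub>R (x - x')) - D (?q \<theta>) (v *\<^sub>R (y - y'))"
  have der: "(?\<phi> has_derivative ?d \<theta>) (at \<theta> within {0..1})" for \<theta>
  proof (rule has_derivative_diff)
    show "((\<lambda>\<theta>. f (?p \<theta>)) has_derivative (\<lambda>v. D (?p \<theta>) (v *\<^sub>R (x - x')))) (at \<theta> within {0..1})"
      by (rule has_derivative_compose[OF _ D]) (auto intro!: derivative_eq_intros)
    show "((\<lambda>\<theta>. f (?q \<theta>)) has_derivative (\<lambda>v. D (?q \<theta>) (v *\<^sub>R (y - y')))) (at \<theta> within {0..1})"
      by (rule has_derivative_compose[OF _ D]) (auto intro!: derivative_eq_intros)
  qed
  have "onorm (?d \<theta>) \<le> ?B" if \<theta>: "\<theta> \<in> {0..1}" for \<theta>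
  proof (rule onorm_le)
    fix v :: real
    interpret P: bounded_linear "D (?p \<theta>)" using D by (rule has_derivative_bounded_linear)
    interpret Q: bounded_linear "D (?q \<theta>)" using D by (rule has_derivative_bounded_linear)
    have "?p \<theta> - ?q \<theta> = (1 - \<theta>) *\<^sub>R (x' - y') + \<theta> *\<^sub>R (x - y)" by (simp add: algebra_simps)
    then have "norm (?p \<theta> - ?q \<theta>) \<le> (1 - \<theta>) * norm (x' - y') + \<theta> * norm (x - y)"
      using \<theta> norm_triangle_ineq[of "(1 - \<theta>) *\<^sub>R (x' - y')" "\<theta> *\<^sub>R (x - y)"] by simp
    also have "\<dots> \<le> 1 * norm (x' - y') + 1 * norm (x - y)" using \<theta> by (intro add_mono mult_right_mono) auto
    finally have pq: "norm (?p \<theta> - ?q \<theta>) \<le> norm (x - y) + norm (x' - y')" by simp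
    have e: "(x - y) - (x' - y') = (x - x') - (y - y')" by simp
    have "?d \<theta> v = v *\<^sub>R (D (?p \<theta>) (x - x') - D (?q \<theta>) (y - y'))"
      unfolding P.scaleR Q.scaleR by (rule scaleR_diff_right[symmetric])
    also have "D (?p \<theta>) (x - x') - D (?q \<theta>) (y - y')
        = D (?p \<theta>) ((x - y) - (x' - y')) + (D (?p \<theta>) (y - y') - D (?q \<theta>) (y - y'))"
      unfolding e P.diff[of "x - x'" "y - y'"] by simp
    finally have "?d \<theta> v = v *\<^sub>R (D (?p \<theta>) ((x - y) - (x' - y')) + (D (?p \<theta>) (y - y') - D (?q \<theta>) (y - y')))" .
    moreover have "norm (D (?p \<theta>) ((x - y) - (x' - y')) + (D (?p \<theta>) (y - y') - D (?q \<theta>) (y - y'))) \<le> ?B"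
    proof (rule norm_triangle_le[OF add_mono[OF L]])
      have "norm (D (?p \<theta>) (y - y') - D (?q \<theta>) (y - y')) \<le> K * norm (?p \<theta> - ?q \<theta>) * norm (y - y')" by (rule K)
      also have "\<dots> \<le> K * (norm (x - y) + norm (x' - y')) * norm (y - y')"
        using pq \<open>0 \<le> K\<close> by (intro mult_right_mono mult_left_mono) auto
      finally show "norm (D (?p \<theta>) (y - y') - D (?q \<theta>) (y - y')) \<le> K * (norm (x - y) + norm (x' - y')) * norm (y - y')" .
    qed
    ultimately show "norm (?d \<theta> v) \<le> ?B * norm v"
      by (simp add: mult.commute[of _ "\<bar>v\<bar>"] mult_left_mono)
  qed
  then have "norm (?\<phi> 1 - ?\<phi> 0) \<le> ?B * norm (1 - 0 :: real)"
    by (intro differentiable_bound[OF _ der]) auto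
  then show ?thesis by simp
qed

text \<open>First derivatives give the Lipschitz estimate; second derivatives make the first ones
  Lipschitz, which feeds \<open>four_point_bound\<close>. M majorises all constants, and the summand
  1 keeps it positive.\<close>

lemma C_b_infinity_bounds:
  fixes f :: "'a::euclidean_space \<Rightarrow> 'b::real_normed_vector"
  assumes "C_b_infinity f"
  shows "\<exists>M>0. (\<forall>x. norm (f x) \<le> M) \<and> (\<forall>x y. norm (f x - f y) \<le> M * norm (x - y)) \<and>
    (\<forall>x y x' y'. norm ((f x - f y) - (f x' - f y')) \<le>
      M * norm ((x - y) - (x' - y')) + M * (norm (x - y) + norm (x' - y')) * norm (y - y'))"
proof -
  let ?D = "\<lambda>v x. frechet_derivative f (at x) v"
  have it0: "iterated_derivative f [] = f" by (rule ext) simp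
  have it1: "iterated_derivative f [v] = ?D v" for v by (rule ext) (simp only: iterated_derivative.simps(2) it0)
  have it2: "iterated_derivative f [u, v] x = frechet_derivative (?D v) (at x) u" for u v x
    by (simp only: iterated_derivative.simps(2)[of f u "[v]"] it1)
  have smooth: "iterated_derivative f vs differentiable (at x)" for vs x
    using assms by (auto simp: C_b_infinity_def smooth_def)
  have bdd: "\<exists>B. \<forall>x. norm (iterated_derivative f vs x) \<le> B" for vs
    using assms unfolding C_b_infinity_def bounded_iff by blast
  have f: "f differentiable (at x)" for x using smooth[of "[]"] by (simp only: it0)
  have Df: "?D v differentiable (at x)" for v x using smooth[of "[v]"] by (simp only: it1)
  obtain B0 where B0: "\<And>x. norm (f x) \<le> B0" using bdd[of "[]"] unfolding it0 by blast
  have "\<exists>B. \<forall>x. norm (?D v x) \<le> B" for v using bdd[of "[v]"] unfolding it1 .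
  then obtain B1 where B1: "\<And>v x. norm (?D v x) \<le> B1 v" by metis
  define B2 where "B2 u v = (SOME B. \<forall>x. norm (frechet_derivative (?D v) (at x) u) \<le> B)" for u v
  have B2: "norm (frechet_derivative (?D v) (at x) u) \<le> B2 u v" for u v x
    using someI_ex[OF bdd[of "[u, v]", unfolded it2]] unfolding B2_def by blast
  define L where "L = (\<Sum>b\<in>(Basis::'a set). B1 b)"
  define K where "K = (\<Sum>v\<in>Basis. \<Sum>u\<in>Basis. B2 u v)"
  define M where "M = 1 + \<bar>B0\<bar> + \<bar>L\<bar> + \<bar>K\<bar>"
  have D: "(f has_derivative (\<lambda>v. ?D v x)) (at x)" for x
    using f[of x] unfolding frechet_derivative_works .
  have DL: "norm (?D v x) \<le> L * norm v" for v x
    unfolding L_def by (rule partial_derivatives_bound(1)[OF f B1])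
  have fL: "norm (f x - f y) \<le> L * norm (x - y)" for x y
    unfolding L_def by (rule partial_derivatives_bound(2)[OF f B1])
  have DK: "norm (?D v x - ?D v y) \<le> M * norm (x - y) * norm v" for v x y
  proof -
    interpret X: bounded_linear "\<lambda>v. ?D v x" using D by (rule has_derivative_bounded_linear)
    interpret Y: bounded_linear "\<lambda>v. ?D v y" using D by (rule has_derivative_bounded_linear)
    have "?D v x - ?D v y = ?D (\<Sum>b\<in>Basis. (v \<bullet> b) *\<^sub>R b) x - ?D (\<Sum>b\<in>Basis. (v \<bullet> b) *\<^sub>R b) y"
      by (simp add: euclidean_representation)
    also have "\<dots> = (\<Sum>b\<in>Basis. (v \<bullet> b) *\<^sub>R (?D b x - ?D b y))"
      by (simp add: X.sum X.scaleR Y.sum Y.scaleR sum_subtractf scaleR_diff_right)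
    finally have eq: "?D v x - ?D v y = (\<Sum>b\<in>Basis. (v \<bullet> b) *\<^sub>R (?D b x - ?D b y))" .
    have "norm (?D v x - ?D v y) \<le> (\<Sum>b\<in>Basis. norm v * ((\<Sum>u\<in>Basis. B2 u b) * norm (x - y)))"
      unfolding eq
    proof (rule sum_norm_le)
      fix b :: 'a assume "b \<in> Basis"
      then show "norm ((v \<bullet> b) *\<^sub>R (?D b x - ?D b y)) \<le> norm v * ((\<Sum>u\<in>Basis. B2 u b) * norm (x - y))"
        unfolding norm_scaleR
        using Basis_le_norm[of b v] partial_derivatives_bound(2)[where g = "?D b" and x = x and y = y, OF Df B2]
        by (intro mult_mono') auto
    qed
    also have "\<dots> = K * (norm (x - y) * norm v)"
      unfolding K_def by (simp only: sum_distrib_left[symmetric] sum_distrib_right[symmetric] mult_ac)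
    also have "\<dots> \<le> M * (norm (x - y) * norm v)"
      by (intro mult_right_mono) (auto simp: M_def)
    finally show ?thesis by (simp add: mult.assoc)
  qed
  have M: "M > 0" "L \<le> M" "B0 \<le> M" by (auto simp: M_def)
  have DM: "norm (?D v x) \<le> M * norm v" for v x
    by (rule order_trans[OF DL mult_right_mono[OF M(2)]]) simp
  show ?thesis
  proof (intro exI[of _ M] conjI allI)
    show "norm (f x) \<le> M" for x using B0[of x] M(3) by simp
    show "norm (f x - f y) \<le> M * norm (x - y)" for x y
      using fL[of x y] mult_right_mono[OF M(2), of "norm (x - y)"] by simp
    show "norm ((f x - f y) - (f x' - f y')) \<le>
      M * norm ((x - y) - (x' - y')) + M * (norm (x - y) + norm (x' - y')) * norm (y - y')" for x y x' y'
      by (rule four_point_bound[OF D DM DK]) (use M in simp)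
  qed (rule M(1))
qed

lemma young_flow_exists:
  fixes V0 :: "real ^ 'e::finite \<Rightarrow> real ^ 'e" and V :: "'d::finite \<Rightarrow> real ^ 'e \<Rightarrow> real ^ 'e"
  assumes "0 < T" "1 / 2 < \<alpha>" "\<alpha> \<le> 1" "C_b_infinity V0" "\<And>j. C_b_infinity (V j)"
  shows "\<exists>M. young_flow T \<alpha> V0 V (real CARD('d)) M"
proof -
  obtain M0 where M0: "M0 > 0" "\<And>x. norm (V0 x) \<le> M0" "\<And>x y. norm (V0 x - V0 y) \<le> M0 * norm (x - y)"
    using C_b_infinity_bounds[OF assms(4)] by auto
  obtain M where M: "\<And>j. M j > 0" "\<And>j x. norm (V j x) \<le> M j"
    "\<And>j x y. norm (V j x - V j y) \<le> M j * norm (x - y)"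
    "\<And>j x y x' y'. norm ((V j x - V j y) - (V j x' - V j y')) \<le>
      M j * norm ((x - y) - (x' - y')) + M j * (norm (x - y) + norm (x' - y')) * norm (y - y')"
    using C_b_infinity_bounds[OF assms(5)] by metis
  \<comment> \<open>Adding the constants of all fields gives one that serves each of them.\<close>
  define C where "C = M0 + (\<Sum>j\<in>UNIV. M j)"
  have S: "M j \<le> (\<Sum>j\<in>UNIV. M j)" for j by (rule member_le_sum) (use M(1) in \<open>auto intro: less_imp_le\<close>)
  then have C: "M0 \<le> C" "\<And>j. M j \<le> C" unfolding C_def using M0(1) M(1) less_imp_le
    by (auto intro!: sum_nonneg add_increasing)
  have "young_flow T \<alpha> V0 V (real CARD('d)) C"
  proof
    show "0 < T" "0 < \<alpha>" "\<alpha> \<le> 1" "1 / 2 < \<alpha>" "0 < C" using assms(1-3) C(1) M0(1) by auto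
    fix x y x' y' j
    show "norm (V0 x) \<le> C" "norm (V j x) \<le> C" using M0(2) M(2) C order_trans by blast+
    show "norm (V0 x - V0 y) \<le> C * norm (x - y)"
      using M0(3)[of x y] mult_right_mono[OF C(1), of "norm (x - y)"] by simp
    show "norm (V j x - V j y) \<le> C * norm (x - y)"
      using M(3)[of j x y] mult_right_mono[OF C(2)[of j], of "norm (x - y)"] by simp
    have "M j * norm ((x - y) - (x' - y')) + M j * (norm (x - y) + norm (x' - y')) * norm (y - y')
      \<le> C * norm ((x - y) - (x' - y')) + C * (norm (x - y) + norm (x' - y')) * norm (y - y')"
      by (intro add_mono mult_right_mono C(2)) auto
    then show "norm ((V j x - V j y) - (V j x' - V j y')) \<le>
      C * norm ((x - y) - (x' - y')) + C * (norm (x - y) + norm (x' - y')) * norm (y - y')"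
      using M(4) order_trans by blast
  qed simp
  then show ?thesis by blast
qed

section \<open>Trigonometric functionals in the Sobolev spaces\<close>

text \<open>The Taylor polynomial at 0 of x -> cos (x + \<theta>), whose k-th derivative at 0 is cos
  (\<theta> + k pi/2). With the phase as a parameter, differentiation stays inside the family. n
  counts the terms, so the degree is below n.\<close>

definition cos_taylor :: "nat \<Rightarrow> real \<Rightarrow> real poly" where
  "cos_taylor n \<theta> = (\<Sum>k<n. monom (cos (\<theta> + real k * (pi / 2)) / fact k) k)"

lemma pderiv_cos_taylor: "pderiv (cos_taylor n \<theta>) = cos_taylor (n - 1) (\<theta> + pi / 2)"
\<comment> \<open>For n = 0 both sides are the zero polynomial, as 0 - 1 = 0 on the
  naturals.\<close>
proof (cases n)
  case (Suc m)
  have sum: "pderiv (sum f A) = (\<Sum>k\<in>A. pderiv (f k))" for f :: "nat \<Rightarrow> real poly" and A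
    by (induction A rule: infinite_finite_induct) (auto simp: pderiv_add)
  have "pderiv (cos_taylor n \<theta>) =
      (\<Sum>k<Suc m. monom (real k * (cos (\<theta> + real k * (pi / 2)) / fact k)) (k - 1))"
    unfolding cos_taylor_def Suc sum pderiv_monom ..
  also have "\<dots> = (\<Sum>k<m. monom (cos (\<theta> + pi / 2 + real k * (pi / 2)) / fact k) k)"
    by (subst sum.lessThan_Suc_shift) (simp add: fact_Suc add.assoc distrib_right del: of_nat_Suc, simp add: algebra_simps add_divide_distrib)
  finally show ?thesis by (simp add: cos_taylor_def Suc)
qed (simp add: cos_taylor_def)

lemma pderiv_funpow_cos_taylor:
  "(pderiv ^^ j) (cos_taylor n \<theta>) = cos_taylor (n - j) (\<theta> + real j * (pi / 2))"
  by (induction j) (simp_all add: pderiv_cos_taylor algebra_simps add_divide_distrib)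

lemma poly_cos_taylor: "poly (cos_taylor n \<theta>) x = (\<Sum>k<n. cos (\<theta> + real k * (pi / 2)) / fact k * x ^ k)"
  by (simp add: cos_taylor_def poly_sum poly_monom)

text \<open>Real part of the exponential series of exp (i x) times \<open>cis \<theta>\<close>;
  powers of i are rotations by multiples of pi/2.\<close>

lemma poly_cos_taylor_tendsto: "(\<lambda>n. poly (cos_taylor n \<theta>) x) \<longlonglongrightarrow> cos (x + \<theta>)"
proof -
  have "(\<lambda>k. cis \<theta> * ((\<i> * complex_of_real x) ^ k /\<^sub>R fact k)) sums (cis \<theta> * exp (\<i> * complex_of_real x))"
    by (intro sums_mult exp_converges)
  then have "(\<lambda>k. Re (cis \<theta> * ((\<i> * complex_of_real x) ^ k /\<^sub>R fact k))) sums Re (cis \<theta> * exp (\<i> * complex_of_real x))"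
    by (rule sums_Re)
  moreover have "Re (cis \<theta> * ((\<i> * complex_of_real x) ^ k /\<^sub>R fact k)) = cos (\<theta> + real k * (pi / 2)) / fact k * x ^ k" for k
  proof -
    have "cis \<theta> * ((\<i> * complex_of_real x) ^ k /\<^sub>R fact k)
        = complex_of_real (x ^ k / fact k) * (cis \<theta> * cis (pi / 2) ^ k)"
      by (simp add: power_mult_distrib scaleR_conv_of_real field_simps)
    also have "\<dots> = complex_of_real (x ^ k / fact k) * cis (\<theta> + real k * (pi / 2))"
    proof -
      have "cis (pi / 2) ^ k = cis (real k * (pi / 2))" by (rule Complex.DeMoivre)
      then show ?thesis using cis_mult[of \<theta> "real k * (pi / 2)"] by (simp only:)
    qed
    finally have eq: "cis \<theta> * ((\<i> * complex_of_real x) ^ k /\<^sub>R fact k)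
        = complex_of_real (x ^ k / fact k) * cis (\<theta> + real k * (pi / 2))" .
    have R: "Re (complex_of_real r * cis \<phi>) = r * cos \<phi>" for r \<phi> by simp
    show ?thesis unfolding eq R by simp
  qed
  moreover have "Re (cis \<theta> * exp (\<i> * complex_of_real x)) = cos (x + \<theta>)"
    by (simp add: cis_conv_exp exp_add[symmetric] flip: cis_conv_exp) (simp add: cis_conv_exp[symmetric] cis_mult add.commute cos_add)
  ultimately show ?thesis by (simp add: sums_def poly_cos_taylor)
qed

text \<open>A majorant independent of n, for dominated convergence under a Gaussian law.\<close>

lemma poly_cos_taylor_bound: "\<bar>poly (cos_taylor n \<theta>) x\<bar> \<le> exp \<bar>x\<bar>"
proof -
  have "\<bar>poly (cos_taylor n \<theta>) x\<bar> \<le> (\<Sum>k<n. \<bar>cos (\<theta> + real k * (pi / 2)) / fact k * x ^ k\<bar>)"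
    unfolding poly_cos_taylor by (rule sum_abs)
  also have "\<dots> \<le> (\<Sum>k<n. \<bar>x\<bar> ^ k /\<^sub>R fact k)"
  proof (rule sum_mono)
    fix k
    have "\<bar>cos (\<theta> + real k * (pi / 2)) / fact k * x ^ k\<bar> = \<bar>cos (\<theta> + real k * (pi / 2))\<bar> * (\<bar>x\<bar> ^ k /\<^sub>R fact k)"
      by (simp add: abs_mult power_abs field_simps)
    also have "\<dots> \<le> 1 * (\<bar>x\<bar> ^ k /\<^sub>R fact k)" by (intro mult_right_mono) auto
    finally show "\<bar>cos (\<theta> + real k * (pi / 2)) / fact k * x ^ k\<bar> \<le> \<bar>x\<bar> ^ k /\<^sub>R fact k" by simp
  qed
  also have "\<dots> \<le> exp \<bar>x\<bar>"
    unfolding exp_def using summable_exp_generic[of "\<bar>x\<bar>"] by (intro sum_le_suminf) auto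
  finally show ?thesis .
qed

lemma pderiv_funpow_diff: "(pderiv ^^ j) (p - q) = (pderiv ^^ j) p - (pderiv ^^ j) q"
  for p q :: "real poly"
  by (induction j) (auto simp: pderiv_diff)

text \<open>For squares of values of a linear form this is the Hilbert--Schmidt sum of its j-th
  tensor power: the sum over j-tuples factorises.\<close>

lemma sum_lists_prod_list:
  fixes f :: "'a \<Rightarrow> real"
  assumes "finite E"
  shows "(\<Sum>hs\<in>{hs. set hs \<subseteq> E \<and> length hs = j}. prod_list (map f hs)) = (\<Sum>h\<in>E. f h) ^ j"
proof (induction j)
  case 0
  have "{hs. set hs \<subseteq> E \<and> length hs = 0} = {[]}" by auto
  then show ?case by simp
next
  case (Suc j)
  let ?L = "{hs. set hs \<subseteq> E \<and> length hs = j}"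
  have "(\<Sum>hs\<in>{hs. set hs \<subseteq> E \<and> length hs = Suc j}. prod_list (map f hs))
      = (\<Sum>(hs, h)\<in>?L \<times> E. f h * prod_list (map f hs))"
    unfolding lists_length_Suc_eq
    by (subst sum.reindex) (auto simp: inj_on_def intro!: sum.cong)
  also have "\<dots> = (\<Sum>hs\<in>?L. \<Sum>h\<in>E. f h * prod_list (map f hs))" by (rule sum.cartesian_product[symmetric])
  also have "\<dots> = (\<Sum>h\<in>E. f h) * (\<Sum>hs\<in>?L. prod_list (map f hs))"
    by (subst sum.swap) (simp only: sum_distrib_left[symmetric] sum_distrib_right[symmetric])
  finally show ?case using Suc.IH by simp
qed

text \<open>The integrand is at most the sum of two exponential tilts, and completing the square
  turns each tilted density into a multiple of a shifted normal density.\<close>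

lemma integrable_exp_abs_gaussian: "integrable (centered_gaussian v) (\<lambda>x. exp (c * \<bar>x\<bar>))"
proof (cases "v = 0")
  case True
  then show ?thesis
    by (simp add: centered_gaussian_def integrable_iff_bounded nn_integral_return)
next
  case False
  \<comment> \<open>v is an arbitrary real; the density depends on \<open>sqrt v\<close> only
    through its square, and the absolute value makes the deviation positive.\<close>
  define \<sigma> where "\<sigma> = \<bar>sqrt v\<bar>"
  have \<sigma>: "\<sigma> > 0" using False by (simp add: \<sigma>_def)
  have nd: "normal_density 0 (sqrt v) = normal_density 0 \<sigma>"
    by (rule ext) (simp add: normal_density_def \<sigma>_def)
  have tilt: "integrable lborel (\<lambda>x. normal_density 0 \<sigma> x * exp (d * x))" for d
  proof -
    have "normal_density 0 \<sigma> x * exp (d * x) = exp (d\<^sup>2 * \<sigma>\<^sup>2 / 2) * normal_density (d * \<sigma>\<^sup>2) \<sigma> x" for x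
    proof -
      have "-(x\<^sup>2 / (2 * \<sigma>\<^sup>2)) + d * x = d\<^sup>2 * \<sigma>\<^sup>2 / 2 - (x - d * \<sigma>\<^sup>2)\<^sup>2 / (2 * \<sigma>\<^sup>2)"
        using \<sigma> by (simp add: field_simps power2_eq_square)
      then show ?thesis
        by (simp add: normal_density_def exp_add[symmetric] exp_diff[symmetric] mult.commute mult.left_commute)
    qed
    then show ?thesis
      using integrable_normal_density[OF \<sigma>, of "d * \<sigma>\<^sup>2"] by simp
  qed
  have "integrable lborel (\<lambda>x. normal_density 0 \<sigma> x * exp (c * \<bar>x\<bar>))"
  proof (rule Bochner_Integration.integrable_bound)
    show "integrable lborel (\<lambda>x. normal_density 0 \<sigma> x * exp (c * x) + normal_density 0 \<sigma> x * exp ((- c) * x))"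
      by (intro Bochner_Integration.integrable_add tilt)
    show "AE x in lborel. norm (normal_density 0 \<sigma> x * exp (c * \<bar>x\<bar>))
        \<le> norm (normal_density 0 \<sigma> x * exp (c * x) + normal_density 0 \<sigma> x * exp ((- c) * x))"
    proof (rule AE_I2)
      fix x :: real
      have "exp (c * \<bar>x\<bar>) \<le> exp (c * x) + exp ((- c) * x)"
        by (cases "x \<ge> 0") auto
      then have "normal_density 0 \<sigma> x * exp (c * \<bar>x\<bar>) \<le> normal_density 0 \<sigma> x * (exp (c * x) + exp ((- c) * x))"
        by (intro mult_left_mono) auto
      then show "norm (normal_density 0 \<sigma> x * exp (c * \<bar>x\<bar>))
        \<le> norm (normal_density 0 \<sigma> x * exp (c * x) + normal_density 0 \<sigma> x * exp ((- c) * x))"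
        by (simp add: distrib_left)
    qed
  qed measurable
  then have "integrable (density lborel (normal_density 0 \<sigma>)) (\<lambda>x. exp (c * \<bar>x\<bar>))"
    by (subst integrable_density) auto
  then show ?thesis using False by (simp add: centered_gaussian_def nd)
qed

section \<open>Finite linear combinations of coordinates\<close>

definition coordinate_functional :: "('d \<times> real) set \<Rightarrow> ('d \<times> real \<Rightarrow> real) \<Rightarrow> 'd::finite path \<Rightarrow> real" where
  "coordinate_functional J c w = (\<Sum>(i, t)\<in>J. c (i, t) * w t $ i)"

lemma coordinate_functional_linear:
  "coordinate_functional J c (\<lambda>t. x t + r *\<^sub>R y t) = coordinate_functional J c x + r * coordinate_functional J c y"
  by (simp add: coordinate_functional_def case_prod_unfold sum_distrib_left sum.distrib[symmetric] algebra_simps)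

text \<open>Along w + s h the functional is affine in s, so each differentiation contributes one
  \<open>pderiv\<close> and one factor independent of w.\<close>

lemma H_derivative_poly:
  "H_derivative (\<lambda>w. poly q (coordinate_functional J c w)) hs w =
    poly ((pderiv ^^ length hs) q) (coordinate_functional J c w) * prod_list (map (coordinate_functional J c) hs)"
proof (induction hs arbitrary: w)
  case (Cons h hs)
  let ?l = "coordinate_functional J c" and ?q = "(pderiv ^^ length hs) q"
  have "((\<lambda>s. poly ?q (?l w + s * ?l h) * prod_list (map ?l hs)) has_real_derivative
      (poly (pderiv ?q) (?l w + 0 * ?l h) * ?l h) * prod_list (map ?l hs)) (at 0)"
    by (intro DERIV_cmult_right DERIV_chain2[OF poly_DERIV]) (auto intro!: derivative_eq_intros)
  then have "deriv (\<lambda>s. poly ?q (?l w + s * ?l h) * prod_list (map ?l hs)) 0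
      = poly (pderiv ?q) (?l w) * ?l h * prod_list (map ?l hs)"
    by (simp add: DERIV_imp_deriv)
  then show ?case by (simp add: Cons.IH coordinate_functional_linear mult_ac)
qed simp

lemma wiener_poly_poly:
  assumes "l \<in> path_dual T \<alpha>" shows "(\<lambda>w. poly q (l w)) \<in> wiener_poly T \<alpha>"
proof (induction q)
  case (pCons a q)
  then show ?case
    using wiener_poly.add[OF wiener_poly.const[of a] wiener_poly.mult[OF wiener_poly.linear[OF assms] pCons.IH]]
    by simp
qed (use wiener_poly.const[of 0] in simp)

locale fbm_space = hoelder_setting T \<alpha> for T \<alpha> +
  fixes H :: real and \<mu> :: "'d::finite path measure"
  assumes fbm: "fbm_law T \<alpha> H \<mu>"
begin

abbreviation "coord \<equiv> coordinate_functional :: ('d \<times> real) set \<Rightarrow> ('d \<times> real \<Rightarrow> real) \<Rightarrow> 'd path \<Rightarrow> real"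

abbreviation coord_set :: "('d \<times> real) set \<Rightarrow> bool" where
  "coord_set J \<equiv> finite J \<and> J \<subseteq> UNIV \<times> {0..T}"

lemma prob_space_\<mu>: "prob_space \<mu>"
  and space_\<mu>: "space \<mu> = paths 0"
  and sets_\<mu>: "sets \<mu> = sets (pborel 0)"
  using fbm by (auto simp: fbm_law_def)

sublocale prob_space \<mu> by (rule prob_space_\<mu>)

lemma coord_continuous_map:
  assumes "coord_set J" shows "continuous_map (ptop 0) euclideanreal (coord J c)"
  unfolding coordinate_functional_def case_prod_unfold
proof (intro continuous_intros)
  show "finite J" using assms by simp
  fix z assume "z \<in> J"
  then have "snd z \<in> {0..T}" using assms by auto
  then have "continuous_map (ptop 0) euclidean (\<lambda>w::'d path. w (snd z))"
    by (rule continuous_map_eval)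
  moreover have "continuous_map euclidean euclideanreal (\<lambda>v::real ^ 'd. v $ fst z)"
    by (simp add: continuous_on_component continuous_on_id)
  ultimately show "continuous_map (ptop 0) euclideanreal (\<lambda>w. w (snd z) $ fst z)"
    using continuous_map_compose[of _ euclidean "\<lambda>w. w (snd z)" euclideanreal "\<lambda>v. v $ fst z"]
    by (simp add: o_def)
qed auto

lemma coord_measurable:
  assumes "coord_set J" shows "coord J c \<in> borel_measurable \<mu>"
  using continuous_map_measurable_path_borel[OF coord_continuous_map[OF assms]]
  by (simp cong: measurable_cong_sets add: sets_\<mu>)

text \<open>Paths start at 0, so an evaluation is bounded by the seminorm times a power of
  T.\<close>

lemma coord_path_dual:
  assumes "coord_set J" shows "coord J c \<in> path_dual T \<alpha>"
proof -
  have "\<bar>coord J c x\<bar> \<le> ((\<Sum>z\<in>J. \<bar>c z\<bar>) * T powr \<alpha>) * hoelder_norm T \<alpha> x"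
    if x: "x \<in> paths 0" for x
  proof -
    have "\<bar>c z * x (snd z) $ fst z\<bar> \<le> \<bar>c z\<bar> * (T powr \<alpha> * hoelder_norm T \<alpha> x)" if "z \<in> J" for z
    proof -
      have z: "snd z \<in> {0..T}" using that assms by auto
      let ?S = "seminorm x"
      have S0: "0 \<le> ?S" by (rule hoelder_seminorm_nonneg[OF T_pos little_hoelder_atD(1)[OF x]])
      have "\<bar>x (snd z) $ fst z\<bar> \<le> norm (x (snd z))" by (rule component_le_norm_cart)
      also have "\<dots> \<le> ?S * (snd z) powr \<alpha>"
        using hoelder_increment[OF little_hoelder_atD(1)[OF x], of 0 "snd z"] z little_hoelder_atD(2)[OF x] by simp
      also have "\<dots> \<le> ?S * T powr \<alpha>"
        using z S0 \<alpha>_pos by (intro mult_left_mono powr_mono2) auto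
      also have "?S = hoelder_norm T \<alpha> x"
        using little_hoelder_atD(2)[OF x] by (simp add: hoelder_norm_def)
      finally show ?thesis unfolding abs_mult by (intro mult_left_mono) (auto simp: mult.commute)
    qed
    then have "\<bar>coord J c x\<bar> \<le> (\<Sum>z\<in>J. \<bar>c z\<bar> * (T powr \<alpha> * hoelder_norm T \<alpha> x))"
      unfolding coordinate_functional_def case_prod_unfold
      by (intro order_trans[OF sum_abs] sum_mono) simp
    then show ?thesis by (simp add: sum_distrib_right mult.assoc)
  qed
  then show ?thesis unfolding path_dual_def by (auto simp: coordinate_functional_linear)
qed

text \<open>\<open>fbm_law\<close> makes the functional Gaussian; its exponential moments dominate
  all the Taylor polynomials.\<close>

lemma coord_exp_integrable:
  assumes "coord_set J" shows "integrable \<mu> (\<lambda>w. exp (r * \<bar>coord J c w\<bar>))"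
proof -
  obtain v where "distr \<mu> borel (coord J c) = centered_gaussian v"
    using fbm assms unfolding fbm_law_def coordinate_functional_def by blast
  then have "integrable (distr \<mu> borel (coord J c)) (\<lambda>x. exp (r * \<bar>x\<bar>))"
    by (simp add: integrable_exp_abs_gaussian)
  then show ?thesis by (subst (asm) integrable_distr_eq) (auto intro: coord_measurable[OF assms])
qed

lemma coord_square_integrable:
  assumes "coord_set J" shows "integrable \<mu> (\<lambda>w. (coord J c w)\<^sup>2)"
proof (rule Bochner_Integration.integrable_bound[OF coord_exp_integrable[OF assms, of 2 c]])
  show "(\<lambda>w. (coord J c w)\<^sup>2) \<in> borel_measurable \<mu>" using coord_measurable[OF assms, of c] by measurable
  have "x\<^sup>2 \<le> exp (2 * \<bar>x\<bar>)" for x :: real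
  proof -
    have "\<bar>x\<bar> \<le> exp \<bar>x\<bar>" using exp_ge_add_one_self[of "\<bar>x\<bar>"] by linarith
    then have "\<bar>x\<bar>\<^sup>2 \<le> (exp \<bar>x\<bar>)\<^sup>2" by (rule power_mono) simp
    then show ?thesis by (simp add: exp_double)
  qed
  then show "AE w in \<mu>. norm ((coord J c w)\<^sup>2) \<le> norm (exp (2 * \<bar>coord J c w\<bar>))" by simp
qed

lemma square_integrable_mult:
  assumes [measurable]: "f \<in> borel_measurable \<mu>" "g \<in> borel_measurable \<mu>"
    and "integrable \<mu> (\<lambda>w. (f w)\<^sup>2)" "integrable \<mu> (\<lambda>w. (g w)\<^sup>2)"
  shows "integrable \<mu> (\<lambda>w. f w * g w :: real)"
proof (rule Bochner_Integration.integrable_bound[OF Bochner_Integration.integrable_add[OF assms(3,4)]])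
  have "\<bar>x * y\<bar> \<le> x\<^sup>2 + y\<^sup>2" for x y :: real
  proof -
    have "0 \<le> (\<bar>x\<bar> - \<bar>y\<bar>)\<^sup>2" by simp
    then have "2 * (\<bar>x\<bar> * \<bar>y\<bar>) \<le> x\<^sup>2 + y\<^sup>2" by (simp add: power2_diff)
    moreover have "0 \<le> \<bar>x\<bar> * \<bar>y\<bar>" by simp
    ultimately show ?thesis unfolding abs_mult by linarith
  qed
  then show "AE w in \<mu>. norm (f w * g w) \<le> norm ((f w)\<^sup>2 + (g w)\<^sup>2)" by simp
qed measurable

text \<open>Bessel's inequality in L2(\<mu>): \<open>cm_rep\<close> turns the value of the
  functional at h into its inner product with the Wiener integral of h, and the Wiener integrals of
  members of E are orthonormal. The bound is independent of E, so the supremum in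
  \<open>hs_norm\<close> is finite.\<close>

lemma coord_bessel:
  assumes J: "coord_set J" and E: "finite E" "cm_orthonormal T \<alpha> \<mu> E"
  shows "(\<Sum>h\<in>E. (coord J c h)\<^sup>2) \<le> (\<integral>w. (coord J c w)\<^sup>2 \<partial>\<mu>)"
proof -
  let ?l = "coord J c" and ?Z = "wiener_integral T \<alpha> \<mu>"
  have rep: "cm_rep T \<alpha> \<mu> h (?Z h)" if "h \<in> E" for h
  proof -
    have "\<exists>Z. cm_rep T \<alpha> \<mu> h Z" using E(2) that by (auto simp: cm_orthonormal_def cameron_martin_def)
    then show ?thesis unfolding wiener_integral_def by (rule someI_ex)
  qed
  have Z2: "?Z h \<in> Lp \<mu> 2" if "h \<in> E" for h
    using rep[OF that] by (auto simp: cm_rep_def first_chaos_def)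
  have Zm: "?Z h \<in> borel_measurable \<mu>" if "h \<in> E" for h using Z2[OF that] by (simp add: Lp_def)
  have Zi: "integrable \<mu> (\<lambda>w. (?Z h w)\<^sup>2)" if "h \<in> E" for h using Z2[OF that] by (simp add: Lp_def)
  have lh: "?l h = (\<integral>w. ?Z h w * ?l w \<partial>\<mu>)" if "h \<in> E" for h
    using rep[OF that] coord_path_dual[OF J] by (auto simp: cm_rep_def)
  have orth: "(\<integral>w. ?Z h w * ?Z k w \<partial>\<mu>) = (if h = k then 1 else 0)" if "h \<in> E" "k \<in> E" for h k
    using E(2) that by (auto simp: cm_orthonormal_def cm_inner_def)
  have iZl: "integrable \<mu> (\<lambda>w. ?Z h w * ?l w)" if "h \<in> E" for h
    by (rule square_integrable_mult[OF Zm[OF that] coord_measurable[OF J] Zi[OF that] coord_square_integrable[OF J]])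
  have iZZ: "integrable \<mu> (\<lambda>w. ?Z h w * ?Z k w)" if "h \<in> E" "k \<in> E" for h k
    by (rule square_integrable_mult[OF Zm[OF that(1)] Zm[OF that(2)] Zi[OF that(1)] Zi[OF that(2)]])
  let ?S = "\<lambda>w. \<Sum>h\<in>E. ?l h * ?Z h w"
  have lS: "(\<lambda>w. ?l w * ?S w) = (\<lambda>w. \<Sum>h\<in>E. ?l h * (?Z h w * ?l w))"
    by (simp add: sum_distrib_left mult_ac)
  have SS: "(\<lambda>w. ?S w * ?S w) = (\<lambda>w. \<Sum>h\<in>E. \<Sum>k\<in>E. (?l h * ?l k) * (?Z h w * ?Z k w))"
    by (simp add: sum_product mult_ac)
  have ilS: "integrable \<mu> (\<lambda>w. ?l w * ?S w)" unfolding lS using iZl by auto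
  have iSS: "integrable \<mu> (\<lambda>w. ?S w * ?S w)" unfolding SS
    by (intro Bochner_Integration.integrable_sum integrable_mult_right iZZ)
  have vlS: "(\<integral>w. ?l w * ?S w \<partial>\<mu>) = (\<Sum>h\<in>E. (?l h)\<^sup>2)"
    unfolding lS using iZl by (subst Bochner_Integration.integral_sum) (auto simp: lh[symmetric] power2_eq_square)
  have vSS: "(\<integral>w. ?S w * ?S w \<partial>\<mu>) = (\<Sum>h\<in>E. (?l h)\<^sup>2)"
  proof -
    have "(\<integral>w. ?S w * ?S w \<partial>\<mu>) = (\<Sum>h\<in>E. \<Sum>k\<in>E. (?l h * ?l k) * (\<integral>w. ?Z h w * ?Z k w \<partial>\<mu>))"
      unfolding SS using iZZ
      by (subst Bochner_Integration.integral_sum, intro Bochner_Integration.integrable_sum integrable_mult_right, simp)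
        (simp add: Bochner_Integration.integral_sum)
    also have "\<dots> = (\<Sum>h\<in>E. \<Sum>k\<in>E. if h = k then ?l h * ?l k else 0)"
      by (intro sum.cong refl) (simp add: orth)
    finally show ?thesis using E(1) by (simp add: sum.delta power2_eq_square)
  qed
  \<comment> \<open>Second moment of the functional minus its projection onto the span of the Wiener
    integrals.\<close>
  have "0 \<le> (\<integral>w. (?l w)\<^sup>2 - 2 * (?l w * ?S w) + ?S w * ?S w \<partial>\<mu>)"
  proof (rule Bochner_Integration.integral_nonneg)
    fix w
    have "a\<^sup>2 - 2 * (a * b) + b * b = (a - b)\<^sup>2" for a b :: real
      by (simp add: power2_eq_square algebra_simps)
    from this[of "?l w" "?S w"] show "0 \<le> (?l w)\<^sup>2 - 2 * (?l w * ?S w) + ?S w * ?S w"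
      by (simp only: zero_le_power2)
  qed
  also have "\<dots> = (\<integral>w. (?l w)\<^sup>2 \<partial>\<mu>) - 2 * (\<integral>w. ?l w * ?S w \<partial>\<mu>) + (\<integral>w. ?S w * ?S w \<partial>\<mu>)"
    using coord_square_integrable[OF J] ilS iSS by simp
  finally show ?thesis unfolding vlS vSS by simp
qed

section \<open>Sobolev norms of polynomials in one functional\<close>

definition coord_norm :: "('d \<times> real) set \<Rightarrow> ('d \<times> real \<Rightarrow> real) \<Rightarrow> real" where
  "coord_norm J c = sqrt (\<integral>w. (coord J c w)\<^sup>2 \<partial>\<mu>)"

text \<open>At each w the j-th derivative is a scalar times the j-th tensor power of one linear
  form, so \<open>coord_bessel\<close> bounds the sums for all finite orthonormal families at once;
  the empty family shows that there is one.\<close>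

lemma hs_norm_coord:
  assumes J: "coord_set J"
    and A_def: "A = (\<lambda>hs. H_derivative (\<lambda>w. poly q (coord J c w)) hs w)"
  shows "0 \<le> hs_norm T \<alpha> \<mu> j A"
    "hs_norm T \<alpha> \<mu> j A \<le> \<bar>poly ((pderiv ^^ j) q) (coord J c w)\<bar> * coord_norm J c ^ j"
proof -
  let ?l = "coord J c" and ?v = "\<integral>w. (coord J c w)\<^sup>2 \<partial>\<mu>" and ?b = "poly ((pderiv ^^ j) q) (coord J c w)"
  let ?E = "{E. finite E \<and> cm_orthonormal T \<alpha> \<mu> E}"
  let ?f = "\<lambda>E. \<Sum>hs\<in>{hs. set hs \<subseteq> E \<and> length hs = j}. (A hs)\<^sup>2"
  have f: "?f E \<le> ?b\<^sup>2 * ?v ^ j" if E: "E \<in> ?E" for E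
  proof -
    have "?f E = (\<Sum>hs\<in>{hs. set hs \<subseteq> E \<and> length hs = j}. ?b\<^sup>2 * prod_list (map (\<lambda>h. (?l h)\<^sup>2) hs))"
    proof (rule sum.cong[OF refl])
      fix hs assume "hs \<in> {hs. set hs \<subseteq> E \<and> length hs = j}"
      then have "A hs = ?b * prod_list (map ?l hs)" by (simp add: A_def H_derivative_poly)
      moreover have "(prod_list (map ?l hs))\<^sup>2 = prod_list (map (\<lambda>h. (?l h)\<^sup>2) hs)" for hs
        by (induction hs) (simp_all add: power_mult_distrib)
      ultimately show "(A hs)\<^sup>2 = ?b\<^sup>2 * prod_list (map (\<lambda>h. (?l h)\<^sup>2) hs)"
        by (simp add: power_mult_distrib)
    qed
    also have "\<dots> = ?b\<^sup>2 * (\<Sum>h\<in>E. (?l h)\<^sup>2) ^ j"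
      using E by (simp add: sum_distrib_left[symmetric] sum_lists_prod_list)
    also have "\<dots> \<le> ?b\<^sup>2 * ?v ^ j"
      using E by (intro mult_left_mono power_mono coord_bessel[OF J] sum_nonneg) auto
    finally show ?thesis .
  qed
  have e: "{} \<in> ?E" by (simp add: cm_orthonormal_def)
  have "0 \<le> ?f {}" by (intro sum_nonneg) simp
  also have "\<dots> \<le> (SUP E\<in>?E. ?f E)"
    by (rule cSUP_upper[OF e]) (use f in \<open>auto intro!: bdd_aboveI2\<close>)
  finally show "0 \<le> hs_norm T \<alpha> \<mu> j A" unfolding hs_norm_def by simp
  have "(SUP E\<in>?E. ?f E) \<le> ?b\<^sup>2 * ?v ^ j" by (rule cSUP_least) (use e f in blast)+
  then have "hs_norm T \<alpha> \<mu> j A \<le> sqrt (?b\<^sup>2 * ?v ^ j)" unfolding hs_norm_def by (rule real_sqrt_le_mono)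
  then show "hs_norm T \<alpha> \<mu> j A \<le> \<bar>?b\<bar> * coord_norm J c ^ j"
    using real_sqrt_abs[of ?b] real_sqrt_power[of ?v j] by (simp only: coord_norm_def real_sqrt_mult)
qed

lemma coord_norm_nonneg: "0 \<le> coord_norm J c"
  by (simp add: coord_norm_def)

lemma poly_sobolev_norm_coord:
  assumes J: "coord_set J" and p: "1 < p"
    and int: "\<And>j. integrable \<mu> (\<lambda>w. \<bar>poly ((pderiv ^^ j) q) (coord J c w)\<bar> powr p)"
  shows "poly_sobolev_norm T \<alpha> \<mu> p k (\<lambda>w. poly q (coord J c w)) \<le>
    (\<Sum>j\<le>k. (coord_norm J c ^ j) powr p * (\<integral>w. \<bar>poly ((pderiv ^^ j) q) (coord J c w)\<bar> powr p \<partial>\<mu>)) powr (1 / p)"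
  unfolding poly_sobolev_norm_def
proof (rule powr_mono2)
  let ?h = "\<lambda>j w. hs_norm T \<alpha> \<mu> j (\<lambda>hs. H_derivative (\<lambda>w. poly q (coord J c w)) hs w)"
  let ?b = "\<lambda>j w. \<bar>poly ((pderiv ^^ j) q) (coord J c w)\<bar>"
  show "0 \<le> (\<Sum>j\<le>k. \<integral>w. ?h j w powr p \<partial>\<mu>)"
    by (intro sum_nonneg Bochner_Integration.integral_nonneg) simp
  show "(\<Sum>j\<le>k. \<integral>w. ?h j w powr p \<partial>\<mu>)
    \<le> (\<Sum>j\<le>k. (coord_norm J c ^ j) powr p * (\<integral>w. ?b j w powr p \<partial>\<mu>))"
  proof (rule sum_mono)
    fix j
    have "(\<integral>w. ?h j w powr p \<partial>\<mu>)
      \<le> (\<integral>w. (coord_norm J c ^ j) powr p * ?b j w powr p \<partial>\<mu>)"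
    \<comment> \<open>This rule asks for integrability of the majorant alone; measurability of the
      Hilbert--Schmidt norm has not been established.\<close>
    proof (rule integral_mono')
      show "integrable \<mu> (\<lambda>w. (coord_norm J c ^ j) powr p * ?b j w powr p)"
        using int by simp
      fix w
      have "?h j w powr p
        \<le> (?b j w * coord_norm J c ^ j) powr p"
        using p by (intro powr_mono2 hs_norm_coord[OF J refl]) auto
      then show "?h j w powr p
        \<le> (coord_norm J c ^ j) powr p * ?b j w powr p"
        using coord_norm_nonneg by (simp add: powr_mult mult.commute)
    qed simp
    then show "(\<integral>w. ?h j w powr p \<partial>\<mu>)
      \<le> (coord_norm J c ^ j) powr p * (\<integral>w. ?b j w powr p \<partial>\<mu>)" by simp
  qed
qed (use p in simp)

section \<open>Cosine functionals as limits of Taylor polynomials\<close>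

definition cos_coord :: "('d \<times> real) set \<Rightarrow> ('d \<times> real \<Rightarrow> real) \<Rightarrow> real \<Rightarrow> 'd path \<Rightarrow> real" where
  "cos_coord J c \<theta> w = cos (coord J c w + \<theta>)"

definition taylor_error :: "('d \<times> real) set \<Rightarrow> ('d \<times> real \<Rightarrow> real) \<Rightarrow> real \<Rightarrow> nat \<Rightarrow> real \<Rightarrow> 'd path \<Rightarrow> real" where
  "taylor_error J c p n \<theta> w = \<bar>poly (cos_taylor n \<theta>) (coord J c w) - cos_coord J c \<theta> w\<bar> powr p"

lemma poly_coord_measurable:
  assumes "coord_set J" shows "(\<lambda>w. poly q (coord J c w)) \<in> borel_measurable \<mu>"
  by (rule borel_measurable_continuous_on[OF _ coord_measurable[OF assms]]) (intro continuous_intros)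

lemma cos_coord_measurable:
  assumes "coord_set J" shows "cos_coord J c \<theta> \<in> borel_measurable \<mu>"
  unfolding cos_coord_def using coord_measurable[OF assms, of c] by measurable

lemma taylor_error_measurable:
  assumes J: "coord_set J" shows "taylor_error J c p n \<theta> \<in> borel_measurable \<mu>"
  unfolding taylor_error_def using poly_coord_measurable[OF J, of "cos_taylor n \<theta>" c] cos_coord_measurable[OF J, of c \<theta>]
  by measurable

lemma taylor_error_bound:
  assumes "1 < p"
  shows "\<bar>taylor_error J c p n \<theta> w\<bar> \<le> 2 powr p * exp (p * \<bar>coord J c w\<bar>)"
proof -
  have "\<bar>poly (cos_taylor n \<theta>) (coord J c w) - cos_coord J c \<theta> w\<bar> \<le> exp \<bar>coord J c w\<bar> + 1"
    using poly_cos_taylor_bound[of n \<theta> "coord J c w"] abs_cos_le_one[of "coord J c w + \<theta>"]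
    unfolding cos_coord_def by linarith
  also have "\<dots> \<le> 2 * exp \<bar>coord J c w\<bar>" by simp
  finally have "taylor_error J c p n \<theta> w \<le> (2 * exp \<bar>coord J c w\<bar>) powr p"
    unfolding taylor_error_def using assms by (intro powr_mono2) auto
  also have "\<dots> = 2 powr p * exp (p * \<bar>coord J c w\<bar>)" by (simp add: powr_mult exp_powr_real mult.commute)
  finally show ?thesis by (simp add: taylor_error_def)
qed

lemma taylor_error_integrable:
  assumes J: "coord_set J" and p: "1 < p"
  shows "integrable \<mu> (taylor_error J c p n \<theta>)"
proof (rule Bochner_Integration.integrable_bound)
  show "integrable \<mu> (\<lambda>w. 2 powr p * exp (p * \<bar>coord J c w\<bar>))" using coord_exp_integrable[OF J] by simp
qed (use taylor_error_measurable[OF J] taylor_error_bound[OF p] in auto)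

lemma taylor_error_tendsto:
  assumes J: "coord_set J" and p: "1 < p"
  shows "(\<lambda>n. \<integral>w. taylor_error J c p n \<theta> w \<partial>\<mu>) \<longlonglongrightarrow> 0"
proof -
  have "(\<lambda>n. \<integral>w. taylor_error J c p n \<theta> w \<partial>\<mu>) \<longlonglongrightarrow> (\<integral>w. 0 \<partial>\<mu>)"
  proof (rule integral_dominated_convergence)
    show "integrable \<mu> (\<lambda>w. 2 powr p * exp (p * \<bar>coord J c w\<bar>))" using coord_exp_integrable[OF J] by simp
    show "AE w in \<mu>. (\<lambda>n. taylor_error J c p n \<theta> w) \<longlonglongrightarrow> 0"
    proof (rule AE_I2)
      fix w
      have "(\<lambda>n. \<bar>poly (cos_taylor n \<theta>) (coord J c w) - cos_coord J c \<theta> w\<bar>) \<longlonglongrightarrow> 0"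
        unfolding cos_coord_def
        by (intro tendsto_rabs_zero LIM_zero poly_cos_taylor_tendsto)
      then have "(\<lambda>n. \<bar>poly (cos_taylor n \<theta>) (coord J c w) - cos_coord J c \<theta> w\<bar> powr p) \<longlonglongrightarrow> 0 powr p"
        using p by (intro tendsto_powr' tendsto_const) auto
      then show "(\<lambda>n. taylor_error J c p n \<theta> w) \<longlonglongrightarrow> 0" unfolding taylor_error_def by simp
    qed
  qed (use taylor_error_measurable[OF J] taylor_error_bound[OF p] in auto)
  then show ?thesis by simp
qed

text \<open>Both Taylor polynomials are compared with their limit, by |a - b|^p <= 2^p (|a - c|^p +
  |b - c|^p).\<close>

lemma taylor_difference_Lp:
  assumes J: "coord_set J" and p: "1 < p"
  shows "integrable \<mu> (\<lambda>w. \<bar>poly (cos_taylor m \<theta> - cos_taylor n \<theta>) (coord J c w)\<bar> powr p)"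
    "(\<integral>w. \<bar>poly (cos_taylor m \<theta> - cos_taylor n \<theta>) (coord J c w)\<bar> powr p \<partial>\<mu>) \<le>
      2 powr p * ((\<integral>w. taylor_error J c p m \<theta> w \<partial>\<mu>) + (\<integral>w. taylor_error J c p n \<theta> w \<partial>\<mu>))"
proof -
  let ?d = "\<lambda>w. \<bar>poly (cos_taylor m \<theta> - cos_taylor n \<theta>) (coord J c w)\<bar> powr p"
  let ?g = "\<lambda>w. 2 powr p * (taylor_error J c p m \<theta> w + taylor_error J c p n \<theta> w)"
  have le: "?d w \<le> ?g w" for w
  proof -
    let ?x = "\<bar>poly (cos_taylor m \<theta>) (coord J c w) - cos_coord J c \<theta> w\<bar>"
    let ?y = "\<bar>poly (cos_taylor n \<theta>) (coord J c w) - cos_coord J c \<theta> w\<bar>"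
    have "\<bar>a - b\<bar> \<le> 2 * max \<bar>a - c\<bar> \<bar>b - c\<bar>" for a b c :: real
      unfolding max_def by (auto simp: abs_if)
    then have "?d w \<le> (2 * max ?x ?y) powr p" using p by (intro powr_mono2) auto
    also have "\<dots> = 2 powr p * max ?x ?y powr p" by (simp add: powr_mult)
    also have "\<dots> \<le> 2 powr p * (?x powr p + ?y powr p)"
      by (intro mult_left_mono) (auto simp: max_def)
    finally show ?thesis by (simp add: taylor_error_def)
  qed
  have g: "integrable \<mu> ?g" using taylor_error_integrable[OF J p] by simp
  show d: "integrable \<mu> ?d"
  proof (rule Bochner_Integration.integrable_bound[OF g])
    show "?d \<in> borel_measurable \<mu>"
      using poly_coord_measurable[OF J, of "cos_taylor m \<theta> - cos_taylor n \<theta>" c] by measurable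
    show "AE w in \<mu>. norm (?d w) \<le> norm (?g w)"
      using le by (intro AE_I2) (simp add: order_trans[OF _ abs_ge_self])
  qed
  have "integral\<^sup>L \<mu> ?d \<le> integral\<^sup>L \<mu> ?g" using d g le by (rule integral_mono)
  also have "\<dots> = 2 powr p * ((\<integral>w. taylor_error J c p m \<theta> w \<partial>\<mu>) + (\<integral>w. taylor_error J c p n \<theta> w \<partial>\<mu>))"
    using taylor_error_integrable[OF J p] by simp
  finally show "integral\<^sup>L \<mu> ?d \<le> 2 powr p * ((\<integral>w. taylor_error J c p m \<theta> w \<partial>\<mu>) + (\<integral>w. taylor_error J c p n \<theta> w \<partial>\<mu>))" .
qed

text \<open>The j-th derivative of a Taylor polynomial is one with j terms fewer and the phase
  shifted by j pi/2. The Cauchy property of order k thus reduces to scalar Lp convergence for the k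
  + 1 phases j <= k.\<close>

lemma cos_coord_sobolev:
  assumes J: "coord_set J" and p: "1 < p"
  shows "cos_coord J c \<theta> \<in> sobolev T \<alpha> \<mu> p k"
proof -
  let ?F = "\<lambda>n w. poly (cos_taylor n \<theta>) (coord J c w)"
  have "integrable \<mu> (\<lambda>w. \<bar>cos_coord J c \<theta> w\<bar> powr p)"
  proof (rule integrable_const_bound[of _ 1])
    show "AE w in \<mu>. norm (\<bar>cos_coord J c \<theta> w\<bar> powr p) \<le> 1"
      using p by (intro AE_I2) (auto simp: cos_coord_def intro!: powr_le1)
    show "(\<lambda>w. \<bar>cos_coord J c \<theta> w\<bar> powr p) \<in> borel_measurable \<mu>"
      using cos_coord_measurable[OF J, of c \<theta>] by measurable
  qed
  then have Lp: "cos_coord J c \<theta> \<in> Lp \<mu> p" using cos_coord_measurable[OF J] by (simp add: Lp_def)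
  have "sobolev_approx T \<alpha> \<mu> p k ?F (cos_coord J c \<theta>)"
    unfolding sobolev_approx_def
  proof (intro conjI allI impI)
    show "?F n \<in> wiener_poly T \<alpha>" for n by (rule wiener_poly_poly[OF coord_path_dual[OF J]])
    have "(\<integral>\<^sup>+ w. ennreal (\<bar>?F n w - cos_coord J c \<theta> w\<bar> powr p) \<partial>\<mu>) = ennreal (\<integral>w. taylor_error J c p n \<theta> w \<partial>\<mu>)" for n
      using taylor_error_integrable[OF J p, of c n \<theta>] unfolding taylor_error_def
      by (intro nn_integral_eq_integral) auto
    then show "Lp_null_sequence \<mu> p (\<lambda>n w. ?F n w - cos_coord J c \<theta> w)"
      using tendsto_ennrealI[OF taylor_error_tendsto[OF J p, of c \<theta>]] by (simp add: Lp_null_sequence_def)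
  next
    fix e :: real assume "e > 0"
    let ?\<theta> = "\<lambda>j. \<theta> + real j * (pi / 2)"
    \<comment> \<open>g bounds the contribution of one index; as p-th powers are compared, the
      target is \<open>e powr p\<close>, shared evenly by m and n.\<close>
    define g where "g n = (\<Sum>j\<le>k. (coord_norm J c ^ j) powr p * (2 powr p * (\<integral>w. taylor_error J c p (n - j) (?\<theta> j) w \<partial>\<mu>)))" for n
    have "g \<longlonglongrightarrow> (\<Sum>j\<le>k. (coord_norm J c ^ j) powr p * (2 powr p * 0))"
      unfolding g_def
      by (intro tendsto_intros filterlim_compose[OF taylor_error_tendsto[OF J p] filterlim_minus_const_nat_at_top])
    then have "g \<longlonglongrightarrow> 0" by simp
    moreover have "e powr p / 2 > 0" using \<open>e > 0\<close> by simp
    ultimately have "\<forall>\<^sub>F n in sequentially. g n < e powr p / 2" by (rule order_tendstoD(2))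
    then obtain N where N: "\<And>n. n \<ge> N \<Longrightarrow> g n < e powr p / 2" by (auto simp: eventually_sequentially)
    have "poly_sobolev_norm T \<alpha> \<mu> p k (\<lambda>w. ?F m w - ?F n w) < e" if "m \<ge> N" "n \<ge> N" for m n
    proof -
      let ?q = "cos_taylor m \<theta> - cos_taylor n \<theta>"
      have dq: "(pderiv ^^ j) ?q = cos_taylor (m - j) (?\<theta> j) - cos_taylor (n - j) (?\<theta> j)" for j
        by (simp only: pderiv_funpow_diff pderiv_funpow_cos_taylor)
      let ?S = "\<Sum>j\<le>k. (coord_norm J c ^ j) powr p * (\<integral>w. \<bar>poly ((pderiv ^^ j) ?q) (coord J c w)\<bar> powr p \<partial>\<mu>)"
      have "?S \<le> g m + g n"
        unfolding g_def sum.distrib[symmetric] distrib_left[symmetric] dq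
        by (intro sum_mono mult_left_mono taylor_difference_Lp(2)[OF J p]) simp
      then have S: "?S < e powr p" using N[OF that(1)] N[OF that(2)] by linarith
      have S0: "0 \<le> ?S" by (intro sum_nonneg mult_nonneg_nonneg Bochner_Integration.integral_nonneg) auto
      have "poly_sobolev_norm T \<alpha> \<mu> p k (\<lambda>w. ?F m w - ?F n w) = poly_sobolev_norm T \<alpha> \<mu> p k (\<lambda>w. poly ?q (coord J c w))"
        by simp
      also have "\<dots> \<le> ?S powr (1 / p)"
        by (rule poly_sobolev_norm_coord[OF J p]) (unfold dq, rule taylor_difference_Lp(1)[OF J p])
      also have "\<dots> < (e powr p) powr (1 / p)" using S0 S p by (intro powr_less_mono2) auto
      also have "\<dots> = e" using \<open>e > 0\<close> p by (simp add: powr_powr)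
      finally show ?thesis .
    qed
    then show "\<exists>N. \<forall>m\<ge>N. \<forall>n\<ge>N. poly_sobolev_norm T \<alpha> \<mu> p k (\<lambda>w. ?F m w - ?F n w) < e" by blast
  qed
  then show ?thesis using Lp by (auto simp: sobolev_def)
qed

lemma cos_coord_D_infinity: "coord_set J \<Longrightarrow> cos_coord J c \<theta> \<in> D_infinity T \<alpha> \<mu>"
  using cos_coord_sobolev by (auto simp: D_infinity_def)

section \<open>Quasi-continuity of continuous functionals\<close>

text \<open>The zero function is admissible and has norm 0. With the exceptional set {} a continuous
  functional is then its own quasi-continuous modification.\<close>

lemma capacity_empty_le: "capacity T \<alpha> \<mu> q k {} \<le> 0"
proof -
  let ?z = "\<lambda>w::'d path. 0 :: real"
  have Hz: "H_derivative ?z hs w = 0" for hs w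
    by (induction hs arbitrary: w) auto
  have hs: "hs_norm T \<alpha> \<mu> j (\<lambda>hs. H_derivative ?z hs w) = 0" for j w
  proof -
    have "{} \<in> {E. finite E \<and> cm_orthonormal T \<alpha> \<mu> E}" by (simp add: cm_orthonormal_def)
    then have "{E. finite E \<and> cm_orthonormal T \<alpha> \<mu> E} \<noteq> {}" by blast
    then show ?thesis unfolding hs_norm_def Hz by simp
  qed
  have pz: "poly_sobolev_norm T \<alpha> \<mu> q k ?z = 0" unfolding poly_sobolev_norm_def hs by simp
  have az: "sobolev_approx T \<alpha> \<mu> q k (\<lambda>_. ?z) ?z"
    unfolding sobolev_approx_def using wiener_poly.const[of 0] pz by (simp add: Lp_null_sequence_def)
  have z: "?z \<in> sobolev T \<alpha> \<mu> q k" unfolding sobolev_def Lp_def using az by auto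
  have "sobolev_norm T \<alpha> \<mu> q k ?z = 0"
    unfolding sobolev_norm_def
  proof (rule cInf_eq_minimum)
    show "0 \<in> {c. \<exists>Fs. sobolev_approx T \<alpha> \<mu> q k Fs ?z \<and> (\<lambda>n. poly_sobolev_norm T \<alpha> \<mu> q k (Fs n)) \<longlonglongrightarrow> c}"
      using az pz by (auto intro!: exI[of _ "\<lambda>_. ?z"])
    fix c assume "c \<in> {c. \<exists>Fs. sobolev_approx T \<alpha> \<mu> q k Fs ?z \<and> (\<lambda>n. poly_sobolev_norm T \<alpha> \<mu> q k (Fs n)) \<longlonglongrightarrow> c}"
    then show "0 \<le> c" by (auto intro: LIMSEQ_le_const simp: poly_sobolev_norm_def)
  qed
  then have mem: "0 \<in> {sobolev_norm T \<alpha> \<mu> q k F powr q | F. F \<in> sobolev T \<alpha> \<mu> q k \<and> (AE w in \<mu>. w \<in> {} \<longrightarrow> 1 \<le> F w)}"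
    using z by (auto intro!: exI[of _ ?z])
  show ?thesis unfolding capacity_def
    by (rule cInf_lower[OF mem]) (auto intro!: bdd_belowI[of _ 0])
qed

lemma continuous_quasi_continuous:
  assumes G: "continuous_map (ptop 0) euclideanreal G"
  shows "quasi_continuous_modification T \<alpha> \<mu> G G"
  unfolding quasi_continuous_modification_def
proof (intro conjI allI impI)
  show "G \<in> borel_measurable \<mu>"
    using continuous_map_measurable_path_borel[OF G] by (simp cong: measurable_cong_sets add: sets_\<mu>)
  fix q e :: real and k assume "e > 0"
  show "\<exists>U. openin (ptop 0) U \<and> capacity T \<alpha> \<mu> q k U < e \<and>
      continuous_map (subtopology (ptop 0) (paths 0 - U)) euclideanreal G"
    using capacity_empty_le[of q k] \<open>e > 0\<close> G
    by (intro exI[of _ "{}"]) (auto intro: continuous_map_from_subtopology)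
qed simp

lemma cos_coord_quasi_continuous:
  assumes J: "coord_set J"
  shows "quasi_continuous_modification T \<alpha> \<mu> (cos_coord J c \<theta>) (cos_coord J c \<theta>)"
proof (rule continuous_quasi_continuous)
  have "continuous_map euclideanreal euclideanreal (\<lambda>x. cos (x + \<theta>))"
    by (simp add: continuous_on_cos continuous_on_add continuous_on_id)
  from continuous_map_compose[OF coord_continuous_map[OF J, of c] this]
  show "continuous_map (ptop 0) euclideanreal (cos_coord J c \<theta>)"
    by (simp add: o_def cos_coord_def[abs_def])
qed

end

section \<open>Disintegration\<close>

context fbm_space
begin

definition trig_class :: "('d path \<Rightarrow> real) set" where
  "trig_class = {cos_coord J c \<theta> | J c \<theta>. coord_set J}"

text \<open>Coefficients are extended by 0 to the union of the index sets and added there.\<close>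

lemma coord_combine:
  assumes "coord_set J" "coord_set J'"
  shows "\<exists>c''. \<forall>w. coord (J \<union> J') c'' w = coord J c w + r * coord J' c' w"
proof (intro exI allI)
  fix w :: "'d path"
  let ?x = "\<lambda>z. w (snd z) $ fst z"
  have "coord (J \<union> J') (\<lambda>z. (if z \<in> J then c z else 0) + (if z \<in> J' then r * c' z else 0)) w
      = (\<Sum>z\<in>J \<union> J'. if z \<in> J then c z * ?x z else 0) + (\<Sum>z\<in>J \<union> J'. if z \<in> J' then r * (c' z * ?x z) else 0)"
    unfolding coordinate_functional_def case_prod_unfold sum.distrib[symmetric]
    by (intro sum.cong) (auto simp: algebra_simps)
  also have "\<dots> = coord J c w + r * coord J' c' w"
    unfolding coordinate_functional_def case_prod_unfold sum_distrib_left using assms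
    by (simp add: sum.If_cases Int_absorb1 Int_absorb2 Int_Un_distrib Un_Int_eq)
  finally show "coord (J \<union> J') (\<lambda>z. (if z \<in> J then c z else 0) + (if z \<in> J' then r * c' z else 0)) w
      = coord J c w + r * coord J' c' w" .
qed

sublocale trig: multiplicative_class "paths 0" trig_class
proof
  fix f assume "f \<in> trig_class"
  then obtain J c \<theta> where f: "f = cos_coord J c \<theta>" "coord_set J" by (auto simp: trig_class_def)
  show "\<exists>C. \<forall>x\<in>paths 0. \<bar>f x\<bar> \<le> C"
    unfolding f cos_coord_def using abs_cos_le_one by blast
  fix g assume "g \<in> trig_class"
  then obtain J' c' \<theta>' where g: "g = cos_coord J' c' \<theta>'" "coord_set J'" by (auto simp: trig_class_def)
  obtain c1 where c1: "\<And>w. coord (J \<union> J') c1 w = coord J c w + 1 * coord J' c' w"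
    using coord_combine[OF f(2) g(2)] by blast
  obtain c2 where c2: "\<And>w. coord (J \<union> J') c2 w = coord J c w + (-1) * coord J' c' w"
    using coord_combine[OF f(2) g(2)] by blast
  have "(\<lambda>x. f x * g x) = (\<lambda>x. 1 / 2 * cos_coord (J \<union> J') c1 (\<theta> + \<theta>') x + 1 / 2 * cos_coord (J \<union> J') c2 (\<theta> - \<theta>') x)"
  proof
    fix x
    have "cos (u + v) + cos (u - v) = 2 * (cos u * cos v)" for u v :: real
      by (simp add: cos_add cos_diff)
    from this[of "coord J c x + \<theta>" "coord J' c' x + \<theta>'"]
    show "f x * g x = 1 / 2 * cos_coord (J \<union> J') c1 (\<theta> + \<theta>') x + 1 / 2 * cos_coord (J \<union> J') c2 (\<theta> - \<theta>') x"
      by (simp add: f g cos_coord_def c1 c2 algebra_simps)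
  qed
  moreover have "coord_set (J \<union> J')" using f g by auto
  then have "cos_coord (J \<union> J') c1 (\<theta> + \<theta>') \<in> trig_class" "cos_coord (J \<union> J') c2 (\<theta> - \<theta>') \<in> trig_class"
    unfolding trig_class_def by blast+
  ultimately show "(\<lambda>x. f x * g x) \<in> bounded_limit_closure (paths 0) trig_class"
    by (simp only:) (intro bounded_limit_closure.lin bounded_limit_closure.base)
next
  have "(\<lambda>_. 1) = cos_coord {} (\<lambda>_. 0) 0"
    by (simp add: fun_eq_iff cos_coord_def coordinate_functional_def)
  then show "(\<lambda>_. 1) \<in> trig_class" unfolding trig_class_def by blast
qed

text \<open>Coordinates are unbounded and so outside the class of cosines, but x is the limit of n
  sin (x/n), the derivative of h -> sin (h x) at 0.\<close>

lemma n_sin_over_n_tendsto: "(\<lambda>n. real (Suc n) * sin (x / real (Suc n))) \<longlonglongrightarrow> x"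
proof -
  have "((\<lambda>h. sin (h * x)) has_real_derivative x) (at 0)"
    by (auto intro!: derivative_eq_intros)
  then have "(\<lambda>h. (sin ((0 + h) * x) - sin (0 * x)) / h) \<midarrow>0\<rightarrow> x" unfolding DERIV_def .
  then have "(\<lambda>n. (sin ((0 + inverse (real (Suc n))) * x) - sin (0 * x)) / inverse (real (Suc n))) \<longlonglongrightarrow> x"
    using LIMSEQ_inverse_real_of_nat
      spec[OF iffD2[OF LIMSEQ_SEQ_conv], of "\<lambda>h. (sin ((0 + h) * x) - sin (0 * x)) / h" x 0 "\<lambda>n. inverse (real (Suc n))"]
    by simp
  then show ?thesis by (simp add: field_simps)
qed

text \<open>Evaluations generate the Borel sets, so it is enough that each coordinate is measurable
  for the sigma-algebra of the superlevel sets; it is a limit of rescaled sines.\<close>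

lemma sets_subset_trig_superlevels:
  "sets (pborel 0) \<subseteq> sigma_sets (paths 0)
    {f -` {c<..} \<inter> paths 0 | f c. f \<in> trig_class}"
proof -
  let ?\<Omega> = "paths (0 :: real ^ 'd)"
  let ?G = "{f -` {c<..} \<inter> ?\<Omega> | f c. f \<in> trig_class}"
  let ?S = "sigma ?\<Omega> ?G"
  have G: "?G \<subseteq> Pow ?\<Omega>" by auto
  have sp: "space ?S = ?\<Omega>" and se: "sets ?S = sigma_sets ?\<Omega> ?G"
    using G by (auto intro: space_measure_of sets_measure_of)
  have f: "f \<in> borel_measurable ?S" if "f \<in> trig_class" for f
    unfolding borel_measurable_iff_greater
  proof
    fix c
    have "{w \<in> space ?S. c < f w} = f -` {c<..} \<inter> ?\<Omega>" unfolding sp by auto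
    then show "{w \<in> space ?S. c < f w} \<in> sets ?S" unfolding se using that by (auto intro!: sigma_sets.Basic)
  qed
  have "sets (pborel 0) \<subseteq> sets ?S"
  proof (rule sets_path_borel_subset_evaluations[OF sp])
    fix t i assume t: "t \<in> {0..T}"
    show "(\<lambda>x. x t $ i) \<in> borel_measurable ?S"
    proof (rule borel_measurable_LIMSEQ_real)
      fix n
      have "coord_set {(i, t)}" using t by simp
      \<comment> \<open>The phase -pi/2 turns the cosine into a sine.\<close>
      then have "cos_coord {(i, t)} (\<lambda>_. 1 / real (Suc n)) (- pi / 2) \<in> trig_class"
        unfolding trig_class_def by blast
      then show "(\<lambda>w. real (Suc n) * cos_coord {(i, t)} (\<lambda>_. 1 / real (Suc n)) (- pi / 2) w) \<in> borel_measurable ?S"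
        by (intro borel_measurable_times borel_measurable_const f)
    next
      fix w
      have "cos (x + - pi / 2) = sin x" for x :: real
        using cos_sin_eq[of "x + - pi / 2"] by (simp add: sin_diff)
      then show "(\<lambda>n. real (Suc n) * cos_coord {(i, t)} (\<lambda>_. 1 / real (Suc n)) (- pi / 2) w) \<longlonglongrightarrow> w t $ i"
        using n_sin_over_n_tendsto[of "w t $ i"] by (simp add: cos_coord_def coordinate_functional_def)
    qed
  qed
  then show ?thesis unfolding se .
qed

lemma indicator_in_trig_closure: "B \<in> sets (pborel 0) \<Longrightarrow> indicator B \<in> trig.cl"
  using trig.indicator_in_closure sets_subset_trig_superlevels by blast

lemma trig_measurable:
  assumes "sets N = sets (pborel 0)" shows "trig_class \<subseteq> borel_measurable N"
proof
  fix f assume "f \<in> trig_class"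
  then have "f \<in> borel_measurable \<mu>" unfolding trig_class_def using cos_coord_measurable by blast
  then show "f \<in> borel_measurable N" using assms by (simp cong: measurable_cong_sets add: sets_\<mu>)
qed

end

section \<open>Densities from Watanabe's pullback\<close>

text \<open>\<open>F\<close> stands for the terminal value of the solution, of which only
  measurability and its pullback enter until the final push-forward.\<close>

locale bridge_setting = fbm_space T \<alpha> H \<mu> for T \<alpha> H and \<mu> :: "'d::finite path measure" +
  fixes F :: "'d path \<Rightarrow> real ^ 'e::finite" and \<delta> :: "real ^ 'e \<Rightarrow> ('d path \<Rightarrow> real) \<Rightarrow> real"
    and p :: "real ^ 'e \<Rightarrow> real" and \<mu>b :: "real ^ 'e \<Rightarrow> 'd path measure"
  assumes F_measurable[measurable]: "F \<in> borel_measurable \<mu>"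
    and delta: "watanabe_pullback T \<alpha> \<mu> F \<delta>"
    and density_eq: "p b = \<delta> b (\<lambda>_. 1)"
    and bridge: "p b > 0 \<Longrightarrow> sugita_measure T \<alpha> \<mu> (\<lambda>G. inverse (p b) * \<delta> b G) (\<mu>b b)"
begin

lemma trig_D_infinity: "G \<in> trig_class \<Longrightarrow> G \<in> D_infinity T \<alpha> \<mu>"
  using cos_coord_D_infinity by (auto simp: trig_class_def)

lemma trig_quasi_continuous: "G \<in> trig_class \<Longrightarrow> quasi_continuous_modification T \<alpha> \<mu> G G"
  using cos_coord_quasi_continuous by (auto simp: trig_class_def)

lemma trig_le_1: "G \<in> trig_class \<Longrightarrow> \<bar>G w\<bar> \<le> 1"
  by (auto simp: trig_class_def cos_coord_def)

lemma delta_continuous: "G \<in> trig_class \<Longrightarrow> continuous_on UNIV (\<lambda>b. \<delta> b G)"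
  using delta trig_D_infinity by (simp add: watanabe_pullback_def)

lemma delta_pairing:
  "G \<in> trig_class \<Longrightarrow> schwartz \<phi> \<Longrightarrow>
    has_bochner_integral lborel (\<lambda>b. \<phi> b * \<delta> b G) (\<integral>w. \<phi> (F w) * G w \<partial>\<mu>)"
  using delta trig_D_infinity by (simp add: watanabe_pullback_def)

lemma p_continuous: "continuous_on UNIV p"
  using delta_continuous[OF trig.one_M] by (simp add: density_eq)

lemma p_measurable[measurable]: "p \<in> borel_measurable borel"
  by (rule borel_measurable_continuous_onI[OF p_continuous])

lemma delta_measurable: "G \<in> trig_class \<Longrightarrow> (\<lambda>b. \<delta> b G) \<in> borel_measurable borel"
  by (rule borel_measurable_continuous_onI[OF delta_continuous])

text \<open>|r| <= 1 and |G| <= 1 make 1 + r G nonnegative, and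
  \<open>p b + r * \<delta> b G\<close> is the weak density of the tilted image measure, so
  \<open>schwartz_weak_density\<close> applies. r = 0 gives the law of F, r = 1 and r = -1 the
  two-sided bound on \<open>\<delta> b G\<close>.\<close>

lemma tilted_law:
  assumes G: "G \<in> trig_class" and r: "\<bar>r\<bar> \<le> 1"
  defines "\<nu> \<equiv> distr (density \<mu> (\<lambda>w. ennreal (1 + r * G w))) borel F"
  shows "0 \<le> p b + r * \<delta> b G" "\<nu> = density lborel (\<lambda>b. ennreal (p b + r * \<delta> b G))"
proof -
  have Gm[measurable]: "G \<in> borel_measurable \<mu>" using trig_measurable[OF sets_\<mu>] G by blast
  have nn: "0 \<le> 1 + r * G w" for w
  proof -
    have "\<bar>r * G w\<bar> \<le> 1" using mult_mono'[OF r trig_le_1[OF G]] by (simp add: abs_mult)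
    then show ?thesis by linarith
  qed
  have le2: "1 + r * G w \<le> 2" for w
  proof -
    have "\<bar>r * G w\<bar> \<le> 1" using mult_mono'[OF r trig_le_1[OF G]] by (simp add: abs_mult)
    then show ?thesis by linarith
  qed
  have fin: "finite_measure \<nu>"
  proof
    have "emeasure \<nu> (space \<nu>) = (\<integral>\<^sup>+w. ennreal (1 + r * G w) \<partial>\<mu>)"
      unfolding \<nu>_def by (simp add: emeasure_distr emeasure_density)
    also have "\<dots> \<le> (\<integral>\<^sup>+w. ennreal 2 \<partial>\<mu>)" by (intro nn_integral_mono ennreal_leI le2)
    also have "\<dots> < \<infinity>" using emeasure_space_1 by (simp add: ennreal_mult_less_top)
    finally show "emeasure \<nu> (space \<nu>) \<noteq> \<infinity>" by simp
  qed
  have sets: "sets \<nu> = sets borel" by (simp add: \<nu>_def)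
  have cont: "continuous_on UNIV (\<lambda>b. p b + r * \<delta> b G)"
    by (intro continuous_intros p_continuous delta_continuous[OF G])
  have weak: "has_bochner_integral lborel (\<lambda>b. \<phi> b * (p b + r * \<delta> b G)) (\<integral>x. \<phi> x \<partial>\<nu>)" if \<phi>: "schwartz \<phi>" for \<phi>
  proof -
    \<comment> \<open>\<open>schwartz\<close> speaks of iterated derivatives; the empty list of
      directions gives \<phi> itself.\<close>
    have d: "\<phi> differentiable (at x)" for x
    proof -
      have "iterated_derivative \<phi> [] = \<phi>" by (rule ext) simp
      then show ?thesis using \<phi> unfolding schwartz_def smooth_def by metis
    qed
    then have "continuous_on UNIV \<phi>"
      by (simp add: continuous_on_eq_continuous_at differentiable_imp_continuous_within)
    then have \<phi>m[measurable]: "\<phi> \<in> borel_measurable borel" by (rule borel_measurable_continuous_onI)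
    have "bounded (range (\<lambda>x. norm x ^ 0 * iterated_derivative \<phi> [] x))"
      using \<phi> unfolding schwartz_def by blast
    then obtain C where C: "\<And>x. \<bar>\<phi> x\<bar> \<le> C" unfolding bounded_iff by auto
    have i1: "integrable \<mu> (\<lambda>w. \<phi> (F w))"
      by (rule integrable_const_bound[of _ C]) (use C in auto)
    have i2: "integrable \<mu> (\<lambda>w. \<phi> (F w) * G w)"
      by (rule integrable_const_bound[of _ C])
        (use C mult_mono'[OF C trig_le_1[OF G]] in \<open>auto simp: abs_mult\<close>)
    have "has_bochner_integral lborel (\<lambda>b. \<phi> b * p b + r * (\<phi> b * \<delta> b G))
        ((\<integral>w. \<phi> (F w) \<partial>\<mu>) + r * (\<integral>w. \<phi> (F w) * G w \<partial>\<mu>))"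
      using delta_pairing[OF trig.one_M \<phi>] delta_pairing[OF G \<phi>]
      by (intro has_bochner_integral_add has_bochner_integral_mult_right) (simp_all add: density_eq)
    also have "(\<lambda>b. \<phi> b * p b + r * (\<phi> b * \<delta> b G)) = (\<lambda>b. \<phi> b * (p b + r * \<delta> b G))"
      by (simp add: algebra_simps)
    also have "(\<integral>w. \<phi> (F w) \<partial>\<mu>) + r * (\<integral>w. \<phi> (F w) * G w \<partial>\<mu>) = (\<integral>w. (1 + r * G w) * \<phi> (F w) \<partial>\<mu>)"
    proof -
      have "(\<lambda>w. (1 + r * G w) * \<phi> (F w)) = (\<lambda>w. \<phi> (F w) + r * (\<phi> (F w) * G w))"
        by (simp add: algebra_simps)
      then show ?thesis using i1 i2 by simp
    qed
    also have "\<dots> = (\<integral>x. \<phi> x \<partial>\<nu>)"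
      unfolding \<nu>_def using nn by (simp add: integral_distr integral_density)
    finally show ?thesis .
  qed
  show "0 \<le> p b + r * \<delta> b G" by (rule schwartz_weak_density(1)[OF fin sets cont weak])
  show "\<nu> = density lborel (\<lambda>b. ennreal (p b + r * \<delta> b G))"
    by (rule schwartz_weak_density(2)[OF fin sets cont weak])
qed

lemma p_nonneg: "0 \<le> p b"
  using tilted_law(1)[OF trig.one_M, of 0] by simp

lemma delta_le_p: "G \<in> trig_class \<Longrightarrow> \<bar>\<delta> b G\<bar> \<le> p b"
  using tilted_law(1)[of G 1 b] tilted_law(1)[of G "-1" b] by simp

lemma law_F: "distr \<mu> borel F = density lborel (\<lambda>b. ennreal (p b))"
  using tilted_law(2)[OF trig.one_M, of 0] by (simp add: density_1)

lemma p_integrable: "integrable lborel p"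
proof -
  have "(\<integral>\<^sup>+b. ennreal (p b) \<partial>lborel) = emeasure (distr \<mu> borel F) UNIV"
    unfolding law_F by (simp add: emeasure_density)
  also have "\<dots> = 1" by (simp add: emeasure_distr emeasure_space_1)
  finally show ?thesis using p_nonneg by (intro integrableI_nonneg) auto
qed

lemma delta_integrable: "G \<in> trig_class \<Longrightarrow> integrable lborel (\<lambda>b. \<delta> b G)"
  by (rule Bochner_Integration.integrable_bound[OF p_integrable])
    (use delta_measurable delta_le_p p_nonneg in auto)

text \<open>Subtracting the identity for r = 0 from that for r = 1 isolates G.\<close>

lemma delta_disintegration:
  assumes G: "G \<in> trig_class" and E: "E \<in> sets borel"
  shows "(\<integral>w. G w * indicator E (F w) \<partial>\<mu>) = (\<integral>b. indicator E b * \<delta> b G \<partial>lborel)"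
proof -
  have Gm[measurable]: "G \<in> borel_measurable \<mu>" using trig_measurable[OF sets_\<mu>] G by blast
  note E[measurable] note delta_measurable[OF G, measurable]
  have *: "(\<integral>w. (1 + r * G w) * indicator E (F w) \<partial>\<mu>) = (\<integral>b. (p b + r * \<delta> b G) * indicator E b \<partial>lborel)"
    if r: "\<bar>r\<bar> \<le> 1" for r
  proof -
    have nn: "0 \<le> 1 + r * G w" for w
    proof -
      have "\<bar>r * G w\<bar> \<le> 1" using mult_mono'[OF r trig_le_1[OF G]] by (simp add: abs_mult)
      then show ?thesis by linarith
    qed
    have "(\<integral>w. (1 + r * G w) * indicator E (F w) \<partial>\<mu>)
        = (\<integral>x. indicator E x \<partial>distr (density \<mu> (\<lambda>w. ennreal (1 + r * G w))) borel F)"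
      by (subst integral_distr, simp, simp, subst integral_density) (auto simp: nn)
    also have "\<dots> = (\<integral>x. indicator E x \<partial>density lborel (\<lambda>b. ennreal (p b + r * \<delta> b G)))"
      by (simp only: tilted_law(2)[OF G r])
    also have "\<dots> = (\<integral>b. (p b + r * \<delta> b G) * indicator E b \<partial>lborel)"
      using tilted_law(1)[OF G r] by (subst integral_density) auto
    finally show ?thesis .
  qed
  have iE: "integrable \<mu> (\<lambda>w. indicator E (F w) :: real)" by (rule integrable_const_bound[of _ 1]) auto
  have iGE: "integrable \<mu> (\<lambda>w. G w * indicator E (F w))"
    by (rule integrable_const_bound[of _ 1]) (use trig_le_1[OF G] in \<open>auto simp: indicator_def\<close>)
  have ipE: "integrable lborel (\<lambda>b. p b * indicator E b)"
    using integrable_real_mult_indicator[OF _ p_integrable, of E] E by simp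
  have idE: "integrable lborel (\<lambda>b. \<delta> b G * indicator E b)"
    using integrable_real_mult_indicator[OF _ delta_integrable[OF G], of E] E by simp
  have "(\<integral>w. (1 + 1 * G w) * indicator E (F w) \<partial>\<mu>) = (\<integral>w. indicator E (F w) \<partial>\<mu>) + (\<integral>w. G w * indicator E (F w) \<partial>\<mu>)"
    using iE iGE by (simp add: distrib_right)
  moreover have "(\<integral>b. (p b + 1 * \<delta> b G) * indicator E b \<partial>lborel)
      = (\<integral>b. p b * indicator E b \<partial>lborel) + (\<integral>b. \<delta> b G * indicator E b \<partial>lborel)"
    using ipE idE by (simp add: distrib_right)
  ultimately show ?thesis using *[of 1] *[of 0] by (simp add: mult.commute)
qed

text \<open>Where \<open>p\<close> vanishes, \<open>\<mu>\<close> is an arbitrary placeholder.\<close>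

definition kernel :: "real ^ 'e \<Rightarrow> 'd path measure" where
  "kernel b = (if p b > 0 then \<mu>b b else \<mu>)"

abbreviation K :: "real ^ 'e \<Rightarrow> ('d path \<Rightarrow> real) \<Rightarrow> real" where
  "K b f \<equiv> \<integral>w. f w \<partial>kernel b"

lemma sets_kernel: "sets (kernel b) = sets (pborel 0)"
  using bridge[of b] by (auto simp: kernel_def sugita_measure_def sets_\<mu>)

lemma space_kernel: "space (kernel b) = paths 0"
  using sets_eq_imp_space_eq[OF sets_kernel[of b]] by simp

lemma kernel_trig_integral:
  assumes G: "G \<in> trig_class"
  shows "(\<integral>w. G w \<partial>kernel b) = (if p b > 0 then \<delta> b G / p b else \<integral>w. G w \<partial>\<mu>)"
proof (cases "p b > 0")
  case True
  then have "has_bochner_integral (\<mu>b b) G (inverse (p b) * \<delta> b G)"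
    using bridge trig_D_infinity[OF G] trig_quasi_continuous[OF G] unfolding sugita_measure_def by blast
  then show ?thesis using True by (simp add: kernel_def has_bochner_integral_iff divide_inverse mult.commute)
qed (simp add: kernel_def)

text \<open>Sugita's identity for the functional 1 evaluates the total mass as
  \<open>\<delta> b (\<lambda>_. 1)\<close> divided by \<open>p b\<close>.\<close>

lemma prob_space_kernel: "prob_space (kernel b)"
proof (cases "p b > 0")
  case True
  then have "has_bochner_integral (\<mu>b b) (\<lambda>_. 1) (inverse (p b) * \<delta> b (\<lambda>_. 1))"
    and fin: "finite_measure (\<mu>b b)"
    using bridge trig_D_infinity[OF trig.one_M] trig_quasi_continuous[OF trig.one_M]
    unfolding sugita_measure_def by blast+
  then have "measure (\<mu>b b) (space (\<mu>b b)) = 1"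
    using True by (simp add: has_bochner_integral_iff density_eq[symmetric])
  then show ?thesis
    using True finite_measure.emeasure_eq_measure[OF fin] by (simp add: kernel_def prob_spaceI)
qed (simp add: kernel_def prob_space_axioms)

lemma delta_eq_kernel:
  assumes "G \<in> trig_class" shows "\<delta> b G = p b * (\<integral>w. G w \<partial>kernel b)"
proof (cases "p b > 0")
  case False
  then have "p b = 0" using p_nonneg[of b] by simp
  then show ?thesis using delta_le_p[OF assms, of b] by simp
qed (simp add: kernel_trig_integral[OF assms])

section \<open>Extension from cosines to Borel sets\<close>

lemma one_integrable_kernel: "integrable (kernel b) (\<lambda>_. 1 :: real)"
proof -
  interpret K: prob_space "kernel b" by (rule prob_space_kernel)
  show ?thesis by simp
qed

lemma closure_kernel_integrable:
  assumes "f \<in> trig.cl" shows "integrable (kernel b) f"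
  using trig.closure_weighted_integrable[OF assms space_kernel trig_measurable[OF sets_kernel] one_integrable_kernel]
  by simp

text \<open>On cosines the integral is a measurable case distinction between
  \<open>\<delta> b G / p b\<close> and a constant; measurability survives linear combinations and
  pointwise limits.\<close>

lemma closure_kernel_measurable:
  assumes "f \<in> trig.cl" shows "(\<lambda>b. K b f) \<in> borel_measurable borel"
  using assms
proof induction
  case (base f)
  note delta_measurable[OF base, measurable]
  show ?case unfolding kernel_trig_integral[OF base] by measurable
next
  case (lin f g x y)
  have "(\<lambda>b. \<integral>w. x * f w + y * g w \<partial>kernel b)
      = (\<lambda>b. x * (K b f) + y * (K b g))"
    using closure_kernel_integrable[OF lin.hyps(1)] closure_kernel_integrable[OF lin.hyps(2)] by simp
  then show ?case using lin.IH by simp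
next
  case (lim u C f)
  show ?case
  proof (rule borel_measurable_LIMSEQ_real[OF _ lim.IH])
    show "(\<lambda>n. K b (u n)) \<longlonglongrightarrow> (K b f)" for b
      using trig.closure_weighted_integral_tendsto[OF lim.hyps space_kernel trig_measurable[OF sets_kernel]
          one_integrable_kernel] by simp
  qed
qed

lemma kernel_integral_bound:
  assumes "f \<in> trig.cl" "\<And>w. w \<in> paths 0 \<Longrightarrow> \<bar>f w\<bar> \<le> C"
  shows "\<bar>K b f\<bar> \<le> C"
proof -
  interpret K: prob_space "kernel b" by (rule prob_space_kernel)
  have "\<bar>K b f\<bar> \<le> (\<integral>w. \<bar>f w\<bar> \<partial>kernel b)" by (rule integral_abs_bound)
  also have "\<dots> \<le> (\<integral>w. C \<partial>kernel b)"
    using closure_kernel_integrable[OF assms(1)] assms(2)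
    by (intro integral_mono) (auto simp: space_kernel)
  finally show ?thesis by (simp add: K.prob_space)
qed

lemma kernel_weighted_integrable:
  assumes f: "f \<in> trig.cl" and E: "E \<in> sets borel"
  shows "integrable lborel (\<lambda>b. indicator E b * (p b * (K b f)))"
proof -
  obtain C where C: "\<And>w. w \<in> paths 0 \<Longrightarrow> \<bar>f w\<bar> \<le> C"
    using trig.closure_bounded[OF f] by blast
  note E[measurable] note closure_kernel_measurable[OF f, measurable]
  show ?thesis
  proof (rule Bochner_Integration.integrable_bound)
    show "integrable lborel (\<lambda>b. p b * C)" using p_integrable by simp
    show "AE b in lborel. norm (indicator E b * (p b * (K b f))) \<le> norm (p b * C)"
    proof (rule AE_I2)
      fix b
      have "\<bar>K b f\<bar> \<le> \<bar>C\<bar>" using kernel_integral_bound[OF f C, of b] by linarith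
      then have "\<bar>p b\<bar> * \<bar>K b f\<bar> \<le> \<bar>p b\<bar> * \<bar>C\<bar>" by (rule mult_left_mono) simp
      then show "norm (indicator E b * (p b * (K b f))) \<le> norm (p b * C)"
        by (auto simp: abs_mult indicator_def)
    qed
  qed measurable
qed

text \<open>For integrands bounded by C the function \<open>p b * \<bar>C\<bar>\<close> is an
  integrable majorant, since every kernel is a probability measure; so the right-hand side passes to
  bounded limits as the left one does.\<close>

lemma closure_disintegration:
  assumes "f \<in> trig.cl" and E: "E \<in> sets borel"
  shows "(\<integral>w. f w * indicator E (F w) \<partial>\<mu>) = (\<integral>b. indicator E b * (p b * (K b f)) \<partial>lborel)"
  using assms(1)
proof induction
  case (base f)
  show ?case unfolding delta_disintegration[OF base E] delta_eq_kernel[OF base] ..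
next
  case (lin f g x y)
  note E[measurable]
  have iE: "integrable \<mu> (\<lambda>w. indicator E (F w) :: real)" by (rule integrable_const_bound[of _ 1]) auto
  note i = trig.closure_weighted_integrable[OF _ space_\<mu> trig_measurable[OF sets_\<mu>] iE]
  have "(\<integral>w. (x * f w + y * g w) * indicator E (F w) \<partial>\<mu>)
      = x * (\<integral>w. f w * indicator E (F w) \<partial>\<mu>) + y * (\<integral>w. g w * indicator E (F w) \<partial>\<mu>)"
    using i[OF lin.hyps(1)] i[OF lin.hyps(2)] by (simp add: distrib_right mult.assoc)
  also have "\<dots> = (\<integral>b. x * (indicator E b * (p b * (K b f)))
      + y * (indicator E b * (p b * (K b g))) \<partial>lborel)"
    using kernel_weighted_integrable[OF lin.hyps(1) E] kernel_weighted_integrable[OF lin.hyps(2) E]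
    by (simp add: lin.IH)
  also have "\<dots> = (\<integral>b. indicator E b * (p b * (\<integral>w. x * f w + y * g w \<partial>kernel b)) \<partial>lborel)"
    using closure_kernel_integrable[OF lin.hyps(1)] closure_kernel_integrable[OF lin.hyps(2)]
    by (simp add: algebra_simps)
  finally show ?case .
next
  case (lim u C f)
  note E[measurable]
  have f: "f \<in> trig.cl" using lim.hyps by (rule bounded_limit_closure.lim)
  have iE: "integrable \<mu> (\<lambda>w. indicator E (F w) :: real)" by (rule integrable_const_bound[of _ 1]) auto
  have 1: "(\<lambda>n. \<integral>w. u n w * indicator E (F w) \<partial>\<mu>) \<longlonglongrightarrow> (\<integral>w. f w * indicator E (F w) \<partial>\<mu>)"
    by (rule trig.closure_weighted_integral_tendsto[OF lim.hyps space_\<mu> trig_measurable[OF sets_\<mu>] iE])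
  have 2: "(\<lambda>n. \<integral>b. indicator E b * (p b * (K b (u n))) \<partial>lborel)
      \<longlonglongrightarrow> (\<integral>b. indicator E b * (p b * (K b f)) \<partial>lborel)"
  proof (rule integral_dominated_convergence)
    show "integrable lborel (\<lambda>b. p b * \<bar>C\<bar>)" using p_integrable by simp
    show "(\<lambda>b. indicator E b * (p b * (K b f))) \<in> borel_measurable lborel"
      using kernel_weighted_integrable[OF f E] by (rule borel_measurable_integrable)
    show "(\<lambda>b. indicator E b * (p b * (K b (u n)))) \<in> borel_measurable lborel" for n
      using kernel_weighted_integrable[OF lim.hyps(1) E] by (rule borel_measurable_integrable)
    have "(\<lambda>n. K b (u n)) \<longlonglongrightarrow> (K b f)" for b
      using trig.closure_weighted_integral_tendsto[OF lim.hyps space_kernel trig_measurable[OF sets_kernel]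
          one_integrable_kernel] by simp
    then show "AE b in lborel. (\<lambda>n. indicator E b * (p b * (K b (u n))))
        \<longlonglongrightarrow> indicator E b * (p b * (K b f))"
      by (intro AE_I2 tendsto_intros)
    show "AE b in lborel. norm (indicator E b * (p b * (K b (u n)))) \<le> p b * \<bar>C\<bar>" for n
    proof (rule AE_I2)
      fix b
      have "\<bar>K b (u n)\<bar> \<le> \<bar>C\<bar>"
        using kernel_integral_bound[OF lim.hyps(1)[of n] lim.hyps(2)[of _ n], where b = b] by simp
      then have "p b * \<bar>K b (u n)\<bar> \<le> p b * \<bar>C\<bar>" using p_nonneg by (rule mult_left_mono)
      then show "norm (indicator E b * (p b * (K b (u n)))) \<le> p b * \<bar>C\<bar>"
        using p_nonneg[of b] by (auto simp: abs_mult indicator_def)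
    qed
  qed
  show ?case using 1 2 unfolding lim.IH by (rule LIMSEQ_unique)
qed

lemma kernel_emeasure:
  assumes "B \<in> sets (pborel 0)"
  shows "emeasure (kernel b) B = ennreal (K b (indicator B))"
proof -
  interpret K: prob_space "kernel b" by (rule prob_space_kernel)
  show ?thesis using assms by (simp add: sets_kernel K.emeasure_eq_measure)
qed

lemma kernel_emeasure_measurable:
  assumes "B \<in> sets (pborel 0)"
  shows "(\<lambda>b. emeasure (kernel b) B) \<in> borel_measurable borel"
  unfolding kernel_emeasure[OF assms]
  using closure_kernel_measurable[OF indicator_in_trig_closure[OF assms]] by measurable

lemma kernel_disintegration:
  assumes B: "B \<in> sets (pborel 0)" and E: "E \<in> sets borel"
  shows "emeasure \<mu> (B \<inter> F -` E) = (\<integral>\<^sup>+b. ennreal (p b) * (emeasure (kernel b) B * indicator E b) \<partial>lborel)"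
proof -
  note ind = indicator_in_trig_closure[OF B]
  have Bs: "B \<subseteq> space \<mu>" using sets.sets_into_space[OF B] by (simp add: space_\<mu>)
  have BE: "B \<inter> F -` E \<in> sets \<mu>"
  proof -
    have "B \<inter> F -` E = B \<inter> (F -` E \<inter> space \<mu>)" using Bs by auto
    then show ?thesis using B E measurable_sets[OF F_measurable E] by (simp add: sets_\<mu> sets.Int)
  qed
  have "emeasure \<mu> (B \<inter> F -` E) = ennreal (\<integral>w. indicator (B \<inter> F -` E) w \<partial>\<mu>)"
    using BE by (simp add: emeasure_eq_measure)
  also have "(\<integral>w. indicator (B \<inter> F -` E) w \<partial>\<mu>) = (\<integral>w. indicator B w * indicator E (F w) \<partial>\<mu> :: real)"
    by (intro Bochner_Integration.integral_cong) (auto simp: indicator_def)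
  also have "\<dots> = (\<integral>b. indicator E b * (p b * (K b (indicator B))) \<partial>lborel)"
    by (rule closure_disintegration[OF ind E])
  also have "ennreal \<dots> = (\<integral>\<^sup>+b. ennreal (indicator E b * (p b * (K b (indicator B)))) \<partial>lborel)"
    using kernel_weighted_integrable[OF ind E] p_nonneg
    by (intro nn_integral_eq_integral[symmetric] AE_I2 mult_nonneg_nonneg Bochner_Integration.integral_nonneg) auto
  also have "\<dots> = (\<integral>\<^sup>+b. ennreal (p b) * (emeasure (kernel b) B * indicator E b) \<partial>lborel)"
  proof (rule nn_integral_cong)
    fix b
    define r where "r = (K b (indicator B) :: real)"
    have "0 \<le> r" unfolding r_def by (intro Bochner_Integration.integral_nonneg) auto
    then show "ennreal (indicator E b * (p b * (K b (indicator B))))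
        = ennreal (p b) * (emeasure (kernel b) B * indicator E b)"
      unfolding kernel_emeasure[OF B] r_def[symmetric] using p_nonneg[of b]
      by (cases "b \<in> E") (simp_all add: ennreal_mult)
  qed
  finally show ?thesis .
qed

text \<open>Where p is positive, \<open>bridge_law\<close> is the push-forward of the kernel.
  Elsewhere the Dirac mass takes over, and the density p of the law of F hides the change.\<close>

lemma bridge_law_conditional:
  assumes \<Phi>: "\<Phi> \<in> measurable (pborel 0) (pborel (a :: real ^ 'e))"
    and F: "F = (\<lambda>w. \<Phi> w T)"
  shows "regular_conditional_probability
    (distr \<mu> (pborel a) \<Phi>) borel (\<lambda>z. z T) (bridge_law T \<alpha> a \<Phi> p \<mu>b)"
proof -
  let ?PB = "pborel a" and ?K = "bridge_law T \<alpha> a \<Phi> p \<mu>b"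
  have \<Phi>\<mu>: "\<Phi> \<in> measurable \<mu> ?PB" using \<Phi> by (simp cong: measurable_cong_sets add: sets_\<mu>)
  have \<Phi>K: "\<Phi> \<in> measurable (kernel b) ?PB" for b
    using \<Phi> by (simp cong: measurable_cong_sets add: sets_kernel)
  have ev: "(\<lambda>z. z T) \<in> borel_measurable ?PB"
    using T_pos by (intro continuous_map_measurable_path_borel continuous_map_eval) simp
  have K: "?K b = (if p b > 0 then distr (kernel b) ?PB \<Phi> else return ?PB (linear_path T a b))" for b
    by (simp add: bridge_law_def kernel_def)
  let ?pre = "\<lambda>A. \<Phi> -` A \<inter> paths 0"
  have pre: "?pre A \<in> sets (pborel 0)" if "A \<in> sets ?PB" for A
    using measurable_sets[OF \<Phi> that] by simp
  have KA: "emeasure (?K b) A = (if p b > 0 then emeasure (kernel b) (?pre A)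
      else indicator A (linear_path T a b))" if "A \<in> sets ?PB" for A b
    using that emeasure_distr[OF \<Phi>K that] by (simp add: K space_kernel)
  show ?thesis
    unfolding regular_conditional_probability_def
  proof (intro conjI ballI)
    fix b
    show "prob_space (?K b)"
      unfolding K using prob_space.prob_space_distr[OF prob_space_kernel \<Phi>K] linear_path_mem
      by (auto intro!: prob_space_return)
    show "space (?K b) = space (distr \<mu> ?PB \<Phi>)" "sets (?K b) = sets (distr \<mu> ?PB \<Phi>)"
      by (simp_all add: K)
  next
    fix A assume "A \<in> sets (distr \<mu> ?PB \<Phi>)"
    then have A: "A \<in> sets ?PB" by simp
    note kernel_emeasure_measurable[OF pre[OF A], measurable] and linear_path_measurable[of a, measurable] and A[measurable]
    show "(\<lambda>b. emeasure (?K b) A) \<in> borel_measurable borel"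
      unfolding KA[OF A] by measurable
  next
    fix A E assume "A \<in> sets (distr \<mu> ?PB \<Phi>)" and E: "E \<in> sets (borel :: (real ^ 'e) measure)"
    then have A: "A \<in> sets ?PB" by simp
    note kernel_emeasure_measurable[OF pre[OF A], measurable] and linear_path_measurable[of a, measurable]
      and A[measurable] and E[measurable]
    have AE: "A \<inter> (\<lambda>z. z T) -` E \<in> sets ?PB"
    proof -
      have "A \<inter> (\<lambda>z. z T) -` E = A \<inter> ((\<lambda>z. z T) -` E \<inter> space ?PB)"
        using sets.sets_into_space[OF A] by auto
      then show ?thesis using A measurable_sets[OF ev E] by (simp add: sets.Int)
    qed
    have "emeasure (distr \<mu> ?PB \<Phi>) (A \<inter> (\<lambda>z. z T) -` E) = emeasure \<mu> (?pre A \<inter> F -` E)"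
      unfolding emeasure_distr[OF \<Phi>\<mu> AE] space_\<mu> F by (rule arg_cong[where f = "emeasure \<mu>"]) auto
    also have "\<dots> = (\<integral>\<^sup>+b. ennreal (p b) * (emeasure (kernel b) (?pre A) * indicator E b) \<partial>lborel)"
      by (rule kernel_disintegration[OF pre[OF A] E])
    also have "\<dots> = (\<integral>\<^sup>+b. ennreal (p b) * (emeasure (?K b) A * indicator E b) \<partial>lborel)"
    proof (rule nn_integral_cong)
      fix b
      \<comment> \<open>Where p vanishes both sides are 0, whatever the two kernels are.\<close>
      show "ennreal (p b) * (emeasure (kernel b) (?pre A) * indicator E b)
          = ennreal (p b) * (emeasure (?K b) A * indicator E b)"
        using p_nonneg[of b] by (cases "p b > 0") (simp_all add: KA[OF A])
    qed
    also have "\<dots> = (\<integral>\<^sup>+b\<in>E. emeasure (?K b) A \<partial>density lborel (\<lambda>b. ennreal (p b)))"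
      unfolding KA[OF A] by (subst nn_integral_density) auto
    also have "density lborel (\<lambda>b. ennreal (p b)) = distr (distr \<mu> ?PB \<Phi>) borel (\<lambda>z. z T)"
      unfolding law_F[symmetric] distr_distr[OF ev \<Phi>\<mu>] by (simp add: F o_def)
    finally show "emeasure (distr \<mu> ?PB \<Phi>) (A \<inter> (\<lambda>z. z T) -` E)
        = (\<integral>\<^sup>+b\<in>E. emeasure (?K b) A \<partial>distr (distr \<mu> ?PB \<Phi>) borel (\<lambda>z. z T))" .
  qed
qed

end

theorem theorem7p1:
  fixes T \<alpha> H :: real
    and V0 :: "real ^ 'e::finite \<Rightarrow> real ^ 'e"
    and V :: "'d::finite \<Rightarrow> real ^ 'e \<Rightarrow> real ^ 'e"
    and a :: "real ^ 'e"
    and \<mu> :: "'d path measure"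
    and \<Phi> :: "'d path \<Rightarrow> 'e path"
    and \<delta> :: "real ^ 'e \<Rightarrow> ('d path \<Rightarrow> real) \<Rightarrow> real"
    and p :: "real ^ 'e \<Rightarrow> real"
    and \<mu>b :: "real ^ 'e \<Rightarrow> 'd path measure"
  assumes "0 < T" and "1 / 2 < \<alpha>" and "\<alpha> < H" and "H < 1"
    and "C_b_infinity V0" and "\<And>j. C_b_infinity (V j)"
    and fbm: "fbm_law T \<alpha> H \<mu>"
    and flow: "\<And>w. w \<in> little_hoelder_at T \<alpha> 0 \<Longrightarrow> young_solution T \<alpha> V0 V a w (\<Phi> w)"
    and nondeg: "nondegenerate T \<alpha> \<mu> (\<lambda>w. \<Phi> w T)"
    and delta: "watanabe_pullback T \<alpha> \<mu> (\<lambda>w. \<Phi> w T) \<delta>"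
    and density: "\<And>b. p b = \<delta> b (\<lambda>_. 1)"
    and bridge: "\<And>b. p b > 0 \<Longrightarrow> sugita_measure T \<alpha> \<mu> (\<lambda>G. inverse (p b) * \<delta> b G) (\<mu>b b)"
  shows "regular_conditional_probability
    (distr \<mu> (path_borel T \<alpha> a) \<Phi>) borel (\<lambda>z. z T) (bridge_law T \<alpha> a \<Phi> p \<mu>b)"
proof -
  \<comment> \<open>From \<alpha> < H < 1 comes \<alpha> <= 1, as the Hoelder estimates
    require.\<close>
  obtain M where "young_flow T \<alpha> V0 V (real CARD('d)) M"
    using young_flow_exists[of T \<alpha> V0 V] assms(1-6) by auto
  then interpret Y: young_flow T \<alpha> V0 V a "real CARD('d)" M .
  have \<Phi>: "\<Phi> \<in> measurable (path_borel T \<alpha> 0) (path_borel T \<alpha> a)"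
    by (rule Y.flow_measurable[OF flow])
  interpret fbm_space T \<alpha> H \<mu> by unfold_locales (rule fbm)
  have "\<Phi> \<in> measurable \<mu> (path_borel T \<alpha> a)"
    using \<Phi> by (simp cong: measurable_cong_sets add: sets_\<mu>)
  moreover have "(\<lambda>z. z T) \<in> borel_measurable (path_borel T \<alpha> a)"
    using \<open>0 < T\<close> by (intro Y.continuous_map_measurable_path_borel Y.continuous_map_eval) simp
  ultimately have "(\<lambda>w. \<Phi> w T) \<in> borel_measurable \<mu>" by (rule measurable_compose)
  then interpret bridge_setting T \<alpha> H \<mu> "\<lambda>w. \<Phi> w T" \<delta> p \<mu>b
    by unfold_locales (use delta density bridge in auto)
  show ?thesis by (rule bridge_law_conditional[OF \<Phi> refl])
qed

end
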